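(* Let $\mathbb{K}$ be a field, $R=\mathbb{K}[x_0,x_1,x_2]$, and let $\mathcal{F}:\mathbb{P}^2_{\mathbb{K}}\dashrightarrow\mathbb{P}^2_{\mathbb{K}}$ be a dominant rational map defined by homogeneous polynomials $f_0,f_1,f_2\in R$ of the same degree $d$, whose base ideal $I=(f_0,f_1,f_2)$ is saturated with $\dim(R/I)=1$. Let $$0\to R(-d-\mu_1)\oplus R(-d-\mu_2)\xrightarrow{\ \varphi\ }R(-d)^3\to I\to0$$ be the Hilbert–Burch presentation of $I$, with $\mu_1+\mu_2=d$, $\mu_1\le\mu_2$, and suppose that $\mu_1=1$ and $d\ge3$. Then $\mathcal{F}$ is birational if and only if the following conditions are satisfied: (i) $\mathrm{ht}(I_1(\varphi))=2$. (ii) After a linear change of coordinates bringing $\varphi$ to the form $$\varphi=\begin{pmatrix}x_0&p_0\\-x_1&p_1\\0&p_2\end{pmatrix},$$ the number $m$ of Sylvester forms produced by the algorithm described in the context satisfies $m=d-2$.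
   Context: $I$ saturated means $I=(I:(x_0,x_1,x_2)^\infty)$; then $I$ has a Hilbert–Burch presentation, with $I$ generated by the maximal minors of the $3\times2$ matrix $\varphi$, whose first and second columns have entries homogeneous of degrees $\mu_1$ and $\mu_2$. $I_1(\varphi)$ is the ideal generated by the entries of $\varphi$ and $\mathrm{ht}$ is height. If $\mu_1=1$ and $\mathrm{ht}(I_1(\varphi))=2$, the linear forms in the first column of $\varphi$ span a $2$-dimensional space, and by linear changes of coordinates (of the variables $x_0,x_1,x_2$ and of the generators $f_0,f_1,f_2$, i.e. in source and target) one may put $\varphi$ in the form displayed in (ii). Algorithm (Sylvester forms), for $\varphi$ in the displayed form. In $\mathcal{A}=\mathbb{K}[x_0,x_1,x_2,y_0,y_1,y_2]$, bigraded with $x_i$ of bi-degree $(1,0)$ and $y_j$ of bi-degree $(0,1)$, put $g_1=x_0y_0-x_1y_1$, $g_2=p_0y_0+p_1y_1+p_2y_2$. Start with $i=0$, $F_0=g_2$. While $F_i\in(x_0,x_1)$: write $F_i=(F_i)_{x_0}x_0+(F_i)_{x_1}x_1$ with bi-homogeneous $(F_i)_{x_0},(F_i)_{x_1}\in\mathcal{A}$, set $$F_{i+1}=\det\begin{pmatrix}y_0&-y_1\\(F_i)_{x_0}&(F_i)_{x_1}\end{pmatrix},$$ and replace $i$ by $i+1$. When $F_i\notin(x_0,x_1)$, stop and put $m=i$; the Sylvester forms are $F_1,\ldots,F_m$, and $F_i$ has bi-degree $(d-1-i,i+1)$. $\mathcal{F}$ is birational if it is dominant with an inverse rational map. *)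

theory Defs
  imports
    "HOL-Analysis.Analysis"
    "HOL-Library.Poly_Mapping"
    "HOL-Library.Extended_Nat"
begin

section \<open>Polynomial rings\<close>

text \<open>
  The ring K[x_v : v in V], with V a finite type, is the type of finitely supported functions
  from exponent vectors to K, with the convolution product of \<^theory>\<open>HOL-Library.Poly_Mapping\<close>.
  Thus R = K[x_0,x_1,x_2] has index type 3, whose elements are 0, 1 and 2, and
  K[x_0,x_1,x_2,y_0,y_1,y_2] has index type 3 + 3, with Inl i for x_i and Inr j for y_j.
\<close>

type_synonym ('v, 'k) mpoly = "('v \<Rightarrow>\<^sub>0 nat) \<Rightarrow>\<^sub>0 'k"
type_synonym 'k R = "(3, 'k) mpoly"
type_synonym 'k A = "(3 + 3, 'k) mpoly"

definition mvar :: "'v \<Rightarrow> ('v, 'k::field) mpoly" where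
  "mvar v = Poly_Mapping.single (Poly_Mapping.single v 1) 1"

definition mconst :: "'k::field \<Rightarrow> ('v, 'k) mpoly" where
  "mconst c = Poly_Mapping.single 0 c"

text \<open>The K-algebra homomorphism sending each variable v to s v.\<close>

definition msubst :: "('v::finite \<Rightarrow> ('w, 'k::field) mpoly) \<Rightarrow> ('v, 'k) mpoly \<Rightarrow> ('w, 'k) mpoly" where
  "msubst s p = (\<Sum>m\<in>Poly_Mapping.keys p.
     mconst (Poly_Mapping.lookup p m) * (\<Prod>v\<in>UNIV. s v ^ Poly_Mapping.lookup m v))"

text \<open>As usual, 0 is (bi-)homogeneous of every (bi-)degree.\<close>

definition homogeneous :: "nat \<Rightarrow> ('v::finite, 'k::field) mpoly \<Rightarrow> bool" where
  "homogeneous d p \<longleftrightarrow>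
     (\<forall>m\<in>Poly_Mapping.keys p. (\<Sum>v\<in>UNIV. Poly_Mapping.lookup m v) = d)"

definition bihomogeneous :: "nat \<Rightarrow> nat \<Rightarrow> 'k::field A \<Rightarrow> bool" where
  "bihomogeneous a b p \<longleftrightarrow>
     (\<forall>m\<in>Poly_Mapping.keys p.
        (\<Sum>i\<in>UNIV. Poly_Mapping.lookup m (Inl i)) = a \<and>
        (\<Sum>j\<in>UNIV. Poly_Mapping.lookup m (Inr j)) = b)"


section \<open>Ideals, Krull dimension and height\<close>

text \<open>Ideals are the submodules of a commutative ring regarded as a module over itself.\<close>

abbreviation is_ideal :: "'a::comm_ring_1 set \<Rightarrow> bool" where
  "is_ideal \<equiv> module.subspace (*)"

abbreviation ideal_gen :: "'a::comm_ring_1 set \<Rightarrow> 'a set" where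
  "ideal_gen \<equiv> module.span (*)"

definition is_prime_ideal :: "'a::comm_ring_1 set \<Rightarrow> bool" where
  "is_prime_ideal P \<longleftrightarrow>
     is_ideal P \<and> P \<noteq> UNIV \<and> (\<forall>a b. a * b \<in> P \<longrightarrow> a \<in> P \<or> b \<in> P)"

definition ideal_mult :: "'a::comm_ring_1 set \<Rightarrow> 'a set \<Rightarrow> 'a set" where
  "ideal_mult I J = ideal_gen {a * b | a b. a \<in> I \<and> b \<in> J}"

primrec ideal_power :: "'a::comm_ring_1 set \<Rightarrow> nat \<Rightarrow> 'a set" where
  "ideal_power J 0 = UNIV"
| "ideal_power J (Suc n) = ideal_mult J (ideal_power J n)"

definition ideal_colon :: "'a::comm_ring_1 set \<Rightarrow> 'a set \<Rightarrow> 'a set" where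
  "ideal_colon I J = {a. \<forall>b\<in>J. a * b \<in> I}"

definition ideal_saturation :: "'a::comm_ring_1 set \<Rightarrow> 'a set \<Rightarrow> 'a set" where
  "ideal_saturation I J = (\<Union>n. ideal_colon I (ideal_power J n))"

definition irrelevant_ideal :: "'k::field R set" where
  "irrelevant_ideal = ideal_gen (range mvar)"

definition saturated :: "'k::field R set \<Rightarrow> bool" where
  "saturated I \<longleftrightarrow> I = ideal_saturation I irrelevant_ideal"

text \<open>A strict chain c 0 < ... < c n of prime ideals, of length n.\<close>

definition prime_chain :: "(nat \<Rightarrow> 'a::comm_ring_1 set) \<Rightarrow> nat \<Rightarrow> bool" where
  "prime_chain c n \<longleftrightarrow>
     (\<forall>i\<le>n. is_prime_ideal (c i)) \<and> (\<forall>i<n. c i \<subset> c (Suc i))"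

text \<open>
  The Krull dimension of the quotient by I; the primes of the quotient are those containing I.
  Since suprema are taken in enat, the zero ring gets dimension 0.
\<close>

definition dim_quotient :: "'a::comm_ring_1 set \<Rightarrow> enat" where
  "dim_quotient I = (SUP n\<in>{n. \<exists>c. prime_chain c n \<and> I \<subseteq> c 0}. enat n)"

definition prime_height :: "'a::comm_ring_1 set \<Rightarrow> enat" where
  "prime_height P = (SUP n\<in>{n. \<exists>c. prime_chain c n \<and> c n = P}. enat n)"

definition height :: "'a::comm_ring_1 set \<Rightarrow> enat" where
  "height I = (INF P\<in>{P. is_prime_ideal P \<and> I \<subseteq> P}. prime_height P)"


section \<open>Rational maps of the projective plane\<close>

text \<open>
  The underlying topological space of the scheme P^2 = Proj R, with its Zariski topology. Points
  are not only the K-rational ones, so density is meaningful over finite fields as well.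
\<close>

definition homogeneous_ideal :: "'k::field R set \<Rightarrow> bool" where
  "homogeneous_ideal P \<longleftrightarrow> P = ideal_gen {h \<in> P. \<exists>n. homogeneous n h}"

definition proj_points :: "'k::field R set set" where
  "proj_points =
     {P. is_prime_ideal P \<and> homogeneous_ideal P \<and> \<not> irrelevant_ideal \<subseteq> P}"

definition zariski_topology :: "'k::field R set topology" where
  "zariski_topology = topology_generated_by
     {{P \<in> proj_points. h \<notin> P} | h. \<exists>n. homogeneous n h}"

text \<open>
  A triple f of forms of the same degree, not all zero, represents the rational map
  (f_0 : f_1 : f_2). Two triples represent the same map iff they are proportional.
\<close>

definition rational_map :: "nat \<Rightarrow> 'k::field R ^ 3 \<Rightarrow> bool" where
  "rational_map d f \<longleftrightarrow> (\<forall>i. homogeneous d (f $ i)) \<and> f \<noteq> 0"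

definition same_rational_map :: "'k::field R ^ 3 \<Rightarrow> 'k R ^ 3 \<Rightarrow> bool" where
  "same_rational_map f g \<longleftrightarrow>
     f \<noteq> 0 \<and> g \<noteq> 0 \<and> (\<forall>i j. f $ i * g $ j = f $ j * g $ i)"

text \<open>First f, then g; the composite is defined as a rational map iff this triple is nonzero.\<close>

definition rational_comp :: "'k::field R ^ 3 \<Rightarrow> 'k R ^ 3 \<Rightarrow> 'k R ^ 3" where
  "rational_comp g f = (\<chi> i. msubst (\<lambda>j. f $ j) (g $ i))"

definition rational_id :: "'k::field R ^ 3" where
  "rational_id = (\<chi> i. mvar i)"

text \<open>
  On points, the rational map is induced by the ring homomorphism y_j \<mapsto> f_j: it sends P to the
  homogeneous part of the preimage of P, and it is defined where the f_j do not all vanish.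
\<close>

definition rational_domain :: "'k::field R ^ 3 \<Rightarrow> 'k R set set" where
  "rational_domain f = {P \<in> proj_points. \<exists>j. f $ j \<notin> P}"

definition rational_point :: "'k::field R ^ 3 \<Rightarrow> 'k R set \<Rightarrow> 'k R set" where
  "rational_point f P =
     ideal_gen {h. (\<exists>n. homogeneous n h) \<and> msubst (\<lambda>j. f $ j) h \<in> P}"

definition dominant :: "'k::field R ^ 3 \<Rightarrow> bool" where
  "dominant f \<longleftrightarrow>
     zariski_topology closure_of (rational_point f ` rational_domain f) = proj_points"

definition birational :: "'k::field R ^ 3 \<Rightarrow> bool" where
  "birational f \<longleftrightarrow> dominant f \<and>
     (\<exists>e g. rational_map e g \<and>
        same_rational_map (rational_comp g f) rational_id \<and>
        same_rational_map (rational_comp f g) rational_id)"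


section \<open>Hilbert--Burch presentations\<close>

definition base_ideal :: "'k::field R ^ 3 \<Rightarrow> 'k R set" where
  "base_ideal f = ideal_gen (range (\<lambda>i. f $ i))"

text \<open>
  Exactness of 0 -> R(-d-mu1) + R(-d-mu2) -> R(-d)^3 -> I -> 0, where I is the base ideal of the
  forms f of degree d. The columns of phi have the indices 0 and 1 of type 2, and their degrees
  say that the maps respect the gradings.
\<close>

definition hilbert_burch_presentation ::
    "nat \<Rightarrow> nat \<Rightarrow> 'k::field R ^ 3 \<Rightarrow> 'k R ^ 2 ^ 3 \<Rightarrow> bool" where
  "hilbert_burch_presentation \<mu>1 \<mu>2 f \<phi> \<longleftrightarrow>
     (\<forall>i. homogeneous \<mu>1 (\<phi> $ i $ 0)) \<and>
     (\<forall>i. homogeneous \<mu>2 (\<phi> $ i $ 1)) \<and>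
     (\<forall>v. \<phi> *v v = 0 \<longrightarrow> v = 0) \<and>
     range (\<lambda>v. \<phi> *v v) = {w. (\<Sum>i\<in>UNIV. f $ i * w $ i) = 0} \<and>
     range (\<lambda>w. \<Sum>i\<in>UNIV. f $ i * w $ i) = base_ideal f"

definition entry_ideal :: "'k::field R ^ 2 ^ 3 \<Rightarrow> 'k R set" where
  "entry_ideal \<phi> = ideal_gen {\<phi> $ i $ j | i j. True}"

text \<open>
  Linear changes of coordinates: M acts on the variables, and N on the generators (f being
  multiplied by the inverse of N), hence on the rows of phi.
\<close>

definition linear_change :: "'k::field ^ 3 ^ 3 \<Rightarrow> 'k R \<Rightarrow> 'k R" where
  "linear_change M = msubst (\<lambda>i. \<Sum>j\<in>UNIV. mconst (M $ i $ j) * mvar j)"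

definition displayed_form :: "'k::field R ^ 3 \<Rightarrow> 'k R ^ 2 ^ 3" where
  "displayed_form p = (\<chi> i j.
     if j = 0 then (if i = 0 then mvar 0 else if i = 1 then - mvar 1 else 0) else p $ i)"

definition coordinate_change ::
    "'k::field ^ 3 ^ 3 \<Rightarrow> 'k ^ 3 ^ 3 \<Rightarrow> 'k R ^ 2 ^ 3 \<Rightarrow> 'k R ^ 3 \<Rightarrow> bool" where
  "coordinate_change M N \<phi> p \<longleftrightarrow> invertible M \<and> invertible N \<and>
     map_matrix mconst N ** map_matrix (linear_change M) \<phi> = displayed_form p"


section \<open>Sylvester forms\<close>

abbreviation xA :: "3 \<Rightarrow> 'k::field A" where "xA i \<equiv> mvar (Inl i)"
abbreviation yA :: "3 \<Rightarrow> 'k::field A" where "yA j \<equiv> mvar (Inr j)"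

definition embed_R :: "'k::field R \<Rightarrow> 'k A" where
  "embed_R = msubst xA"

definition g2 :: "'k::field R ^ 3 \<Rightarrow> 'k A" where
  "g2 p = (\<Sum>j\<in>UNIV. embed_R (p $ j) * yA j)"

definition x01_ideal :: "'k::field A set" where
  "x01_ideal = ideal_gen {xA 0, xA 1}"

definition sylvester_step :: "'k::field A \<Rightarrow> 'k A \<Rightarrow> bool" where
  "sylvester_step F F' \<longleftrightarrow>
     (\<exists>a b. (\<exists>k l. bihomogeneous k l a) \<and> (\<exists>k l. bihomogeneous k l b) \<and>
        F = a * xA 0 + b * xA 1 \<and>
        F' = det (vector [vector [yA 0, - yA 1], vector [a, b]] :: 'k A ^ 2 ^ 2))"

text \<open>
  A terminating run F_0, ..., F_m of the algorithm. The decompositions in its steps are not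
  unique, so a run is a relation; an algorithm that never stops has no run.
\<close>

definition sylvester_run :: "'k::field R ^ 3 \<Rightarrow> nat \<Rightarrow> (nat \<Rightarrow> 'k A) \<Rightarrow> bool" where
  "sylvester_run p m F \<longleftrightarrow> F 0 = g2 p \<and>
     (\<forall>i<m. F i \<in> x01_ideal \<and> sylvester_step (F i) (F (Suc i))) \<and>
     F m \<notin> x01_ideal"

text \<open>
  The number of Sylvester forms is n for some change of coordinates and some choice of the
  decompositions, respectively for all of them (and there are some).
\<close>

definition some_sylvester_number :: "'k::field R ^ 2 ^ 3 \<Rightarrow> nat \<Rightarrow> bool" where
  "some_sylvester_number \<phi> n \<longleftrightarrow>
     (\<exists>M N p F. coordinate_change M N \<phi> p \<and> sylvester_run p n F)"

definition every_sylvester_number :: "'k::field R ^ 2 ^ 3 \<Rightarrow> nat \<Rightarrow> bool" where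
  "every_sylvester_number \<phi> n \<longleftrightarrow>
     (\<exists>M N p. coordinate_change M N \<phi> p) \<and>
     (\<forall>M N p. coordinate_change M N \<phi> p \<longrightarrow>
        (\<exists>F. sylvester_run p n F) \<and> (\<forall>m F. sylvester_run p m F \<longrightarrow> m = n))"

end

theory Submission
  imports Defs "HOL-Computational_Algebra.Fraction_Field"
begin

text \<open>
  Write l and p for the two columns of the presentation matrix, of degrees 1 and n = d - 1, and
  \<delta> = l \<times> p for its minors. The vector f is orthogonal to both columns, hence proportional to
  \<delta>, so that f and \<delta> define the same rational map. Dominance means that no nonzero form
  vanishes at f; it turns every left inverse of f into a two-sided one, so f is birational iff some
  triple g of forms satisfies that g(f) is a nonzero multiple of x
  (\<open>birational_iff_has_inverse\<close>).

  Suppose that the linear column is (x_0, -x_1, 0). The graph of f lies in g_1 = g_2 = 0, and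
  g_1 = x_0 y_0 - x_1 y_1 is parametrized by x = (y_1, y_0, w). Substituting this in g_2 gives the
  eliminant C, a polynomial in w over K[y]. A Sylvester step does not change the image under this
  substitution, and the i-th form, of bidegree (n - i, i + 1), lies in (x_0, x_1) iff the coefficient
  of w^(n - i) in C is zero. Hence every run of the algorithm has length n - deg C, whatever
  decompositions are chosen (\<open>sylvester_run_length\<close>, \<open>sylvester_run_exists\<close>), and it
  has to be shown that f has a left inverse iff deg C = 1. The degree of C in w is the
  degree of f as a rational map.

  If C = h w + k, then solving for w yields the inverse (y_1 h, y_0 h, -k). Conversely let g be a left
  inverse. Put A = x_0 p_1 + x_1 p_0 and B = p_2, so that \<delta> = (-x_1 B, -x_0 B, A). Modulo
  E = A + T B the vector \<delta> is -B times (x_1, x_0, T); hence E divides a power of B times the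
  2 \<times> 2 minors of x and g(x_1, x_0, T). Here B can be cancelled up to a factor free of x_2, and the
  minors have degree at most 1 in x_2, so E, which is C in other coordinates, has degree at most 1 in x_2 too.
  The same argument excludes that the entries of l are linearly independent: after a change of the
  generators l = x, and one works with E = \<delta>_0 + T \<delta>_2 along lines of direction
  (1, 0, T), on which E has degree n \<ge> 2. Both cases are instances of \<open>degree_le_1_of_inverse\<close>.

  The cancellation is where the exactness of the presentation enters. If h a = D \<delta> for a vector a,
  then cross products of Koszul syzygies of a are multiples of \<delta>, which shows by induction that
  h^m divides D^m \<delta> for all m (\<open>powers_of_multiplier\<close>). Comparing degrees, a common divisor of
  the minors cannot involve a variable that D does not involve (\<open>deg_0_of_dvd_minors\<close>).

  If the entries of l spanned a space of dimension at most 1, then l would be a linear form times a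
  constant vector. This vector would be a syzygy of f, against dominance, or l would be zero and with it
  all minors. So a birational f can be brought to the displayed form; then
  deg C = 1 < n forces p to vanish at (0, 0, 1), and the ideal of entries is generated by two
  independent linear forms. That its height is 2 also needs an upper bound on chains of arbitrary
  primes: a prime strictly above a nonzero prime contains nonzero elements free of any given
  variable (\<open>prime_contains_free\<close>).
\<close>

section \<open>Ring homomorphisms and evaluation of polynomials\<close>

definition ring_map :: "('a::comm_ring_1 \<Rightarrow> 'b::comm_ring_1) \<Rightarrow> bool" where
  "ring_map h \<longleftrightarrow> h 1 = 1 \<and> (\<forall>a b. h (a + b) = h a + h b) \<and> (\<forall>a b. h (a * b) = h a * h b)"

lemma ring_mapI:
  assumes "h 1 = 1" "\<And>a b. h (a + b) = h a + h b" "\<And>a b. h (a * b) = h a * h b"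
  shows "ring_map h"
  using assms by (simp add: ring_map_def)

lemma
  assumes "ring_map h"
  shows ring_map_one: "h 1 = 1"
    and ring_map_add: "h (a + b) = h a + h b"
    and ring_map_mult: "h (a * b) = h a * h b"
  using assms by (simp_all add: ring_map_def)

lemma ring_map_zero: "ring_map h \<Longrightarrow> h 0 = 0"
  using ring_map_add[of h 0 0] by simp

lemma ring_map_uminus: "ring_map h \<Longrightarrow> h (- a) = - h a"
  using ring_map_add[of h a "- a"] ring_map_zero[of h] minus_unique[of "h a" "h (- a)"] by simp

lemma ring_map_diff: "ring_map h \<Longrightarrow> h (a - b) = h a - h b"
  using ring_map_add[of h a "- b"] by (simp add: ring_map_uminus)

lemma ring_map_power: "ring_map h \<Longrightarrow> h (a ^ n) = h a ^ n"
  by (induction n) (simp_all add: ring_map_one ring_map_mult)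

lemma ring_map_sum: "ring_map h \<Longrightarrow> h (sum f S) = (\<Sum>i\<in>S. h (f i))"
  by (induction S rule: infinite_finite_induct) (simp_all add: ring_map_zero ring_map_add)

lemma ring_map_prod: "ring_map h \<Longrightarrow> h (prod f S) = (\<Prod>i\<in>S. h (f i))"
  by (induction S rule: infinite_finite_induct) (simp_all add: ring_map_one ring_map_mult)

lemmas ring_map_simps = ring_map_zero ring_map_one ring_map_add ring_map_mult ring_map_uminus
  ring_map_diff ring_map_power

lemma ring_map_comp: "ring_map g \<Longrightarrow> ring_map h \<Longrightarrow> ring_map (\<lambda>x. g (h x))"
  by (simp add: ring_map_def)

lemma ring_map_id: "ring_map (\<lambda>x. x)"
  by (simp add: ring_map_def)

lemma ring_map_const_poly: "ring_map (\<lambda>c. [:c:])"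
  by (simp add: ring_map_def one_pCons)

lemma ring_map_poly: "ring_map (\<lambda>p. poly p a)"
  by (simp add: ring_map_def)

lemma ring_map_mconst: "ring_map mconst"
  by (simp add: ring_map_def mconst_def single_add mult_single)

text \<open>
  Evaluation with values in an arbitrary commutative ring, \<open>\<kappa>\<close> being the structure map on constants. Besides
  substitutions of polynomials, values in R[T], in R[T][c] and in a fraction field occur.
\<close>

definition meval ::
  "('k::field \<Rightarrow> 'a::comm_ring_1) \<Rightarrow> ('v::finite \<Rightarrow> 'a) \<Rightarrow> ('v, 'k) mpoly \<Rightarrow> 'a" where
  "meval \<kappa> s p = (\<Sum>m\<in>Poly_Mapping.keys p.
     \<kappa> (Poly_Mapping.lookup p m) * (\<Prod>v\<in>UNIV. s v ^ Poly_Mapping.lookup m v))"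

lemma msubst_eq_meval: "msubst s = meval mconst s"
  by (simp add: fun_eq_iff msubst_def meval_def)

lemma meval_superset:
  assumes "ring_map \<kappa>" "finite S" "Poly_Mapping.keys p \<subseteq> S"
  shows "meval \<kappa> s p = (\<Sum>m\<in>S. \<kappa> (Poly_Mapping.lookup p m) * (\<Prod>v\<in>UNIV. s v ^ Poly_Mapping.lookup m v))"
  unfolding meval_def
  by (rule sum.mono_neutral_left) (use assms in \<open>auto simp: in_keys_iff ring_map_zero\<close>)

lemma meval_single:
  "ring_map \<kappa> \<Longrightarrow> meval \<kappa> s (Poly_Mapping.single m c) = \<kappa> c * (\<Prod>v\<in>UNIV. s v ^ Poly_Mapping.lookup m v)"
  by (subst meval_superset[of _ "{m}"]) auto

lemma meval_add: 
  assumes "ring_map \<kappa>"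
  shows "meval \<kappa> s (p + q) = meval \<kappa> s p + meval \<kappa> s q"
  using assms meval_superset[of \<kappa> "Poly_Mapping.keys p \<union> Poly_Mapping.keys q" p s]
    meval_superset[of \<kappa> "Poly_Mapping.keys p \<union> Poly_Mapping.keys q" q s]
    meval_superset[of \<kappa> "Poly_Mapping.keys p \<union> Poly_Mapping.keys q" "p + q" s]
  by (simp add: Poly_Mapping.keys_add lookup_add ring_map_add sum.distrib[symmetric] algebra_simps)

lemma meval_sum:
  assumes "ring_map \<kappa>"
  shows "meval \<kappa> s (sum f S) = (\<Sum>i\<in>S. meval \<kappa> s (f i))"
proof -
  have "meval \<kappa> s 0 = 0" by (simp add: meval_def)
  then show ?thesis
    by (induction S rule: infinite_finite_induct) (simp_all add: meval_add[OF assms])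
qed

lemma sum_of_monomials:
  fixes p :: "('v, 'k::field) mpoly"
  shows "p = (\<Sum>m\<in>Poly_Mapping.keys p. Poly_Mapping.single m (Poly_Mapping.lookup p m))"
proof (rule poly_mapping_eqI)
  fix k
  show "Poly_Mapping.lookup p k = Poly_Mapping.lookup (\<Sum>m\<in>Poly_Mapping.keys p. Poly_Mapping.single m (Poly_Mapping.lookup p m)) k"
    by (auto simp: lookup_sum lookup_single when_def in_keys_iff)
qed

lemma meval_monomial_mult:
  assumes "ring_map \<kappa>"
  shows "meval \<kappa> s (Poly_Mapping.single m c * Poly_Mapping.single n d) =
    meval \<kappa> s (Poly_Mapping.single m c) * meval \<kappa> s (Poly_Mapping.single n d)"
  using assms
  by (simp add: mult_single meval_single ring_map_mult lookup_add power_add prod.distrib)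

lemma ring_map_meval:
  assumes "ring_map \<kappa>"
  shows "ring_map (meval \<kappa> s)"
proof (rule ring_mapI)
  show "meval \<kappa> s 1 = 1"
    using meval_single[OF assms, of s 0 1] assms by (simp add: ring_map_one)
  show "meval \<kappa> s (p + q) = meval \<kappa> s p + meval \<kappa> s q" for p q
    by (rule meval_add[OF assms])
  show "meval \<kappa> s (p * q) = meval \<kappa> s p * meval \<kappa> s q" for p q
  proof -
    have "meval \<kappa> s (p * q) = meval \<kappa> s ((\<Sum>m\<in>Poly_Mapping.keys p. Poly_Mapping.single m (Poly_Mapping.lookup p m)) *
      (\<Sum>m\<in>Poly_Mapping.keys q. Poly_Mapping.single m (Poly_Mapping.lookup q m)))"
      by (simp only: sum_of_monomials[symmetric])
    also have "\<dots> = meval \<kappa> s (\<Sum>m\<in>Poly_Mapping.keys p. Poly_Mapping.single m (Poly_Mapping.lookup p m)) *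
      meval \<kappa> s (\<Sum>m\<in>Poly_Mapping.keys q. Poly_Mapping.single m (Poly_Mapping.lookup q m))"
      by (simp add: sum_product meval_sum[OF assms] meval_monomial_mult[OF assms])
    finally show ?thesis
      by (simp only: sum_of_monomials[symmetric])
  qed
qed

lemma meval_mconst: "ring_map \<kappa> \<Longrightarrow> meval \<kappa> s (mconst c) = \<kappa> c"
  by (simp add: mconst_def meval_single)

lemma meval_mvar:
  assumes "ring_map \<kappa>"
  shows "meval \<kappa> s (mvar v) = s v"
proof -
  have "(\<Prod>u\<in>UNIV. s u ^ Poly_Mapping.lookup (Poly_Mapping.single v 1) u) = (\<Prod>u\<in>UNIV. if u = v then s u else 1)"
    by (rule prod.cong) (auto simp: lookup_single when_def)
  then show ?thesis
    using assms by (simp add: mvar_def meval_single ring_map_one)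
qed

lemma mvar_power: "mvar v ^ n = Poly_Mapping.single (Poly_Mapping.single v n) 1"
  by (induction n) (simp_all add: mvar_def mult_single single_add[symmetric])

lemma single_eq_prod:
  fixes m :: "'v::finite \<Rightarrow>\<^sub>0 nat" and c :: "'k::field"
  shows "Poly_Mapping.single m c = mconst c * (\<Prod>v\<in>UNIV. mvar v ^ Poly_Mapping.lookup m v)"
proof -
  have "(\<Prod>v\<in>S. mvar v ^ Poly_Mapping.lookup m v) =
      Poly_Mapping.single (\<Sum>v\<in>S. Poly_Mapping.single v (Poly_Mapping.lookup m v)) (1::'k)" for S
    by (induction S rule: infinite_finite_induct) (simp_all add: mvar_power mult_single)
  moreover have "(\<Sum>v\<in>UNIV. Poly_Mapping.single v (Poly_Mapping.lookup m v)) = m"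
    by (rule poly_mapping_eqI) (auto simp: lookup_sum lookup_single when_def)
  ultimately show ?thesis
    by (simp add: mconst_def mult_single)
qed

lemma mpoly_induct [case_names const var add mult]:
  fixes p :: "('v::finite, 'k::field) mpoly"
  assumes "\<And>c. P (mconst c)" "\<And>v. P (mvar v)"
    and "\<And>p q. P p \<Longrightarrow> P q \<Longrightarrow> P (p + q)" "\<And>p q. P p \<Longrightarrow> P q \<Longrightarrow> P (p * q)"
  shows "P p"
proof -
  have 0: "P 0" "P 1"
    using assms(1)[of 0] assms(1)[of 1] by (simp_all add: ring_map_zero[OF ring_map_mconst] ring_map_one[OF ring_map_mconst])
  have pow: "P (mvar v ^ n)" for v n
    by (induction n) (simp_all add: 0 assms(2,4))
  have prd: "P (\<Prod>v\<in>S. mvar v ^ f v)" for f :: "'v \<Rightarrow> nat" and S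
    by (induction S rule: infinite_finite_induct) (simp_all add: 0 pow assms(4))
  have mon: "P (Poly_Mapping.single m c)" for m c
    by (subst single_eq_prod) (rule assms(4)[OF assms(1) prd])
  have sm: "P (sum f S)" if "\<And>i. P (f i)" for f :: "('v \<Rightarrow>\<^sub>0 nat) \<Rightarrow> ('v, 'k) mpoly" and S
    by (induction S rule: infinite_finite_induct) (simp_all add: 0 that assms(3))
  have "P (\<Sum>m\<in>Poly_Mapping.keys p. Poly_Mapping.single m (Poly_Mapping.lookup p m))"
    by (rule sm) (rule mon)
  then show ?thesis
    by (simp only: sum_of_monomials[symmetric])
qed

lemma ring_map_mpoly_unique:
  fixes p :: "('v::finite, 'k::field) mpoly"
  assumes "ring_map g" "ring_map h" "\<And>c. g (mconst c) = h (mconst c)" "\<And>v. g (mvar v) = h (mvar v)"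
  shows "g p = h p"
  by (induction p rule: mpoly_induct)
    (simp_all add: assms(3,4) ring_map_simps[OF assms(1)] ring_map_simps[OF assms(2)])

lemma meval_id: "meval mconst mvar p = p"
  by (rule ring_map_mpoly_unique[OF ring_map_meval[OF ring_map_mconst] ring_map_id])
    (simp_all add: meval_mconst[OF ring_map_mconst] meval_mvar[OF ring_map_mconst])

lemma ring_map_meval_comp:
  fixes p :: "('v::finite, 'k::field) mpoly"
  assumes "ring_map \<kappa>" "ring_map h"
  shows "h (meval \<kappa> s p) = meval (\<lambda>c. h (\<kappa> c)) (\<lambda>v. h (s v)) p"
proof -
  have c: "ring_map (\<lambda>c. h (\<kappa> c))" by (rule ring_map_comp[OF assms(2,1)])
  show ?thesis
    by (rule ring_map_mpoly_unique[OF ring_map_comp[OF assms(2) ring_map_meval[OF assms(1)]] ring_map_meval[OF c]])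
      (simp_all add: meval_mconst[OF assms(1)] meval_mvar[OF assms(1)] meval_mconst[OF c] meval_mvar[OF c])
qed

lemma meval_cong: "(\<And>v. s v = s' v) \<Longrightarrow> meval \<kappa> s p = meval \<kappa> s' p"
  by (simp add: meval_def)

lemma meval_swap_subst:
  fixes p :: "('v::finite, 'k::field) mpoly" and t :: "'v \<Rightarrow> ('w::finite, 'k) mpoly"
  assumes "ring_map \<kappa>"
  shows "meval \<kappa> s (msubst t p) = meval \<kappa> (\<lambda>v. meval \<kappa> s (t v)) p"
  unfolding msubst_eq_meval
  by (subst ring_map_meval_comp[OF ring_map_mconst ring_map_meval[OF assms]])
    (simp add: meval_mconst[OF assms])


section \<open>Weighted homogeneous polynomials\<close>

text \<open>
  The weights 1 give homogeneous polynomials; the weights 0 and 1 on the two groups of variables give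
  the two components of a bidegree.
\<close>

definition weighted :: "('v::finite \<Rightarrow> nat) \<Rightarrow> nat \<Rightarrow> ('v, 'k::field) mpoly \<Rightarrow> bool" where
  "weighted w d p \<longleftrightarrow> (\<forall>m\<in>Poly_Mapping.keys p. (\<Sum>v\<in>UNIV. Poly_Mapping.lookup m v * w v) = d)"

lemma homogeneous_eq_weighted: "homogeneous d p \<longleftrightarrow> weighted (\<lambda>_. 1) d p"
  by (simp add: homogeneous_def weighted_def)

lemma sum_UNIV_sum: "(\<Sum>v\<in>(UNIV::('a::finite + 'b::finite) set). f v) = (\<Sum>i\<in>UNIV. f (Inl i)) + (\<Sum>j\<in>UNIV. f (Inr j))"
  unfolding UNIV_Plus_UNIV[symmetric] by (subst sum.Plus) simp_all

lemma bihomogeneous_eq_weighted: "bihomogeneous a b p \<longleftrightarrow>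
   weighted (case_sum (\<lambda>_. 1) (\<lambda>_. 0)) a p \<and> weighted (case_sum (\<lambda>_. 0) (\<lambda>_. 1)) b p"
  by (auto simp: bihomogeneous_def weighted_def sum_UNIV_sum)

lemma weighted_zero: "weighted w d 0"
  by (simp add: weighted_def)

lemma weighted_add: "weighted w d p \<Longrightarrow> weighted w d q \<Longrightarrow> weighted w d (p + q)"
  unfolding weighted_def using Poly_Mapping.keys_add by fastforce

lemma weighted_uminus: "weighted w d p \<Longrightarrow> weighted w d (- p)"
  by (simp add: weighted_def keys_minus in_keys_iff)

lemma weighted_diff: "weighted w d p \<Longrightarrow> weighted w d q \<Longrightarrow> weighted w d (p - q)"
  using weighted_add[of w d p "- q"] weighted_uminus by fastforce

lemma weighted_mult:
  assumes "weighted w a p" "weighted w b q"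
  shows "weighted w (a + b) (p * q)"
  unfolding weighted_def
proof
  fix m assume "m \<in> Poly_Mapping.keys (p * q)"
  then obtain m1 m2 where "m1 \<in> Poly_Mapping.keys p" "m2 \<in> Poly_Mapping.keys q" "m = m1 + m2"
    using keys_mult[of p q] by blast
  then show "(\<Sum>v\<in>UNIV. Poly_Mapping.lookup m v * w v) = a + b"
    using assms by (simp add: weighted_def lookup_add algebra_simps sum.distrib)
qed

lemma weighted_mconst: "weighted w 0 (mconst c)"
  by (simp add: weighted_def mconst_def)

lemma weighted_one: "weighted w 0 1"
  by (simp add: weighted_def)

lemma weighted_mvar: "weighted w (w v) (mvar v)"
proof -
  have "(\<Sum>u\<in>UNIV. Poly_Mapping.lookup (Poly_Mapping.single v 1) u * w u) = (\<Sum>u\<in>UNIV. if u = v then w u else 0)"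
    by (rule sum.cong) (auto simp: lookup_single when_def)
  then show ?thesis by (simp add: weighted_def mvar_def)
qed

lemma weighted_power: "weighted w a p \<Longrightarrow> weighted w (n * a) (p ^ n)"
  by (induction n) (simp_all add: weighted_one weighted_mult)

lemma weighted_prod: "finite S \<Longrightarrow> (\<And>i. i \<in> S \<Longrightarrow> weighted w (a i) (f i)) \<Longrightarrow> weighted w (sum a S) (prod f S)"
  by (induction S rule: finite_induct) (simp_all add: weighted_one weighted_mult)

lemma weighted_sum: "(\<And>i. i \<in> S \<Longrightarrow> weighted w a (f i)) \<Longrightarrow> weighted w a (sum f S)"
  by (induction S rule: infinite_finite_induct) (simp_all add: weighted_zero weighted_add)

lemma weighted_msubst:
  assumes "weighted w d p" "\<And>v. weighted w' (w v) (s v)"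
  shows "weighted w' d (msubst s p)"
  unfolding msubst_def
proof (rule weighted_sum)
  fix m assume "m \<in> Poly_Mapping.keys p"
  then have d: "d = 0 + (\<Sum>v\<in>UNIV. Poly_Mapping.lookup m v * w v)"
    using assms(1) by (simp add: weighted_def)
  show "weighted w' d (mconst (Poly_Mapping.lookup p m) * (\<Prod>v\<in>UNIV. s v ^ Poly_Mapping.lookup m v))"
    unfolding d by (intro weighted_mult weighted_mconst weighted_prod weighted_power assms(2) finite)
qed

lemma weighted_unique:
  assumes "weighted w a p" "weighted w b p" "p \<noteq> 0"
  shows "a = b"
proof -
  obtain m where "m \<in> Poly_Mapping.keys p" using assms(3) by fastforce
  then show ?thesis using assms(1,2) by (auto simp: weighted_def)
qed

lemma meval_scale:
  assumes "ring_map \<kappa>" "weighted w d p"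
  shows "meval \<kappa> (\<lambda>v. r ^ w v * s v) p = r ^ d * meval \<kappa> s p"
proof -
  have "(\<Prod>v\<in>UNIV. (r ^ w v * s v) ^ Poly_Mapping.lookup m v) =
      r ^ (\<Sum>v\<in>UNIV. Poly_Mapping.lookup m v * w v) * (\<Prod>v\<in>UNIV. s v ^ Poly_Mapping.lookup m v)" for m
    by (simp add: power_mult_distrib prod.distrib power_mult[symmetric] power_sum mult.commute)
  then show ?thesis
    using assms(2) by (simp add: meval_def weighted_def sum_distrib_left algebra_simps cong: sum.cong)
qed

lemma meval_scale_homogeneous:
  assumes "ring_map \<kappa>" "homogeneous d p"
  shows "meval \<kappa> (\<lambda>v. r * s v) p = r ^ d * meval \<kappa> s p"
  using meval_scale[of \<kappa> "\<lambda>_. 1" d p r s] assms by (simp add: homogeneous_eq_weighted)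


section \<open>Top coefficients of evaluated polynomials\<close>

lemma coeff_mult_top:
  fixes p q :: "'a::comm_ring_1 poly"
  assumes "degree p \<le> m" "degree q \<le> n"
  shows "degree (p * q) \<le> m + n" "coeff (p * q) (m + n) = coeff p m * coeff q n"
proof -
  show "degree (p * q) \<le> m + n"
    using degree_mult_le[of p q] assms by linarith
  have "coeff (p * q) (m + n) = (\<Sum>i\<le>m + n. coeff p i * coeff q (m + n - i))"
    by (rule coeff_mult)
  also have "\<dots> = (\<Sum>i\<le>m + n. if i = m then coeff p m * coeff q n else 0)"
  proof (rule sum.cong)
    fix i
    have "i < m \<Longrightarrow> degree q < m + n - i" "i > m \<Longrightarrow> degree p < i"
      using assms by auto
    then show "coeff p i * coeff q (m + n - i) = (if i = m then coeff p m * coeff q n else 0)"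
      by (cases i m rule: linorder_cases) (auto simp: coeff_eq_0)
  qed simp
  finally show "coeff (p * q) (m + n) = coeff p m * coeff q n" by simp
qed

lemma coeff_power_top:
  fixes p :: "'a::comm_ring_1 poly"
  assumes "degree p \<le> m"
  shows "degree (p ^ n) \<le> n * m \<and> coeff (p ^ n) (n * m) = coeff p m ^ n"
proof (induction n)
  case (Suc n)
  then show ?case using coeff_mult_top[OF assms, of "p ^ n" "n * m"] by (simp add: add.commute)
qed simp

lemma coeff_prod_top:
  fixes p :: "'i \<Rightarrow> 'a::comm_ring_1 poly"
  assumes "finite S" "\<And>i. i \<in> S \<Longrightarrow> degree (p i) \<le> m i"
  shows "degree (prod p S) \<le> sum m S \<and> coeff (prod p S) (sum m S) = (\<Prod>i\<in>S. coeff (p i) (m i))"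
  using assms
proof (induction S rule: finite_induct)
  case (insert i S)
  then show ?case using coeff_mult_top[of "p i" "m i" "prod p S" "sum m S"] by simp
qed simp

text \<open>
  A product attains the sum of the degree bounds of its factors with the product of the coefficients
  there. So the top coefficient of an evaluated polynomial is its value at the top coefficients.
\<close>

lemma
  fixes s :: "'v::finite \<Rightarrow> 'a::comm_ring_1 poly"
  assumes "weighted w d p" "\<And>v. degree (s v) \<le> w v"
  shows degree_meval_le: "degree (meval (\<lambda>c. [:\<kappa> c:]) s p) \<le> d" (is ?deg)
    and coeff_meval_top: "coeff (meval (\<lambda>c. [:\<kappa> c:]) s p) d = meval \<kappa> (\<lambda>v. coeff (s v) (w v)) p" (is ?coeff)
proof -
  have *: "degree (\<Prod>v\<in>UNIV. s v ^ Poly_Mapping.lookup m v) \<le> d \<and>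
     coeff (\<Prod>v\<in>UNIV. s v ^ Poly_Mapping.lookup m v) d = (\<Prod>v\<in>UNIV. coeff (s v) (w v) ^ Poly_Mapping.lookup m v)"
    if "m \<in> Poly_Mapping.keys p" for m
  proof -
    have "d = (\<Sum>v\<in>UNIV. Poly_Mapping.lookup m v * w v)"
      using assms(1) that by (simp add: weighted_def)
    then show ?thesis
      using coeff_prod_top[of UNIV "\<lambda>v. s v ^ Poly_Mapping.lookup m v" "\<lambda>v. Poly_Mapping.lookup m v * w v"]
        coeff_power_top[OF assms(2)] by simp
  qed
  show ?deg
    unfolding meval_def
    by (rule degree_sum_le) (auto simp: * intro: order.trans[OF degree_smult_le])
  show ?coeff
    unfolding meval_def by (simp add: coeff_sum * cong: sum.cong)
qed

section \<open>Minors and syzygies\<close>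

lemma three_eq_zero: "(3::3) = 0"
  by simp

lemma distinct_3 [simp]: "(0::3) \<noteq> 1" "(0::3) \<noteq> 2" "(1::3) \<noteq> 2" "(1::3) \<noteq> 0" "(2::3) \<noteq> 0" "(2::3) \<noteq> 1"
  by simp_all

lemma sum_UNIV_3: "(\<Sum>i\<in>(UNIV :: 3 set). f i) = f 0 + f 1 + f 2"
  unfolding sum_3 three_eq_zero by (simp only: ac_simps)

lemma all_3: "(\<forall>i::3. P i) \<longleftrightarrow> P 0 \<and> P 1 \<and> P 2"
  unfolding forall_3 three_eq_zero by blast

lemma cases_3:
  obtains "k = (0::3)" | "k = 1" | "k = 2"
  using exhaust_3[of k] unfolding three_eq_zero by blast

lemma plus_3: "(0::3) + 1 = 1" "(0::3) + 2 = 2" "(1::3) + 1 = 2" "(1::3) + 2 = 0" "(2::3) + 1 = 0" "(2::3) + 2 = 1"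
  by simp_all

text \<open>
  The cross product. Indices are added in the ring of integers modulo 3, which makes the formula
  cyclic.
\<close>

definition minors :: "(3 \<Rightarrow> 'a::comm_ring_1) \<Rightarrow> (3 \<Rightarrow> 'a) \<Rightarrow> 3 \<Rightarrow> 'a" where
  "minors a b i = a (i + 1) * b (i + 2) - a (i + 2) * b (i + 1)"

lemma minors_simps: 
  "minors a b 0 = a 1 * b 2 - a 2 * b 1"
  "minors a b 1 = a 2 * b 0 - a 0 * b 2"
  "minors a b 2 = a 0 * b 1 - a 1 * b 0"
  by (simp_all only: minors_def plus_3)

definition parallel :: "(3 \<Rightarrow> 'a::comm_ring_1) \<Rightarrow> (3 \<Rightarrow> 'a) \<Rightarrow> bool" where
  "parallel a b \<longleftrightarrow> (\<forall>i j. a i * b j = a j * b i)"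

definition syzygy_basis :: "(3 \<Rightarrow> 'a::comm_ring_1) \<Rightarrow> (3 \<Rightarrow> 'a) \<Rightarrow> (3 \<Rightarrow> 'a) \<Rightarrow> bool" where
  "syzygy_basis f l p \<longleftrightarrow>
     (\<forall>w. (\<Sum>i\<in>UNIV. f i * w i) = 0 \<longleftrightarrow> (\<exists>u v. \<forall>i. w i = u * l i + v * p i))"

lemma syzygy_basisD:
  assumes "syzygy_basis f l p"
  shows "(\<Sum>i\<in>UNIV. f i * l i) = 0" "(\<Sum>i\<in>UNIV. f i * p i) = 0"
    and "(\<Sum>i\<in>UNIV. f i * w i) = 0 \<Longrightarrow> \<exists>u v. \<forall>i. w i = u * l i + v * p i"
proof -
  have "\<exists>u v. \<forall>i. l i = u * l i + v * p i" "\<exists>u v. \<forall>i. p i = u * l i + v * p i"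
    by (rule exI[of _ 1], rule exI[of _ 0], simp) (rule exI[of _ 0], rule exI[of _ 1], simp)
  then show "(\<Sum>i\<in>UNIV. f i * l i) = 0" "(\<Sum>i\<in>UNIV. f i * p i) = 0"
    using assms by (simp_all add: syzygy_basis_def)
  show "\<exists>u v. \<forall>i. w i = u * l i + v * p i" if "(\<Sum>i\<in>UNIV. f i * w i) = 0"
    using assms that by (simp add: syzygy_basis_def)
qed

lemma parallel_iff_3: "parallel a b \<longleftrightarrow> a 0 * b 1 = a 1 * b 0 \<and> a 0 * b 2 = a 2 * b 0 \<and> a 1 * b 2 = a 2 * b 1"
  unfolding parallel_def all_3 by auto

lemma parallel_minors:
  assumes "syzygy_basis f l p"
  shows "parallel f (minors l p)"
proof -
  define F G where "F = (\<Sum>i\<in>UNIV. f i * l i)" and "G = (\<Sum>i\<in>UNIV. f i * p i)"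
  have "f 0 * minors l p 1 - f 1 * minors l p 0 = l 2 * G - p 2 * F"
    "f 0 * minors l p 2 - f 2 * minors l p 0 = p 1 * F - l 1 * G"
    "f 1 * minors l p 2 - f 2 * minors l p 1 = l 0 * G - p 0 * F"
    unfolding F_def G_def sum_UNIV_3 minors_simps by (simp_all add: algebra_simps)
  moreover have "F = 0" "G = 0"
    using syzygy_basisD(1,2)[OF assms] by (simp_all add: F_def G_def)
  ultimately show ?thesis unfolding parallel_iff_3 by simp
qed

lemma minors_of_syzygies:
  assumes "\<forall>i. w i = u * l i + v * p i" "\<forall>i. w' i = u' * l i + v' * p i"
  shows "minors w w' i = (u * v' - u' * v) * minors l p i"
  by (simp add: minors_def assms algebra_simps)

lemma parallel_trans:
  fixes a b c :: "3 \<Rightarrow> 'a::idom"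
  assumes "parallel a b" "parallel b c" "b k \<noteq> 0"
  shows "parallel a c"
  unfolding parallel_def
proof (intro allI)
  fix i j
  have "b k * b k * (a i * c j) = (a i * b k) * (b k * c j)" by (simp only: ac_simps)
  also have "\<dots> = (a k * b i) * (b j * c k)" using assms(1,2) by (simp add: parallel_def)
  also have "\<dots> = (a k * b j) * (b i * c k)" by (simp only: ac_simps)
  also have "\<dots> = (a j * b k) * (b k * c i)" using assms(1,2) by (simp add: parallel_def)
  also have "\<dots> = b k * b k * (a j * c i)" by (simp only: ac_simps)
  finally have "b k * b k * (a i * c j) = b k * b k * (a j * c i)" .
  then show "a i * c j = a j * c i" using assms(3) by simp
qed

lemma parallel_sym: "parallel a b \<Longrightarrow> parallel b a"
  by (auto simp: parallel_def mult.commute)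

text \<open>
  The vector b_m a is the cross product of a Koszul syzygy of a and one of b. By proportionality these
  are syzygies of f, hence combinations of l and p.
\<close>

lemma koszul_multiple:
  fixes f :: "3 \<Rightarrow> 'a::idom"
  assumes "syzygy_basis f l p" "parallel f a" "parallel f b" "parallel a b"
  shows "\<exists>c. \<forall>i. b m * a i = c * minors l p i"
proof -
  have eqs: "f 0 * a 1 = f 1 * a 0" "f 0 * a 2 = f 2 * a 0" "f 1 * a 2 = f 2 * a 1"
    "f 0 * b 1 = f 1 * b 0" "f 0 * b 2 = f 2 * b 0" "f 1 * b 2 = f 2 * b 1"
    "a 0 * b 1 = a 1 * b 0" "a 0 * b 2 = a 2 * b 0" "a 1 * b 2 = a 2 * b 1"
    using assms(2-4) by (simp_all add: parallel_iff_3)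
  have "\<exists>w w'. (\<Sum>i\<in>UNIV. f i * w i) = 0 \<and> (\<Sum>i\<in>UNIV. f i * w' i) = 0 \<and> (\<forall>i. minors w w' i = b m * a i)"
  proof (cases m rule: cases_3)
    case 1
    show ?thesis
      by (rule exI[of _ "\<lambda>i. if i = 0 then a 1 else if i = 1 then - a 0 else 0"],
          rule exI[of _ "\<lambda>i. if i = 0 then b 2 else if i = 2 then - b 0 else 0"])
        (simp add: 1 sum_UNIV_3 minors_simps all_3 eqs mult.commute[of "b _" "a _"])
  next
    case 2
    show ?thesis
      by (rule exI[of _ "\<lambda>i. if i = 1 then a 2 else if i = 2 then - a 1 else 0"],
          rule exI[of _ "\<lambda>i. if i = 1 then b 0 else if i = 0 then - b 1 else 0"])
        (simp add: 2 sum_UNIV_3 minors_simps all_3 eqs mult.commute[of "b _" "a _"])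
  next
    case 3
    show ?thesis
      by (rule exI[of _ "\<lambda>i. if i = 2 then a 0 else if i = 0 then - a 2 else 0"],
          rule exI[of _ "\<lambda>i. if i = 2 then b 1 else if i = 1 then - b 2 else 0"])
        (simp add: 3 sum_UNIV_3 minors_simps all_3 eqs mult.commute[of "b _" "a _"])
  qed
  then obtain w w' where w: "(\<Sum>i\<in>UNIV. f i * w i) = 0" "(\<Sum>i\<in>UNIV. f i * w' i) = 0"
      "\<forall>i. minors w w' i = b m * a i"
    by blast
  obtain u v where uv: "\<forall>i. w i = u * l i + v * p i" using syzygy_basisD(3)[OF assms(1) w(1)] by blast
  obtain u' v' where uv': "\<forall>i. w' i = u' * l i + v' * p i" using syzygy_basisD(3)[OF assms(1) w(2)] by blast
  show ?thesis
    using minors_of_syzygies[OF uv uv'] w(3) by metis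
qed

text \<open>
  The Koszul syzygies of f make f_k^2 a multiple of the k-th minor.
\<close>

lemma minors_nonzero:
  fixes f :: "3 \<Rightarrow> 'a::idom"
  assumes "syzygy_basis f l p" "f k \<noteq> 0"
  shows "minors l p k \<noteq> 0"
proof -
  have "parallel f f" by (simp add: parallel_def mult.commute)
  then obtain c where "\<forall>i. f k * f i = c * minors l p i"
    using koszul_multiple[OF assms(1), of f f k] by blast
  then have "f k * f k = c * minors l p k" by blast
  then show ?thesis using assms(2) by auto
qed

text \<open>
  A fraction D / h that multiplies the minors into the ring can be raised to any power: the Koszul
  construction, applied to (D / h) \<delta> and (D / h)^n \<delta>, produces (D / h)^(n + 1) \<delta>. In other words,
  D / h is almost integral.
\<close>

lemma powers_of_multiplier:
  fixes f :: "3 \<Rightarrow> 'a::idom"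
  assumes "syzygy_basis f l p" "f k \<noteq> 0" "h \<noteq> 0" "\<And>i. h * a i = D * minors l p i"
  shows "\<exists>b. \<forall>i. h ^ n * b i = D ^ n * minors l p i"
proof (induction n)
  case 0
  show ?case by (rule exI[of _ "minors l p"]) simp
next
  case (Suc n)
  define d where "d = minors l p"
  have dk: "d k \<noteq> 0" using minors_nonzero[OF assms(1,2)] by (simp add: d_def)
  have fd: "parallel f d" using parallel_minors[OF assms(1)] by (simp add: d_def)
  have par: "parallel f a'" if "h' \<noteq> 0" "\<And>i. h' * a' i = D' * d i" for h' a' D'
    unfolding parallel_def
  proof (intro allI)
    fix i j
    have "h' * (f i * a' j) = f i * (h' * a' j)" by (simp only: ac_simps)
    also have "\<dots> = D' * (f i * d j)" by (simp only: that(2) ac_simps)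
    also have "\<dots> = D' * (f j * d i)" using fd by (simp add: parallel_def)
    also have "\<dots> = f j * (h' * a' i)" by (simp only: that(2) ac_simps)
    also have "\<dots> = h' * (f j * a' i)" by (simp only: ac_simps)
    finally show "f i * a' j = f j * a' i" using that(1) by simp
  qed
  obtain b where b: "\<forall>i. h ^ n * b i = D ^ n * d i" using Suc.IH by (auto simp: d_def)
  have fa: "parallel f a" by (rule par[where h' = h and D' = D]) (use assms(3) in simp, use assms(4) in \<open>simp add: d_def\<close>)
  have fb: "parallel f b" by (rule par[where h' = "h ^ n" and D' = "D ^ n"]) (use b assms(3) in auto)
  have ab: "parallel a b" by (rule parallel_trans[OF parallel_sym[OF fa] fb assms(2)])
  have "\<forall>m. \<exists>c. \<forall>i. b m * a i = c * d i"
    using koszul_multiple[OF assms(1) fa fb ab] by (simp add: d_def)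
  then obtain c where c: "\<And>m i. b m * a i = c m * d i" by metis
  have "h ^ Suc n * c m = D ^ Suc n * d m" for m
  proof -
    have "(h ^ Suc n * c m) * d k = h ^ Suc n * (c m * d k)" by (simp only: mult.assoc)
    also have "\<dots> = (h ^ n * b m) * (h * a k)" by (simp only: c[symmetric] power_Suc ac_simps)
    also have "\<dots> = (D ^ n * d m) * (D * d k)" using b assms(4) by (simp add: d_def)
    also have "\<dots> = (D ^ Suc n * d m) * d k" by (simp only: power_Suc ac_simps)
    finally show ?thesis using dk by simp
  qed
  then show ?case by (auto simp: d_def)
qed

section \<open>A left inverse modulo one equation\<close>

lemma meval_cong_mod:
  fixes q :: "('v::finite, 'k::field) mpoly"
  assumes "ring_map \<kappa>" "\<And>v. E dvd s v - t v"
  shows "E dvd meval \<kappa> s q - meval \<kappa> t q"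
proof (induction q rule: mpoly_induct)
  case (mult p q)
  have "meval \<kappa> s (p * q) - meval \<kappa> t (p * q) =
      meval \<kappa> s p * (meval \<kappa> s q - meval \<kappa> t q) + (meval \<kappa> s p - meval \<kappa> t p) * meval \<kappa> t q"
    by (simp add: ring_map_mult[OF ring_map_meval[OF assms(1)]] algebra_simps)
  then show ?case using mult by auto
next
  case (add p q)
  have "meval \<kappa> s (p + q) - meval \<kappa> t (p + q) =
      (meval \<kappa> s q - meval \<kappa> t q) + (meval \<kappa> s p - meval \<kappa> t p)"
    by (simp add: ring_map_add[OF ring_map_meval[OF assms(1)]] algebra_simps)
  then show ?case using add by auto
qed (simp_all add: meval_mconst[OF assms(1)] meval_mvar[OF assms(1)] assms(2))

lemma form_cong_mod:
  assumes "ring_map \<kappa>" "\<And>v. E dvd r * s v - b * t v" "homogeneous e q"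
  shows "E dvd r ^ e * meval \<kappa> s q - b ^ e * meval \<kappa> t q"
  using meval_cong_mod[where s = "\<lambda>v. r * s v" and t = "\<lambda>v. b * t v", OF assms(1,2), of q]
  by (simp add: meval_scale_homogeneous[OF assms(1,3)])

text \<open>
  If \<open>r \<delta> \<equiv> b Y\<close> modulo E, homogeneity gives \<open>r^e g(\<delta>) \<equiv> b^e g(Y)\<close>. As \<open>g(\<delta>)\<close> is
  proportional to X, the vector \<open>b^e g(Y)\<close> is proportional to X modulo E, and each factor b can be traded
  for h.
\<close>

lemma inverse_mod:
  fixes g :: "3 \<Rightarrow> 'k::field R"
  assumes "ring_map \<kappa>" "\<And>i. E dvd r * \<delta> i - b * Y i"
    and cancel: "\<And>a. E dvd b * a \<Longrightarrow> E dvd h * a"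
    and "\<And>i. homogeneous e (g i)" "parallel (\<lambda>i. meval \<kappa> \<delta> (g i)) X"
  shows "E dvd h ^ e * (meval \<kappa> Y (g i) * X j - meval \<kappa> Y (g j) * X i)"
proof -
  have cancel_power: "E dvd b ^ n * a \<Longrightarrow> E dvd h ^ n * a" for n a
  proof (induction n arbitrary: a)
    case (Suc n)
    have "E dvd b * (b ^ n * a)" using Suc.prems by (simp add: mult.assoc)
    then have "E dvd b ^ n * (h * a)" using cancel[of "b ^ n * a"] by (simp only: ac_simps)
    then have "E dvd h ^ n * (h * a)" by (rule Suc.IH)
    then show ?case by (simp only: power_Suc ac_simps)
  qed simp
  have d: "E dvd r ^ e * meval \<kappa> \<delta> (g i) - b ^ e * meval \<kappa> Y (g i)" for i
    by (rule form_cong_mod[OF assms(1,2,4)])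
  have "meval \<kappa> \<delta> (g i) * X j = meval \<kappa> \<delta> (g j) * X i"
    using assms(5) by (simp add: parallel_def)
  then have "r ^ e * meval \<kappa> \<delta> (g i) * X j = r ^ e * meval \<kappa> \<delta> (g j) * X i"
    by (simp only: mult.assoc)
  then have "b ^ e * (meval \<kappa> Y (g i) * X j - meval \<kappa> Y (g j) * X i) =
     (r ^ e * meval \<kappa> \<delta> (g j) - b ^ e * meval \<kappa> Y (g j)) * X i
     - (r ^ e * meval \<kappa> \<delta> (g i) - b ^ e * meval \<kappa> Y (g i)) * X j"
    by (simp add: algebra_simps)
  moreover have "E dvd (r ^ e * meval \<kappa> \<delta> (g j) - b ^ e * meval \<kappa> Y (g j)) * X i
     - (r ^ e * meval \<kappa> \<delta> (g i) - b ^ e * meval \<kappa> Y (g i)) * X j"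
    by (intro dvd_diff dvd_mult2 d)
  ultimately show ?thesis by (intro cancel_power) simp
qed

section \<open>Rings with a distinguished variable\<close>

text \<open>
  The map j rewrites an element as a polynomial in t with coefficients that do not involve t. For a
  polynomial ring this includes the choice of the complementary coordinates, so that t-degrees along
  skew lines are covered.
\<close>

locale free_variable =
  fixes j :: "'a::idom \<Rightarrow> 'a poly" and t :: 'a
  assumes j: "ring_map j"
    and j_t: "j t = [:0, 1:]"
    and poly_j: "poly (j a) t = a"
    and j_coeff: "j (coeff (j a) n) = [:coeff (j a) n:]"
begin

abbreviation deg :: "'a \<Rightarrow> nat" where "deg a \<equiv> degree (j a)"

definition free :: "'a \<Rightarrow> bool" where "free a \<longleftrightarrow> j a = [:a:]"

lemmas j_simps = ring_map_simps[OF j]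

lemma j_eq_0_iff [simp]: "j a = 0 \<longleftrightarrow> a = 0"
  using poly_j[of a] j_simps(1) by auto

lemma deg_mult: "a \<noteq> 0 \<Longrightarrow> b \<noteq> 0 \<Longrightarrow> deg (a * b) = deg a + deg b"
  by (simp add: j_simps degree_mult_eq)

lemma deg_power: "a \<noteq> 0 \<Longrightarrow> deg (a ^ n) = n * deg a"
  by (simp add: j_simps degree_power_eq)

lemma deg_le_of_dvd: "a dvd b \<Longrightarrow> b \<noteq> 0 \<Longrightarrow> deg a \<le> deg b"
  by (elim dvdE) (simp add: deg_mult)

lemma free_deg: "free a \<Longrightarrow> deg a = 0"
  by (simp add: free_def)

lemma free_coeff: "free (coeff (j a) n)"
  by (simp add: free_def j_coeff)

lemma deg_0_free: "deg a = 0 \<Longrightarrow> free a"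
proof -
  assume "deg a = 0"
  then obtain c where c: "j a = [:c:]" by (rule degree_eq_zeroE)
  then show ?thesis using poly_j[of a] by (simp add: free_def)
qed

lemma free_mult: "free a \<Longrightarrow> free b \<Longrightarrow> free (a * b)"
  by (simp add: free_def j_simps)

lemma free_1: "free 1"
  by (simp add: free_def j_simps one_pCons)

lemma free_power: "free a \<Longrightarrow> free (a ^ n)"
  by (induction n) (simp_all add: free_1 free_mult)

lemma pseudo_division:
  assumes "b \<noteq> 0"
  shows "\<exists>D q r. free D \<and> D \<noteq> 0 \<and> D * a = q * b + r \<and> (r = 0 \<or> deg r < deg b)"
proof (induction "deg a" arbitrary: a rule: less_induct)
  case less
  show ?case
  proof (cases "a = 0 \<or> deg a < deg b")
    case True
    then show ?thesis by (intro exI[of _ 1] exI[of _ 0] exI[of _ a]) (simp add: free_1)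
  next
    case False
    define m n where "m = deg a" and "n = deg b"
    define la lb where "la = coeff (j a) m" and "lb = coeff (j b) n"
    have la: "la \<noteq> 0" "free la" and lb: "lb \<noteq> 0" "free lb"
      using False assms by (simp_all add: la_def lb_def m_def n_def free_coeff)
    define a' where "a' = lb * a - la * t ^ (m - n) * b"
    have ja: "j a' = smult lb (j a) - monom la (m - n) * j b"
      using la lb by (simp add: a'_def j_simps free_def j_t monom_altdef)
    have mn: "m - n + n = m" using False by (simp add: m_def n_def)
    have "coeff (monom la (m - n) * j b) m = la * lb"
      using mn by (simp add: coeff_monom_mult lb_def)
    then have c: "coeff (j a') m = 0" by (simp add: ja la_def)
    have "degree (monom la (m - n) * j b) \<le> m"
      using degree_mult_le[of "monom la (m - n)" "j b"] degree_monom_le[of la "m - n"] mn by (simp add: n_def)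
    then have "deg a' \<le> m"
      unfolding ja by (intro degree_diff_le) (simp_all add: m_def)
    with c have *: "a' = 0 \<or> deg a' < deg a"
      by (metis j_eq_0_iff le_neq_implies_less leading_coeff_0_iff m_def)
    have "\<exists>D q r. free D \<and> D \<noteq> 0 \<and> D * a' = q * b + r \<and> (r = 0 \<or> deg r < deg b)"
    proof (cases "a' = 0")
      case True
      then show ?thesis by (intro exI[of _ 1] exI[of _ 0]) (simp add: free_1)
    next
      case False
      then show ?thesis using * less.hyps by blast
    qed
    then obtain D q r where D: "free D" "D \<noteq> 0" "D * a' = q * b + r" "r = 0 \<or> deg r < deg b" by blast
    have "(D * lb) * a = (q + D * la * t ^ (m - n)) * b + r"
      using D(3) by (simp add: a'_def algebra_simps)
    then show ?thesis
      using D lb by (intro exI[of _ "D * lb"] exI[of _ "q + D * la * t ^ (m - n)"] exI[of _ r]) (simp add: free_mult)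
  qed
qed

text \<open>
  A nonzero element of least degree in the ideal (a, b) divides both generators up to a factor free of
  t, by division with remainder.
\<close>

lemma pseudo_gcd:
  assumes "a \<noteq> 0 \<or> b \<noteq> 0"
  shows "\<exists>h u v D. h = u * a + v * b \<and> h \<noteq> 0 \<and> free D \<and> D \<noteq> 0 \<and> h dvd D * a \<and> h dvd D * b"
proof -
  define J where "J h \<longleftrightarrow> h \<noteq> 0 \<and> (\<exists>u v. h = u * a + v * b)" for h
  have "a = 1 * a + 0 * b" "b = 0 * a + 1 * b" by simp_all
  then have "\<exists>h. J h" using assms unfolding J_def by blast
  then obtain h where h: "J h" "\<And>h'. J h' \<Longrightarrow> deg h \<le> deg h'"
    using ex_has_least_nat[of J _ deg] by blast
  then obtain u v where huv: "h = u * a + v * b" and h0: "h \<noteq> 0" by (auto simp: J_def)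
  have *: "\<exists>D. free D \<and> D \<noteq> 0 \<and> h dvd D * c" if c: "c = u' * a + v' * b" for c u' v'
  proof -
    obtain D q r where D: "free D" "D \<noteq> 0" "D * c = q * h + r" "r = 0 \<or> deg r < deg h"
      using pseudo_division[OF h0, of c] by blast
    have "r = (D * u' - q * u) * a + (D * v' - q * v) * b"
      using D(3) unfolding c huv by (simp add: algebra_simps)
    then have "J r" if "r \<noteq> 0" using that unfolding J_def by blast
    then have "r = 0" using D(4) h(2)[of r] by fastforce
    then show ?thesis using D by auto
  qed
  obtain D1 where D1: "free D1" "D1 \<noteq> 0" "h dvd D1 * a" using *[of a 1 0] by auto
  obtain D2 where D2: "free D2" "D2 \<noteq> 0" "h dvd D2 * b" using *[of b 0 1] by auto
  have "h dvd D1 * D2 * a" "h dvd D1 * D2 * b"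
    using dvd_mult[OF D1(3), of D2] dvd_mult[OF D2(3), of D1] by (simp_all only: ac_simps)
  then show ?thesis
    using huv h0 D1 D2 free_mult[OF D1(1) D2(1)]
    by (intro exI[of _ h] exI[of _ u] exI[of _ v] exI[of _ "D1 * D2"]) simp
qed

text \<open>
  Otherwise all powers of h divide the corresponding powers of D times the minors, and the degree of
  h^n outgrows the fixed degree of a minor.
\<close>

lemma deg_0_of_dvd_minors:
  fixes f :: "3 \<Rightarrow> 'a"
  assumes "syzygy_basis f l p" "f k \<noteq> 0" "\<And>i. h dvd D * minors l p i" "D \<noteq> 0" "free D"
  shows "deg h = 0"
proof (rule ccontr)
  assume h: "deg h \<noteq> 0"
  then have h0: "h \<noteq> 0" by (auto simp: j_simps(1))
  define n where "n = Suc (deg (minors l p k))"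
  have "\<forall>i. \<exists>a. D * minors l p i = h * a"
    using assms(3) by (auto elim: dvdE)
  from choice[OF this] obtain a where a: "\<And>i. D * minors l p i = h * a i" by blast
  obtain b where "\<forall>i. h ^ n * b i = D ^ n * minors l p i"
    using powers_of_multiplier[OF assms(1,2) h0 a[symmetric]] by blast
  then have b: "h ^ n * b k = D ^ n * minors l p k" by blast
  have k: "minors l p k \<noteq> 0" by (rule minors_nonzero[OF assms(1,2)])
  have "deg (h ^ n) \<le> deg (D ^ n * minors l p k)"
  proof (rule deg_le_of_dvd)
    show "h ^ n dvd D ^ n * minors l p k" by (rule dvdI[OF b[symmetric]])
    show "D ^ n * minors l p k \<noteq> 0" using k assms(4) by simp
  qed
  also have "\<dots> = deg (minors l p k)"
    using k assms(4) free_deg[OF free_power[OF assms(5)]] by (simp add: deg_mult)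
  finally have "n * deg h \<le> deg (minors l p k)" by (simp only: deg_power[OF h0])
  moreover have "n * 1 \<le> n * deg h" using h by (intro mult_le_mono2) simp
  ultimately show False by (simp add: n_def)
qed

text \<open>
  The generator produced by \<open>pseudo_gcd\<close> divides all minors up to a factor free of t, hence is free
  of t itself.
\<close>

lemma bezout_of_minors:
  fixes f :: "3 \<Rightarrow> 'a"
  assumes "syzygy_basis f l p" "f k \<noteq> 0" "\<And>i. r * minors l p i = u i * a + v i * b" "r \<noteq> 0" "free r"
  shows "\<exists>h x y. h = x * a + y * b \<and> h \<noteq> 0 \<and> free h"
proof -
  have "r * minors l p k \<noteq> 0" using minors_nonzero[OF assms(1,2)] assms(4) by simp
  then have "a \<noteq> 0 \<or> b \<noteq> 0" using assms(3)[of k] by auto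
  then obtain h x y D where h: "h = x * a + y * b" "h \<noteq> 0" "free D" "D \<noteq> 0" "h dvd D * a" "h dvd D * b"
    using pseudo_gcd by blast
  have "h dvd (D * r) * minors l p i" for i
  proof -
    have "(D * r) * minors l p i = u i * (D * a) + v i * (D * b)"
      using assms(3)[of i] by (simp add: mult.assoc) (simp add: algebra_simps)
    then show ?thesis using h(5,6) by simp
  qed
  then have "deg h = 0"
    using deg_0_of_dvd_minors[OF assms(1,2), of h "D * r"] h assms(4,5) by (simp add: free_mult)
  then show ?thesis using h deg_0_free by blast
qed

end

section \<open>Homomorphisms from univariate polynomial rings\<close>

lemma ring_map_map_poly:
  assumes "ring_map h"
  shows "ring_map (map_poly h)"
proof (rule ring_mapI)
  have h0: "h 0 = 0" by (rule ring_map_zero[OF assms])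
  show "map_poly h 1 = 1"
    by (simp add: one_pCons map_poly_pCons[of h, OF h0] ring_map_one[OF assms])
  show "map_poly h (p + q) = map_poly h p + map_poly h q" for p q
    by (simp add: poly_eq_iff coeff_map_poly[of h, OF h0] ring_map_add[OF assms])
  show "map_poly h (p * q) = map_poly h p * map_poly h q" for p q
    by (simp add: poly_eq_iff coeff_map_poly[of h, OF h0] coeff_mult ring_map_sum[OF assms] ring_map_mult[OF assms])
qed

definition lift :: "('a::comm_ring_1 \<Rightarrow> 'b::comm_ring_1) \<Rightarrow> 'b \<Rightarrow> 'a poly \<Rightarrow> 'b" where
  "lift h t p = poly (map_poly h p) t"

lemma ring_map_lift: "ring_map h \<Longrightarrow> ring_map (lift h t)"
  unfolding lift_def by (rule ring_map_comp[OF ring_map_poly ring_map_map_poly])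

lemma lift_const: "ring_map h \<Longrightarrow> lift h t [:a:] = h a"
  by (simp add: lift_def map_poly_pCons ring_map_zero)

lemma lift_X: "ring_map h \<Longrightarrow> lift h t [:0, 1:] = t"
  by (simp add: lift_def map_poly_pCons ring_map_zero ring_map_one)

lemma ring_map_poly_unique:
  fixes p :: "'a::comm_ring_1 poly"
  assumes "ring_map g" "ring_map h" "\<And>a. g [:a:] = h [:a:]" "g [:0, 1:] = h [:0, 1:]"
  shows "g p = h p"
proof (induction p)
  case (pCons a p)
  have "pCons a p = [:a:] + [:0, 1:] * p" by simp
  then show ?case
    by (simp only: ring_map_simps(3,4)[OF assms(1)] ring_map_simps(3,4)[OF assms(2)] assms(3,4) pCons(2))
qed (simp add: ring_map_zero[OF assms(1)] ring_map_zero[OF assms(2)])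

lemma ring_map_const_mconst: "ring_map (\<lambda>c. [:mconst c:])"
  by (rule ring_map_comp[OF ring_map_const_poly ring_map_mconst])

lemma meval_const_poly:
  assumes "ring_map \<kappa>"
  shows "meval (\<lambda>c. [:\<kappa> c:]) (\<lambda>v. [:s v:]) q = [:meval \<kappa> s q:]"
  using ring_map_meval_comp[OF assms ring_map_const_poly, of s q] by simp

section \<open>Distinguished variables of R and of R[T]\<close>

lemma coeff_closed:
  assumes "ring_map (j :: 'a::idom \<Rightarrow> 'a poly)"
    and "\<And>n. j (coeff (j a) n) = [:coeff (j a) n:]" "\<And>n. j (coeff (j b) n) = [:coeff (j b) n:]"
  shows "j (coeff (j (a + b)) n) = [:coeff (j (a + b)) n:]"
    and "j (coeff (j (a * b)) n) = [:coeff (j (a * b)) n:]"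
proof -
  show "j (coeff (j (a + b)) n) = [:coeff (j (a + b)) n:]"
    by (simp add: ring_map_add[OF assms(1)] assms(2,3))
  have "[:\<Sum>i\<le>n. coeff (j a) i * coeff (j b) (n - i):] = (\<Sum>i\<le>n. [:coeff (j a) i * coeff (j b) (n - i):])"
    by (rule ring_map_sum[OF ring_map_const_poly])
  then show "j (coeff (j (a * b)) n) = [:coeff (j (a * b)) n:]"
    by (simp add: ring_map_mult[OF assms(1)] coeff_mult ring_map_sum[OF assms(1)] assms(2,3)
        mult.commute[of "coeff (j b) _"])
qed

definition split_variable :: "3 \<Rightarrow> 'k::field R \<Rightarrow> 'k R poly" where
  "split_variable v = meval (\<lambda>c. [:mconst c:]) (\<lambda>u. if u = v then [:0, 1:] else [:mvar u:])"

lemma split_variable_simps: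
  "ring_map (split_variable v)"
  "split_variable v (mconst c) = [:mconst c:]"
  "split_variable v (mvar u) = (if u = v then [:0, 1:] else [:mvar u:])"
  by (simp_all add: split_variable_def ring_map_meval[OF ring_map_const_mconst]
      meval_mconst[OF ring_map_const_mconst] meval_mvar[OF ring_map_const_mconst])

lemma free_variable_split: "free_variable (split_variable v) (mvar v :: 'k::field R)"
proof
  show r: "ring_map (split_variable v :: 'k R \<Rightarrow> _)" by (rule split_variable_simps)
  show "split_variable v (mvar v) = [:0, 1 :: 'k R:]" by (simp add: split_variable_simps)
  show "poly (split_variable v a) (mvar v) = a" for a :: "'k R"
    by (rule ring_map_mpoly_unique[OF ring_map_comp[OF ring_map_poly r] ring_map_id])
      (simp_all add: split_variable_simps(2,3))
  show "split_variable v (coeff (split_variable v a) n) = [:coeff (split_variable v a) n:]" for a :: "'k R" and n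
  proof (induction a arbitrary: n rule: mpoly_induct)
    case (const c)
    show ?case by (cases n) (simp_all add: split_variable_simps(2) ring_map_zero[OF r])
  next
    case (var u)
    show ?case
      by (auto simp: split_variable_simps(3) coeff_pCons ring_map_zero[OF r] ring_map_one[OF r] one_pCons split: nat.splits)
  qed (rule coeff_closed[OF r]; assumption)+
qed

text \<open>
  The value s v may mix variables; for instance x_2 = (x_2 - T x_0) + T c exhibits the coefficients that
  are constant along lines of direction (1, 0, T), parametrized by c = x_0.
\<close>

definition split_map :: "(3 \<Rightarrow> 'k::field R poly poly) \<Rightarrow> 'k R poly \<Rightarrow> 'k R poly poly" where
  "split_map s = lift (meval (\<lambda>c. [:[:mconst c:]:]) s) [:[:0, 1:]:]"

lemma ring_map_const2_mconst: "ring_map (\<lambda>c. [:[:mconst c:]:])"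
  by (rule ring_map_comp[OF ring_map_const_poly ring_map_const_mconst])

lemma split_map_simps:
  "ring_map (split_map s)"
  "split_map s [:mconst c:] = [:[:mconst c:]:]"
  "split_map s [:mvar v:] = s v"
  "split_map s [:0, 1:] = [:[:0, 1:]:]"
proof -
  note r = ring_map_meval[OF ring_map_const2_mconst, of s]
  show "ring_map (split_map s)" "split_map s [:mconst c:] = [:[:mconst c:]:]"
    "split_map s [:mvar v:] = s v" "split_map s [:0, 1:] = [:[:0, 1:]:]"
    by (simp_all add: split_map_def ring_map_lift[OF r] lift_const[OF r] lift_X[OF r]
        meval_mconst[OF ring_map_const2_mconst] meval_mvar[OF ring_map_const2_mconst])
qed

lemma ring_map_Rpoly_unique:
  fixes p :: "('v::finite, 'k::field) mpoly poly"
  assumes "ring_map g" "ring_map h" "\<And>c. g [:mconst c:] = h [:mconst c:]" "\<And>v. g [:mvar v:] = h [:mvar v:]"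
    "g [:0, 1:] = h [:0, 1:]"
  shows "g p = h p"
  by (rule ring_map_poly_unique[OF assms(1,2) _ assms(5)])
    (rule ring_map_mpoly_unique[OF ring_map_comp[OF assms(1) ring_map_const_poly] ring_map_comp[OF assms(2) ring_map_const_poly] assms(3,4)])

lemma Rpoly_induct [case_names const var X add mult]:
  fixes p :: "('v::finite, 'k::field) mpoly poly"
  assumes "\<And>c. P [:mconst c:]" "\<And>v. P [:mvar v:]" "P [:0, 1:]"
    and "\<And>p q. P p \<Longrightarrow> P q \<Longrightarrow> P (p + q)" "\<And>p q. P p \<Longrightarrow> P q \<Longrightarrow> P (p * q)"
  shows "P p"
proof -
  have c: "P [:a:]" for a
  proof (induction a rule: mpoly_induct)
    case (add p q) then show ?case using assms(4)[of "[:p:]" "[:q:]"] by simp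
  next
    case (mult p q) then show ?case using assms(5)[of "[:p:]" "[:q:]"] by (simp add: mult.commute)
  qed (rule assms)+
  show ?thesis
  proof (induction p)
    case 0 show ?case using c[of 0] by simp
  next
    case (pCons a p)
    have "pCons a p = [:a:] + [:0, 1:] * p" by simp
    then show ?case using assms(4)[OF c assms(5)[OF assms(3) pCons(2)]] by simp
  qed
qed

lemma free_variable_split_map:
  fixes s :: "3 \<Rightarrow> 'k::field R poly poly"
  assumes "s i = [:0, 1:]" "\<And>v. poly (s v) [:mvar i:] = [:mvar v:]"
    and "\<And>v n. split_map s (coeff (s v) n) = [:coeff (s v) n:]"
  shows "free_variable (split_map s) [:mvar i:]"
proof
  show r: "ring_map (split_map s)" by (rule split_map_simps)
  show "split_map s [:mvar i:] = [:0, 1:]" by (simp add: split_map_simps assms(1))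
  show "poly (split_map s a) [:mvar i:] = a" for a
    by (rule ring_map_Rpoly_unique[OF ring_map_comp[OF ring_map_poly r] ring_map_id])
      (simp_all only: split_map_simps(2-4) assms(2), simp_all)
  show "split_map s (coeff (split_map s a) n) = [:coeff (split_map s a) n:]" for a n
  proof (induction a arbitrary: n rule: Rpoly_induct)
    case (const c)
    show ?case by (cases n) (simp_all add: split_map_simps(2) ring_map_zero[OF r])
  next
    case (var v)
    show ?case by (simp only: split_map_simps(3) assms(3))
  next
    case X
    show ?case by (cases n) (simp_all add: split_map_simps(4) ring_map_zero[OF r])
  qed (rule coeff_closed[OF r]; assumption)+
qed

text \<open>
  A relation over the polynomial ring is a family of relations, one for each power of the variable.
\<close>

lemma syzygy_basis_const_poly:
  fixes f l p :: "3 \<Rightarrow> 'a::idom"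
  assumes "syzygy_basis f l p"
  shows "syzygy_basis (\<lambda>i. [:f i:]) (\<lambda>i. [:l i:]) (\<lambda>i. [:p i:])"
  unfolding syzygy_basis_def
proof (intro allI iffI)
  fix w :: "3 \<Rightarrow> 'a poly"
  assume "\<exists>u v. \<forall>i. w i = u * [:l i:] + v * [:p i:]"
  then obtain u v where uv: "\<And>i. w i = u * [:l i:] + v * [:p i:]" by blast
  have "(\<Sum>i\<in>UNIV. [:f i:] * w i) = u * (\<Sum>i\<in>UNIV. [:f i:] * [:l i:]) + v * (\<Sum>i\<in>UNIV. [:f i:] * [:p i:])"
    unfolding uv sum_UNIV_3 by (simp only: algebra_simps)
  also have "(\<Sum>i\<in>UNIV. [:f i:] * [:l i:]) = [:\<Sum>i\<in>UNIV. f i * l i:]"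
    by (simp add: sum_UNIV_3)
  also have "(\<Sum>i\<in>UNIV. [:f i:] * [:p i:]) = [:\<Sum>i\<in>UNIV. f i * p i:]"
    by (simp add: sum_UNIV_3)
  finally show "(\<Sum>i\<in>UNIV. [:f i:] * w i) = 0"
    by (simp add: syzygy_basisD(1,2)[OF assms])
next
  fix w :: "3 \<Rightarrow> 'a poly"
  assume w: "(\<Sum>i\<in>UNIV. [:f i:] * w i) = 0"
  have "\<exists>u v. \<forall>i. coeff (w i) n = u * l i + v * p i" for n
  proof (rule syzygy_basisD(3)[OF assms])
    have "coeff (\<Sum>i\<in>UNIV. [:f i:] * w i) n = 0" using w by simp
    then show "(\<Sum>i\<in>UNIV. f i * coeff (w i) n) = 0" by (simp add: coeff_sum)
  qed
  then obtain u v where uv: "\<And>n i. coeff (w i) n = u n * l i + v n * p i" by metis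
  define N where "N = degree (w 0) + degree (w 1) + degree (w 2)"
  have N: "degree (w i) \<le> N" for i
    by (cases i rule: cases_3) (simp_all add: N_def)
  define U V where "U = (\<Sum>n\<le>N. monom (u n) n)" and "V = (\<Sum>n\<le>N. monom (v n) n)"
  have "w i = U * [:l i:] + V * [:p i:]" for i
  proof (rule poly_eqI)
    fix n
    have "coeff (w i) n = (if n \<le> N then u n * l i + v n * p i else 0)"
      using uv[of i n] N[of i] coeff_eq_0[of "w i" n] by (cases "n \<le> N") simp_all
    then show "coeff (w i) n = coeff (U * [:l i:] + V * [:p i:]) n"
      by (auto simp: U_def V_def coeff_sum mult.commute)
  qed
  then show "\<exists>u v. \<forall>i. w i = u * [:l i:] + v * [:p i:]" by blast
qed

lemma minors_const_poly: "minors (\<lambda>i. [:l i:]) (\<lambda>i. [:p i:]) k = [:minors l p k:]"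
  by (simp add: minors_def)

section \<open>A degree bound for maps with a left inverse\<close>

lemma (in free_variable) free_meval:
  assumes "ring_map \<kappa>" "\<And>c. free (\<kappa> c)" "\<And>v. free (Y v)"
  shows "free (meval \<kappa> Y q)"
proof -
  have "j (meval \<kappa> Y q) = meval (\<lambda>c. [:\<kappa> c:]) (\<lambda>v. [:Y v:]) q"
    using assms(2,3) by (simp add: ring_map_meval_comp[OF assms(1) j] free_def)
  then show ?thesis by (simp add: free_def meval_const_poly[OF assms(1)])
qed

text \<open>
  E = a + b T is an equation modulo which \<open>\<delta>\<close> becomes, up to factors, a vector Y that is free of t,
  while the point x moves on a line with parameter t. Each 2 \<times> 2 minor of x and g(Y) then has degree at
  most 1 in t and is divisible by E up to a factor h^e free of t. If E had larger degree, all these minors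
  would be zero. As the line does not pass through the origin, this means g(Y) = 0, so that E would divide
  a nonzero element free of T. The element h comes from \<open>bezout_of_minors\<close>: if E divides b z, it also
  divides a z, because a = E - b T, and hence h z.
\<close>

lemma degree_le_1_of_inverse:
  fixes f l p g :: "3 \<Rightarrow> 'k::field R" and Y :: "3 \<Rightarrow> 'k R poly"
  assumes "free_variable j t"
    and syz: "syzygy_basis f l p" "f k \<noteq> 0"
    and g: "\<And>i. homogeneous e (g i)" "parallel (\<lambda>i. meval mconst (minors l p) (g i)) mvar"
      "meval mconst (minors l p) (g i0) \<noteq> 0"
    and r: "\<And>i. r * minors l p i = u i * a + v i * b" "r \<noteq> 0" "free_variable.free j [:r:]"
    and b: "b \<noteq> 0" "b' = b \<or> b' = - b"
    and congr: "\<And>i. [:a, b:] dvd [:r:] * [:minors l p i:] - [:b':] * Y i"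
    and free: "\<And>c. free_variable.free j [:mconst c:]" "\<And>i. free_variable.free j (Y i)"
    and X: "\<And>i. degree (j [:mvar i:]) \<le> 1"
      "coeff (j [:mvar m:]) 1 * coeff (j [:mvar n:]) 0 \<noteq> coeff (j [:mvar n:]) 1 * coeff (j [:mvar m:]) 0"
  shows "degree (j [:a, b:]) \<le> 1"
proof (rule ccontr)
  assume deg: "\<not> ?thesis"
  interpret free_variable j t by fact
  define E where "E = [:a, b:]"
  define W where "W i = meval (\<lambda>c. [:mconst c:]) Y (g i)" for i
  have E0: "E \<noteq> 0" "degree E = 1" using b(1) by (simp_all add: E_def)
  have "\<exists>h x y. h = x * [:a:] + y * [:b:] \<and> h \<noteq> 0 \<and> free h"
  proof (rule bezout_of_minors[OF syzygy_basis_const_poly[OF syz(1)], where r = "[:r:]" and k = k])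
    show "[:r:] * minors (\<lambda>i. [:l i:]) (\<lambda>i. [:p i:]) i = [:u i:] * [:a:] + [:v i:] * [:b:]" for i
      using r(1)[of i] by (simp add: minors_const_poly mult.commute)
  qed (use syz(2) r in auto)
  then obtain h x y where h: "h = x * [:a:] + y * [:b:]" "h \<noteq> 0" "free h" by blast
  have cancel: "E dvd h * z" if "E dvd [:b':] * z" for z
  proof -
    have bz: "E dvd [:b:] * z"
    proof (cases "b' = b")
      case False
      then have "[:b:] * z = - ([:b':] * z)" using b(2) by simp
      then show ?thesis using that by (metis dvd_minus_iff)
    qed (use that in simp)
    have "[:a:] * z = E * z - [:0, 1:] * ([:b:] * z)"
      by (simp add: E_def algebra_simps)
    then have "E dvd [:a:] * z" using bz by (metis dvd_diff dvd_mult dvd_triv_left)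
    moreover have "h * z = x * ([:a:] * z) + y * ([:b:] * z)" unfolding h(1) by (simp only: algebra_simps)
    ultimately show ?thesis using bz by (metis dvd_add dvd_mult)
  qed
  have par: "parallel (\<lambda>i. meval (\<lambda>c. [:mconst c:]) (\<lambda>i. [:minors l p i:]) (g i)) (\<lambda>i. [:mvar i:])"
    using g(2) by (simp add: meval_const_poly[OF ring_map_mconst] parallel_def mult.commute)
  have dvd: "E dvd h ^ e * (W i * [:mvar j':] - W j' * [:mvar i:])" for i j'
    unfolding W_def
    by (rule inverse_mod[where r = "[:r:]" and b = "[:b':]", OF ring_map_const_mconst _ cancel g(1) par])
      (simp_all only: E_def congr)
  have Wfree: "j (W i) = [:W i:]" for i
    using free_meval[OF ring_map_const_mconst free] by (simp add: W_def free_def)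
  have M0: "W i * [:mvar j':] - W j' * [:mvar i:] = 0" for i j'
  proof (rule ccontr)
    assume M: "W i * [:mvar j':] - W j' * [:mvar i:] \<noteq> 0"
    have "deg E \<le> deg (h ^ e * (W i * [:mvar j':] - W j' * [:mvar i:]))"
      by (rule deg_le_of_dvd[OF dvd]) (use M h(2) in simp)
    also have "\<dots> = deg (W i * [:mvar j':] - W j' * [:mvar i:])"
      using M h free_deg[OF free_power[OF h(3)]] by (subst deg_mult) simp_all
    also have "\<dots> \<le> 1"
      unfolding j_simps Wfree
      by (intro degree_diff_le order.trans[OF degree_mult_le]) (use X(1) in simp_all)
    finally show False using deg by (simp add: E_def)
  qed
  have eq: "W i * coeff (j [:mvar j':]) n' = W j' * coeff (j [:mvar i:]) n'" for i j' n'
  proof -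
    have "j (W i * [:mvar j':] - W j' * [:mvar i:]) = 0" using M0 by (simp add: j_simps)
    then have "[:W i:] * j [:mvar j':] = [:W j':] * j [:mvar i:]"
      by (simp only: j_simps Wfree right_minus_eq)
    then have "coeff ([:W i:] * j [:mvar j':]) n' = coeff ([:W j':] * j [:mvar i:]) n'" by simp
    then show ?thesis by simp
  qed
  define xm vm xn vn where "xm = coeff (j [:mvar m:]) 0" and "vm = coeff (j [:mvar m:]) 1"
    and "xn = coeff (j [:mvar n:]) 0" and "vn = coeff (j [:mvar n:]) 1"
  have e: "W m * xn = W n * xm" "W m * vn = W n * vm"
    using eq by (simp_all add: xm_def xn_def vm_def vn_def)
  have ne: "vm * xn - vn * xm \<noteq> 0" using X(2) by (simp add: xm_def xn_def vm_def vn_def)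
  have "W m * (vm * xn - vn * xm) = vm * (W m * xn) - xm * (W m * vn)" by (simp add: algebra_simps)
  also have "\<dots> = 0" unfolding e by (simp add: algebra_simps)
  finally have Wm: "W m = 0" using ne by simp
  have "W n * (vm * xn - vn * xm) = (W n * vm) * xn - (W n * xm) * vn" by (simp add: algebra_simps)
  also have "\<dots> = 0" unfolding e[symmetric] by (simp add: algebra_simps)
  finally have Wn: "W n = 0" using ne by simp
  have W0: "W i = 0" for i
  proof -
    have "W i * xm = 0" "W i * vm = 0"
      using eq[of i m 0] eq[of i m 1] Wm by (simp_all add: xm_def vm_def)
    then show ?thesis using ne by auto
  qed
  have "E dvd [:r:] ^ e * meval (\<lambda>c. [:mconst c:]) (\<lambda>i. [:minors l p i:]) (g i0) - [:b':] ^ e * W i0"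
    unfolding W_def
    by (rule form_cong_mod[OF ring_map_const_mconst _ g(1)]) (simp only: E_def congr)
  then have "E dvd [:r ^ e * meval mconst (minors l p) (g i0):]"
    by (simp add: W0 meval_const_poly[OF ring_map_mconst] poly_const_pow mult.commute)
  then have "degree E \<le> 0"
    using dvd_imp_degree_le[of E "[:r ^ e * meval mconst (minors l p) (g i0):]"] g(3) r(2) by simp
  then show False using E0 by simp
qed

section \<open>Left inverses and algebraic independence of triples of forms\<close>

text \<open>
  Up to a common factor, g composed with f is the identity.
\<close>

definition has_inverse :: "(3 \<Rightarrow> 'k::field R) \<Rightarrow> bool" where
  "has_inverse f \<longleftrightarrow> (\<exists>e g. (\<forall>i. homogeneous e (g i)) \<and>
     parallel (\<lambda>i. msubst f (g i)) mvar \<and> (\<exists>i. msubst f (g i) \<noteq> 0))"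

definition forms_independent :: "(3 \<Rightarrow> 'k::field R) \<Rightarrow> bool" where
  "forms_independent f \<longleftrightarrow> (\<forall>n h. homogeneous n h \<longrightarrow> msubst f h = 0 \<longrightarrow> h = 0)"

lemma homogeneous_mvar: "homogeneous 1 (mvar i)"
  unfolding homogeneous_eq_weighted by (rule weighted_mvar)

lemma mvar_nonzero [simp]: "mvar v \<noteq> (0 :: ('v, 'k::field) mpoly)"
proof
  assume "mvar v = (0 :: ('v, 'k) mpoly)"
  then have "Poly_Mapping.lookup (mvar v :: ('v, 'k) mpoly) (Poly_Mapping.single v 1) = 0" by simp
  then show False by (simp add: mvar_def)
qed

lemma msubst_simps:
  "msubst s (mconst c) = mconst c" "msubst s (mvar v) = s v" "ring_map (msubst s)"
  by (simp_all add: msubst_eq_meval meval_mconst[OF ring_map_mconst] meval_mvar[OF ring_map_mconst] ring_map_meval[OF ring_map_mconst])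

lemma forms_independent_nonzero: "forms_independent f \<Longrightarrow> f i \<noteq> 0"
  unfolding forms_independent_def using homogeneous_mvar[of i] msubst_simps(2)[of f i] mvar_nonzero[of i] by metis

lemma parallel_form:
  assumes "ring_map \<kappa>" "parallel a b" "homogeneous e q"
  shows "b k ^ e * meval \<kappa> a q = a k ^ e * meval \<kappa> b q"
proof -
  have "meval \<kappa> (\<lambda>v. b k * a v) q = meval \<kappa> (\<lambda>v. a k * b v) q"
    by (rule meval_cong) (use assms(2) in \<open>simp add: parallel_def mult.commute\<close>)
  then show ?thesis by (simp add: meval_scale_homogeneous[OF assms(1,3)])
qed

text \<open>
  Proportional vectors define the same rational map, so they satisfy the same forms.
\<close>

lemma parallel_form_eq_0_iff:
  fixes a b :: "3 \<Rightarrow> 'k::field R"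
  assumes "parallel a b" "homogeneous e q" "a k \<noteq> 0" "b k \<noteq> 0"
  shows "msubst a q = 0 \<longleftrightarrow> msubst b q = 0"
  using parallel_form[OF ring_map_mconst assms(1,2), of k] assms(3,4)
  by (metis msubst_eq_meval mult_eq_0_iff power_not_zero)

lemma has_inverse_parallel:
  fixes a b :: "3 \<Rightarrow> 'k::field R"
  assumes "has_inverse a" "parallel a b" "a k \<noteq> 0" "b k \<noteq> 0"
  shows "has_inverse b"
proof -
  obtain e g where g: "\<And>i. homogeneous e (g i)" "parallel (\<lambda>i. msubst a (g i)) mvar" "\<exists>i. msubst a (g i) \<noteq> 0"
    using assms(1) by (auto simp: has_inverse_def)
  have eq: "b k ^ e * msubst a (g i) = a k ^ e * msubst b (g i)" for i
    using parallel_form[OF ring_map_mconst assms(2) g(1)] by (simp add: msubst_eq_meval)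
  have "parallel (\<lambda>i. msubst b (g i)) mvar"
    unfolding parallel_def
  proof (intro allI)
    fix i j
    have "a k ^ e * (msubst b (g i) * mvar j) = (b k ^ e * msubst a (g i)) * mvar j"
      by (simp only: eq mult.assoc)
    also have "\<dots> = (b k ^ e * msubst a (g j)) * mvar i"
      using g(2) by (simp add: parallel_def mult.assoc)
    also have "\<dots> = a k ^ e * (msubst b (g j) * mvar i)" by (simp only: eq mult.assoc)
    finally show "msubst b (g i) * mvar j = msubst b (g j) * mvar i"
      using assms(3) by simp
  qed
  moreover have "\<exists>i. msubst b (g i) \<noteq> 0"
    using g(3) parallel_form_eq_0_iff[OF assms(2) g(1) assms(3,4)] by blast
  ultimately show ?thesis using g(1) by (auto simp: has_inverse_def)
qed

lemma minors_homogeneous: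
  assumes "\<And>i. homogeneous a (l i)" "\<And>i. homogeneous b (p i)"
  shows "homogeneous (a + b) (minors l p i)"
  using assms unfolding homogeneous_eq_weighted minors_def by (intro weighted_diff weighted_mult)

section \<open>A linear column of rank three\<close>

lemma mvar_dvd:
  fixes p :: "'k::field R"
  assumes "msubst (\<lambda>u. if u = v then 0 else mvar u) p = 0"
  shows "mvar v dvd p"
proof -
  interpret free_variable "split_variable v" "mvar v :: 'k R" by (rule free_variable_split)
  have "poly (split_variable v p) 0 = msubst (\<lambda>u. if u = v then 0 else mvar u) p"
    by (rule ring_map_mpoly_unique[OF ring_map_comp[OF ring_map_poly j] msubst_simps(3)])
      (simp_all add: split_variable_simps(2,3) msubst_simps(1,2))
  then have "[:0, 1:] dvd split_variable v p"
    using assms by (simp add: poly_eq_0_iff_dvd)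
  then obtain q where "split_variable v p = [:0, 1:] * q" by (elim dvdE)
  then have "p = mvar v * poly q (mvar v)"
    using poly_j[of p] by simp
  then show ?thesis by simp
qed

text \<open>
  The line x_1 = 0 is parametrized by (1, 0, T); substituting T = x_2 / x_0 and clearing denominators by
  homogeneity turns vanishing at (1, 0, T) into vanishing at x_1 = 0.
\<close>

lemma mvar_dvd_of_vanishing:
  fixes p :: "'k::field R"
  assumes "homogeneous d p"
    and "meval (\<lambda>c. [:mconst c:]) (\<lambda>i. if i = 0 then 1 else if i = 1 then 0 else [:0, 1:]) p = (0 :: 'k R poly)"
  shows "mvar 1 dvd p"
proof (rule mvar_dvd)
  define F :: "'k R \<Rightarrow> 'k R fract" where "F a = Fraction_Field.Fract a 1" for a
  have F0: "F a = 0 \<longleftrightarrow> a = 0" for a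
    by (simp add: F_def Zero_fract_def eq_fract)
  define T :: "'k R fract" where "T = F (mvar 2) / F (mvar 0)"
  define s :: "3 \<Rightarrow> 'k R poly" where "s i = (if i = 0 then 1 else if i = 1 then 0 else [:0, 1:])" for i
  have r: "ring_map F" by (simp add: ring_map_def F_def One_fract_def)
  note rl = ring_map_lift[OF r, of T]
  note rc = ring_map_comp[OF r ring_map_mconst]
  have "F (mvar 0) * T = F (mvar 2)" by (simp add: T_def F0)
  then have e: "F (mvar 0) * lift F T (s v) = F (if v = 1 then 0 else mvar v)" for v
    by (cases v rule: cases_3)
      (simp_all add: s_def ring_map_zero[OF rl] ring_map_one[OF rl] lift_X[OF r] F0)
  have "F (msubst (\<lambda>u. if u = 1 then 0 else mvar u) p) =
      meval (\<lambda>c. F (mconst c)) (\<lambda>v. F (mvar 0) * lift F T (s v)) p"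
    unfolding msubst_eq_meval e by (rule ring_map_meval_comp[OF ring_map_mconst r])
  also have "\<dots> = F (mvar 0) ^ d * meval (\<lambda>c. F (mconst c)) (\<lambda>v. lift F T (s v)) p"
    by (rule meval_scale_homogeneous[OF rc assms(1)])
  also have "meval (\<lambda>c. F (mconst c)) (\<lambda>v. lift F T (s v)) p =
      lift F T (meval (\<lambda>c. [:mconst c:]) s p)"
    by (simp add: ring_map_meval_comp[OF ring_map_const_mconst rl] lift_const[OF r])
  also have "\<dots> = 0" using assms(2) by (simp add: s_def[abs_def] ring_map_zero[OF rl])
  finally show "msubst (\<lambda>u. if u = 1 then 0 else mvar u) p = 0" by (simp add: F0)
qed

text \<open>
  With l = x, the minors satisfy \<open>x \<bullet> \<delta> = 0\<close>, and E = (1, 0, T) \<bullet> \<delta> cuts out the points x whose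
  image lies on a line of the pencil defined by T. Modulo E the vector x_1 \<delta> is \<open>\<delta>_2\<close> times
  Y = (-T x_1, T x_0 - x_2, x_1), the cross product of (1, 0, T) and x, which does not change when x
  moves in direction (1, 0, T). On such a line E has degree n \<ge> 2, so \<open>degree_le_1_of_inverse\<close> forbids a
  left inverse.
\<close>

lemma no_inverse_if_linear_forms_independent:
  fixes f p :: "3 \<Rightarrow> 'k::field R"
  assumes syz: "syzygy_basis f mvar p" and f2: "f 2 \<noteq> 0"
    and hom: "\<And>i. homogeneous n (p i)" and n: "n \<ge> 2"
  shows "\<not> has_inverse f"
proof
  assume inv: "has_inverse f"
  define \<delta> where "\<delta> = minors mvar p"
  have \<delta>2: "\<delta> 2 \<noteq> 0" using minors_nonzero[OF syz f2] by (simp add: \<delta>_def)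
  have hom\<delta>: "homogeneous (Suc n) (\<delta> i)" for i
  proof -
    have "homogeneous (1 + n) (\<delta> i)"
      unfolding \<delta>_def by (rule minors_homogeneous[OF homogeneous_mvar hom])
    then show ?thesis by simp
  qed
  have x\<delta>: "mvar 0 * \<delta> 0 + mvar 1 * \<delta> 1 + mvar 2 * \<delta> 2 = 0"
    by (simp add: \<delta>_def minors_simps algebra_simps)
  have "has_inverse \<delta>"
    using has_inverse_parallel[OF inv parallel_minors[OF syz] f2] \<delta>2 by (simp add: \<delta>_def)
  then obtain e g where g: "\<And>i. homogeneous e (g i)" "parallel (\<lambda>i. meval mconst (minors mvar p) (g i)) mvar"
    "\<exists>i. meval mconst (minors mvar p) (g i) \<noteq> 0"
    by (auto simp: has_inverse_def msubst_eq_meval \<delta>_def)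
  then obtain i0 where i0: "meval mconst (minors mvar p) (g i0) \<noteq> 0" by blast
  \<comment> \<open>The line through x of direction (1, 0, T), with parameter c = x_0.\<close>
  define s :: "3 \<Rightarrow> 'k R poly poly" where
    "s i = (if i = 0 then [:0, 1:] else if i = 1 then [:[:mvar 1:]:] else [:[:mvar 2, - mvar 0:], [:0, 1:]:])" for i
  define j where "j = split_map s"
  note jg = split_map_simps(2-4)[of s, folded j_def]
  note jr = split_map_simps(1)[of s, folded j_def]
  have j_lin: "j [:mvar 2, - mvar 0:] = [:[:mvar 2, - mvar 0:]:]"
  proof -
    have "[:mvar 2, - mvar 0:] = [:mvar 2:] - [:0, 1:] * [:mvar 0 :: 'k R:]" by simp
    then have "j [:mvar 2, - mvar 0:] = j [:mvar 2:] - j [:0, 1:] * j [:mvar 0:]"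
      by (simp only: ring_map_simps[OF jr])
    then show ?thesis by (simp add: jg s_def)
  qed
  have fv: "free_variable j [:mvar 0:]"
    unfolding j_def
  proof (rule free_variable_split_map)
    show "s 0 = [:0, 1:]" by (simp add: s_def)
    show "poly (s v) [:mvar 0:] = [:mvar v:]" for v
      by (cases v rule: cases_3) (simp_all add: s_def)
    show "split_map s (coeff (s v) m) = [:coeff (s v) m:]" for v m
      unfolding j_def[symmetric]
      using j_lin jg(2)[of 1] jg(3) ring_map_zero[OF jr] ring_map_one[OF jr]
      by (cases v rule: cases_3; cases m; cases "m - 1")
        (auto simp: s_def one_pCons coeff_pCons split: nat.splits)
  qed
  interpret free_variable j "[:mvar 0:]" by (rule fv)
  define Y :: "3 \<Rightarrow> 'k R poly" where
    "Y i = (if i = 0 then [:0, - mvar 1:] else if i = 1 then [:- mvar 2, mvar 0:] else [:mvar 1:])" for i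
  have fr1: "free [:mvar 1:]" by (simp add: free_def jg s_def)
  have le: "degree (j [:\<delta> 0, \<delta> 2:]) \<le> 1"
    unfolding \<delta>_def
  proof (rule degree_le_1_of_inverse[OF fv syz f2 g(1,2) i0, where r = "mvar 1" and b' = "minors mvar p 2" and Y = Y
        and m = 0 and n = 1 and u = "\<lambda>i. if i = 0 then mvar 1 else if i = 1 then - mvar 0 else 0"
        and v = "\<lambda>i. if i = 0 then 0 else if i = 1 then - mvar 2 else mvar 1"])
    show "mvar 1 * minors mvar p i = (if i = 0 then mvar 1 else if i = 1 then - mvar 0 else 0) * minors mvar p 0
      + (if i = 0 then 0 else if i = 1 then - mvar 2 else mvar 1) * minors mvar p 2" for i
      using x\<delta> by (cases i rule: cases_3) (simp_all add: \<delta>_def[symmetric] eq_neg_iff_add_eq_0 algebra_simps)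
    show "[:minors mvar p 0, minors mvar p 2:] dvd [:mvar 1:] * [:minors mvar p i:] - [:minors mvar p 2:] * Y i" for i
    proof (cases i rule: cases_3)
      case 1
      have "[:mvar 1:] * [:\<delta> i:] - [:\<delta> 2:] * Y i = [:mvar 1:] * [:\<delta> 0, \<delta> 2:]"
        by (simp add: 1 Y_def algebra_simps)
      then show ?thesis unfolding \<delta>_def[symmetric] by (metis dvd_triv_right)
    next
      case 2
      have "mvar 1 * \<delta> 1 + mvar 2 * \<delta> 2 = - (mvar 0 * \<delta> 0)"
        using x\<delta> by (simp add: eq_neg_iff_add_eq_0 algebra_simps)
      then have "[:mvar 1:] * [:\<delta> i:] - [:\<delta> 2:] * Y i = - [:mvar 0:] * [:\<delta> 0, \<delta> 2:]"
        by (simp add: 2 Y_def algebra_simps)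
      then show ?thesis unfolding \<delta>_def[symmetric] by (metis dvd_triv_right)
    next
      case 3
      then show ?thesis by (simp add: Y_def mult.commute)
    qed
    show "free (Y i)" for i
    proof (cases i rule: cases_3)
      case 1
      have "j (- ([:0, 1:] * [:mvar 1:])) = [:- ([:0, 1:] * [:mvar 1:]):]"
        unfolding ring_map_simps[OF jr] jg by (simp add: s_def)
      then show ?thesis by (simp add: free_def 1 Y_def)
    next
      case 2
      have "j (- [:mvar 2, - mvar 0:]) = [:- [:mvar 2, - mvar 0:]:]"
        unfolding ring_map_simps[OF jr] j_lin by simp
      then show ?thesis by (simp add: free_def 2 Y_def)
    next
      case 3 then show ?thesis using fr1 by (simp add: Y_def)
    qed
    show "free [:mconst c:]" for c by (simp add: free_def jg)
    show "degree (j [:mvar i:]) \<le> 1" for i by (cases i rule: cases_3) (simp_all add: jg s_def)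
    show "coeff (j [:mvar 0:]) 1 * coeff (j [:mvar 1:]) 0 \<noteq> coeff (j [:mvar 1:]) 1 * coeff (j [:mvar 0:]) 0"
      by (simp add: jg s_def)
  qed (use \<delta>2 fr1 in \<open>simp_all add: \<delta>_def\<close>)
  \<comment> \<open>The coefficients of c^(n + 1) are the values of the minors at the direction of the line.\<close>
  define v :: "3 \<Rightarrow> 'k R poly" where "v i = (if i = 0 then 1 else if i = 1 then 0 else [:0, 1:])" for i
  define dv where "dv i = meval (\<lambda>c. [:mconst c:]) v (\<delta> i)" for i
  have j_meval: "j [:q:] = meval (\<lambda>c. [:[:mconst c:]:]) s q" for q
    by (rule ring_map_mpoly_unique[OF ring_map_comp[OF jr ring_map_const_poly] ring_map_meval[OF ring_map_const2_mconst]])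
      (simp_all add: jg meval_mconst[OF ring_map_const2_mconst] meval_mvar[OF ring_map_const2_mconst])
  have top: "coeff (j [:\<delta> i:]) (Suc n) = dv i" for i
  proof -
    have "coeff (j [:\<delta> i:]) (Suc n) = meval (\<lambda>c. [:mconst c:]) (\<lambda>v. coeff (s v) 1) (\<delta> i)"
      unfolding j_meval
      by (rule coeff_meval_top) (use hom\<delta>[of i] in \<open>simp_all add: homogeneous_eq_weighted s_def\<close>)
    also have "\<dots> = dv i" unfolding dv_def by (rule meval_cong) (simp add: s_def v_def)
    finally show ?thesis .
  qed
  have "[:mvar 0:] * [:\<delta> 0:] + [:mvar 1:] * [:\<delta> 1:] + [:mvar 2:] * [:\<delta> 2:] = 0"
    using x\<delta> by (simp add: algebra_simps)
  then have "j ([:mvar 0:] * [:\<delta> 0:] + [:mvar 1:] * [:\<delta> 1:] + [:mvar 2:] * [:\<delta> 2:]) = j 0"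
    by (rule arg_cong)
  then have "[:0, 1:] * j [:\<delta> 0:] + [:[:mvar 1:]:] * j [:\<delta> 1:] + [:[:mvar 2, - mvar 0:], [:0, 1:]:] * j [:\<delta> 2:] = 0"
    unfolding ring_map_simps[OF jr] jg by (simp only: s_def) simp
  moreover have "j [:\<delta> 0, \<delta> 2:] = j [:\<delta> 0:] + [:[:0, 1:]:] * j [:\<delta> 2:]"
  proof -
    have "[:\<delta> 0, \<delta> 2:] = [:\<delta> 0:] + [:0, 1:] * [:\<delta> 2:]" by simp
    then show ?thesis by (simp only: ring_map_simps[OF jr] jg)
  qed
  moreover have "[:[:mvar 2, - mvar 0:], [:0, 1:]:] = [:[:mvar 2, - mvar 0:]:] + [:0, 1:] * [:[:0, 1 :: 'k R:]:]"
    by simp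
  moreover have "X * J + M * B + L * C = 0" if "X * A + M * B + N * C = 0" "J = A + U * C" "N = L + X * U"
    for X J M B L C A N U :: "'k R poly poly"
    using that by (simp add: algebra_simps)
  \<comment> \<open>On the line, x \<bullet> \<delta> = 0 expresses c E by terms whose top coefficients are known.\<close>
  ultimately have "[:0, 1:] * j [:\<delta> 0, \<delta> 2:] + [:[:mvar 1:]:] * j [:\<delta> 1:] + [:[:mvar 2, - mvar 0:]:] * j [:\<delta> 2:] = 0"
    by blast
  then have "coeff ([:0, 1:] * j [:\<delta> 0, \<delta> 2:] + [:[:mvar 1:]:] * j [:\<delta> 1:] + [:[:mvar 2, - mvar 0:]:] * j [:\<delta> 2:]) (Suc n) = 0"
    by simp
  moreover have "coeff (j [:\<delta> 0, \<delta> 2:]) n = 0"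
    using le n by (intro coeff_eq_0) simp
  ultimately have rel: "[:mvar 1:] * dv 1 + [:mvar 2, - mvar 0:] * dv 2 = 0"
    by (simp add: top)
  \<comment> \<open>The vector dv involves T only, so the relation can be read off at x_1 = 0.\<close>
  have dv2: "dv 2 = 0"
  proof -
    define z :: "3 \<Rightarrow> 'k R poly" where "z i = (if i = 1 then 0 else [:mvar i:])" for i
    define Z where "Z = lift (meval (\<lambda>c. [:mconst c:]) z) [:0, 1:]"
    have Z: "ring_map Z" "Z [:mvar i:] = z i" "Z [:mconst c:] = [:mconst c:]" "Z [:0, 1:] = [:0, 1:]" for i c
      using ring_map_meval[OF ring_map_const_mconst, of z]
      by (simp_all add: Z_def ring_map_lift lift_const lift_X meval_mvar[OF ring_map_const_mconst] meval_mconst[OF ring_map_const_mconst])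
    have "Z (dv i) = dv i" for i
      unfolding dv_def ring_map_meval_comp[OF ring_map_const_mconst Z(1)] Z(3)
      by (rule meval_cong) (simp add: v_def Z(4) ring_map_zero[OF Z(1)] ring_map_one[OF Z(1)])
    moreover have "Z [:mvar 2, - mvar 0:] = [:mvar 2, - mvar 0:]"
    proof -
      have "[:mvar 2, - mvar 0:] = [:mvar 2:] - [:0, 1:] * [:mvar 0 :: 'k R:]" by simp
      then have "Z [:mvar 2, - mvar 0:] = Z [:mvar 2:] - Z [:0, 1:] * Z [:mvar 0:]"
        by (simp only: ring_map_simps[OF Z(1)])
      then show ?thesis by (simp add: Z(2,4) z_def)
    qed
    moreover have "Z ([:mvar 1:] * dv 1 + [:mvar 2, - mvar 0:] * dv 2) = Z 0"
      by (simp only: rel)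
    then have "Z [:mvar 1:] * Z (dv 1) + Z [:mvar 2, - mvar 0:] * Z (dv 2) = 0"
      by (simp only: ring_map_simps[OF Z(1)])
    ultimately have "[:mvar 2, - mvar 0:] * dv 2 = 0"
      by (simp only: Z(2) z_def) simp
    then show ?thesis unfolding mult_eq_0_iff by simp
  qed
  with rel have dv1: "dv 1 = 0" by simp
  have rv: "ring_map (meval (\<lambda>c. [:mconst c:]) v)" by (rule ring_map_meval[OF ring_map_const_mconst])
  have "meval (\<lambda>c. [:mconst c:]) v (mvar 0 * \<delta> 0 + mvar 1 * \<delta> 1 + mvar 2 * \<delta> 2) = meval (\<lambda>c. [:mconst c:]) v 0"
    by (simp only: x\<delta>)
  then have dv0: "dv 0 = 0"
    using dv1 dv2 by (simp add: ring_map_simps[OF rv] meval_mvar[OF ring_map_const_mconst] dv_def) (simp add: v_def)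
  \<comment> \<open>If the minors vanish at (1, 0, T), then x_1 is a common divisor of them.\<close>
  have div: "mvar 1 dvd 1 * minors mvar p i" for i
  proof -
    have "dv i = 0" using dv0 dv1 dv2 by (cases i rule: cases_3) simp_all
    then show ?thesis
      using mvar_dvd_of_vanishing[OF hom\<delta>[of i]] by (simp add: dv_def v_def[abs_def] \<delta>_def)
  qed
  interpret R: free_variable "split_variable 1" "mvar 1 :: 'k R" by (rule free_variable_split)
  have "R.deg (mvar 1) = 0"
    by (rule R.deg_0_of_dvd_minors[OF syz f2 div]) (simp_all add: R.free_1)
  then show False by (simp add: split_variable_simps)
qed

section \<open>Elimination on the incidence variety\<close>

text \<open>
  The point (y_1, y_0, w) of the line x_0 y_0 = x_1 y_1, where w is the variable of the polynomial ring
  over K[y_0, y_1, y_2] and the y_j are the variables of R.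
\<close>

definition incidence_point :: "3 \<Rightarrow> 'k::field R poly" where
  "incidence_point i = (if i = 0 then [:mvar 1:] else if i = 1 then [:mvar 0:] else [:0, 1:])"

text \<open>
  Restriction to the incidence variety. Its value on \<open>g2 p\<close> is the eliminant C.
\<close>

definition restrict_incidence :: "'k::field A \<Rightarrow> 'k R poly" where
  "restrict_incidence = meval (\<lambda>c. [:mconst c:]) (case_sum incidence_point (\<lambda>j. [:mvar j:]))"

definition restrict_x :: "'k::field R \<Rightarrow> 'k R poly" where
  "restrict_x = meval (\<lambda>c. [:mconst c:]) incidence_point"

lemma restrict_incidence_simps:
  "ring_map restrict_incidence"
  "restrict_incidence (mconst c) = [:mconst c:]"
  "restrict_incidence (xA i) = incidence_point i"
  "restrict_incidence (yA i) = [:mvar i:]"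
  by (simp_all add: restrict_incidence_def ring_map_meval[OF ring_map_const_mconst]
      meval_mconst[OF ring_map_const_mconst] meval_mvar[OF ring_map_const_mconst])

lemma restrict_x_simps:
  "ring_map restrict_x"
  "restrict_x (mconst c) = [:mconst c:]"
  "restrict_x (mvar i) = incidence_point i"
  by (simp_all add: restrict_x_def ring_map_meval[OF ring_map_const_mconst]
      meval_mconst[OF ring_map_const_mconst] meval_mvar[OF ring_map_const_mconst])

lemma restrict_incidence_embed: "restrict_incidence (embed_R q) = restrict_x q"
  by (simp add: embed_R_def restrict_incidence_def restrict_x_def meval_swap_subst[OF ring_map_const_mconst]
      meval_mvar[OF ring_map_const_mconst])

lemma restrict_incidence_g2:
  "restrict_incidence (g2 p) = restrict_x (p $ 0) * [:mvar 0:] + restrict_x (p $ 1) * [:mvar 1:] + restrict_x (p $ 2) * [:mvar 2:]"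
  by (simp only: g2_def sum_UNIV_3 ring_map_simps[OF restrict_incidence_simps(1)] restrict_incidence_embed restrict_incidence_simps(4))

text \<open>
  The first column of \<open>displayed_form\<close>.
\<close>

definition standard_column :: "3 \<Rightarrow> 'k::field R" where
  "standard_column i = (if i = 0 then mvar 0 else if i = 1 then - mvar 1 else 0)"

lemma minors_standard_column:
  "minors standard_column p 0 = - (mvar 1 * p 2)"
  "minors standard_column p 1 = - (mvar 0 * p 2)"
  "minors standard_column p 2 = mvar 0 * p 1 + mvar 1 * p 0"
  by (simp_all add: minors_simps standard_column_def)

text \<open>
  An instance of \<open>degree_le_1_of_inverse\<close> with t = x_2. The renaming (x_0, x_1, x_2, T) to (y_1, y_0, w, y_2)
  carries E = A + T B to the eliminant.
\<close>

lemma degree_eliminant_le_1: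
  fixes f :: "3 \<Rightarrow> 'k::field R" and p :: "'k R ^ 3"
  assumes syz: "syzygy_basis f standard_column (($) p)" and f: "f 0 \<noteq> 0" "f 2 \<noteq> 0"
    and inv: "has_inverse f"
  shows "degree (restrict_incidence (g2 p)) \<le> 1"
proof -
  define A B where "A = mvar 0 * p $ 1 + mvar 1 * p $ 0" and "B = p $ 2"
  define \<delta> where "\<delta> = minors standard_column (($) p)"
  have \<delta>: "\<delta> 0 = - (mvar 1 * B)" "\<delta> 1 = - (mvar 0 * B)" "\<delta> 2 = A"
    by (simp_all add: \<delta>_def minors_standard_column A_def B_def)
  have \<delta>2: "\<delta> 2 \<noteq> 0" "\<delta> 0 \<noteq> 0" using minors_nonzero[OF syz] f by (simp_all add: \<delta>_def)
  then have B: "B \<noteq> 0" by (auto simp: \<delta>)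
  have "has_inverse \<delta>"
    using has_inverse_parallel[OF inv parallel_minors[OF syz] f(2)] \<delta>2 by (simp add: \<delta>_def)
  then obtain e g where g: "\<And>i. homogeneous e (g i)" "parallel (\<lambda>i. meval mconst \<delta> (g i)) mvar"
    "\<exists>i. meval mconst \<delta> (g i) \<noteq> 0"
    by (auto simp: has_inverse_def msubst_eq_meval)
  then obtain i0 where i0: "meval mconst \<delta> (g i0) \<noteq> 0" by blast
  define s :: "3 \<Rightarrow> 'k R poly poly" where "s i = (if i = 2 then [:0, 1:] else [:[:mvar i:]:])" for i
  define j where "j = split_map s"
  note jg = split_map_simps(2-4)[of s, folded j_def]
  note jr = split_map_simps(1)[of s, folded j_def]
  have fv: "free_variable j [:mvar 2:]"
    unfolding j_def
  proof (rule free_variable_split_map)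
    show "s 2 = [:0, 1:]" by (simp add: s_def)
    show "poly (s v) [:mvar 2:] = [:mvar v:]" for v by (simp add: s_def)
    show "split_map s (coeff (s v) m) = [:coeff (s v) m:]" for v m
      unfolding j_def[symmetric]
      using jg(2)[of v] ring_map_zero[OF jr] ring_map_one[OF jr]
      by (auto simp: s_def one_pCons coeff_pCons split: nat.splits)
  qed
  interpret free_variable j "[:mvar 2:]" by (rule fv)
  define Y :: "3 \<Rightarrow> 'k R poly" where
    "Y i = (if i = 0 then [:mvar 1:] else if i = 1 then [:mvar 0:] else [:0, 1:])" for i
  have le: "degree (j [:A, B:]) \<le> 1"
  proof (rule degree_le_1_of_inverse[OF fv syz f(2) g(1) g(2)[unfolded \<delta>_def] i0[unfolded \<delta>_def], folded \<delta>_def,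
        where r = 1 and b' = "- B" and Y = Y
        and m = 2 and n = 0 and u = "\<lambda>i. if i = 2 then 1 else 0"
        and v = "\<lambda>i. if i = 0 then - mvar 1 else if i = 1 then - mvar 0 else 0"])
    show "1 * \<delta> i = (if i = 2 then 1 else 0) * A
      + (if i = 0 then - mvar 1 else if i = 1 then - mvar 0 else 0) * B" for i
      by (cases i rule: cases_3) (simp_all add: \<delta>)
    show "[:A, B:] dvd [:1:] * [:\<delta> i:] - [:- B:] * Y i" for i
      by (cases i rule: cases_3) (simp_all add: \<delta> Y_def)
    show "free (Y i)" for i
      by (cases i rule: cases_3) (simp_all add: free_def Y_def jg s_def)
    show "free [:mconst c:]" for c by (simp add: free_def jg)
    show "free [:1:]" using free_1 by (simp add: one_pCons)
    show "degree (j [:mvar i:]) \<le> 1" for i by (simp add: jg s_def)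
    show "coeff (j [:mvar 2:]) 1 * coeff (j [:mvar 0:]) 0 \<noteq> coeff (j [:mvar 0:]) 1 * coeff (j [:mvar 2:]) 0"
      by (simp add: jg s_def)
  qed (use B in simp_all)
  \<comment> \<open>Pi is the renaming of variables, and \<tau> its effect on the coefficients of powers of x_2.\<close>
  define Pi where "Pi = lift restrict_x [:mvar 2 :: 'k R:]"
  define z :: "3 \<Rightarrow> 'k R" where "z i = (if i = 0 then mvar 1 else if i = 1 then mvar 0 else 0)" for i
  define \<tau> where "\<tau> = lift (msubst z) (mvar 2)"
  have Pi: "ring_map Pi" "Pi [:a:] = restrict_x a" "Pi [:0, 1:] = [:mvar 2:]" for a
    by (simp_all add: Pi_def ring_map_lift lift_const lift_X restrict_x_simps(1))
  have \<tau>: "ring_map \<tau>" "\<tau> [:mconst c:] = mconst c" "\<tau> [:mvar i:] = z i" "\<tau> [:0, 1:] = mvar 2" for c i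
    by (simp_all add: \<tau>_def ring_map_lift lift_const lift_X msubst_simps)
  have "Pi a = map_poly \<tau> (j a)" for a
  proof (rule ring_map_Rpoly_unique[OF Pi(1) ring_map_comp[OF ring_map_map_poly[OF \<tau>(1)] jr]])
    note simps = Pi restrict_x_simps incidence_point_def jg s_def
      map_poly_pCons ring_map_zero[OF \<tau>(1)] ring_map_one[OF \<tau>(1)] \<tau> z_def
    show "Pi [:mconst c:] = map_poly \<tau> (j [:mconst c:])" for c by (simp add: simps)
    show "Pi [:mvar v:] = map_poly \<tau> (j [:mvar v:])" for v
      by (cases v rule: cases_3) (simp_all add: simps)
    show "Pi [:0, 1:] = map_poly \<tau> (j [:0, 1:])" by (simp add: simps)
  qed
  then have "degree (Pi [:A, B:]) \<le> 1"
    using le ring_map_zero[OF \<tau>(1)] by (auto intro!: degree_le simp: coeff_map_poly coeff_eq_0)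
  moreover have "Pi [:A, B:] = restrict_incidence (g2 p)"
  proof -
    have "[:A, B:] = [:A:] + [:0, 1:] * [:B:]" by simp
    then have "Pi [:A, B:] = restrict_x A + [:mvar 2:] * restrict_x B"
      by (simp only: ring_map_simps[OF Pi(1)] Pi(2,3))
    moreover have "restrict_x A = [:mvar 1:] * restrict_x (p $ 1) + [:mvar 0:] * restrict_x (p $ 0)"
      unfolding A_def ring_map_simps[OF restrict_x_simps(1)] restrict_x_simps(3) by (simp add: incidence_point_def)
    ultimately show ?thesis unfolding restrict_incidence_g2 B_def by (simp only: ac_simps)
  qed
  ultimately show ?thesis by simp
qed

text \<open>
  On y = \<delta> the point (y_1, y_0, w) with w = - p_2 x_2 is - p_2 times x, and g_2(x, \<delta>(x)) = p \<bullet> (l \<times> p) = 0.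
\<close>

lemma eliminant_vanishes_on_minors:
  fixes p :: "'k::field R ^ 3"
  assumes hom: "\<And>i. homogeneous n (p $ i)"
  shows "lift (msubst (minors standard_column (($) p))) (- (p $ 2 * mvar 2)) (restrict_incidence (g2 p)) = 0"
proof -
  define \<delta> where "\<delta> = minors standard_column (($) p)"
  define L where "L = lift (msubst \<delta>) (- (p $ 2 * mvar 2))"
  have L: "ring_map L" "L [:a:] = msubst \<delta> a" "L [:0, 1:] = - (p $ 2 * mvar 2)" for a
    by (simp_all add: L_def ring_map_lift lift_const lift_X msubst_simps)
  have Lx: "L (restrict_x (p $ i)) = (- (p $ 2)) ^ n * p $ i" for i
  proof -
    have "L (restrict_x (p $ i)) = meval mconst (\<lambda>v. L (incidence_point v)) (p $ i)"
      by (simp add: restrict_x_def ring_map_meval_comp[OF ring_map_const_mconst L(1)] L(2) msubst_simps)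
    also have "\<dots> = meval mconst (\<lambda>v. - (p $ 2) * mvar v) (p $ i)"
    proof (rule meval_cong)
      fix v show "L (incidence_point v) = - (p $ 2) * mvar v"
        by (cases v rule: cases_3) (simp_all add: incidence_point_def L msubst_simps \<delta>_def minors_standard_column)
    qed
    also have "\<dots> = (- (p $ 2)) ^ n * meval mconst mvar (p $ i)"
      by (rule meval_scale_homogeneous[OF ring_map_mconst hom])
    finally show ?thesis by (simp add: meval_id)
  qed
  have "L (restrict_incidence (g2 p)) = (- (p $ 2)) ^ n * (p $ 0 * \<delta> 0 + p $ 1 * \<delta> 1 + p $ 2 * \<delta> 2)"
    unfolding restrict_incidence_g2 ring_map_simps[OF L(1)] Lx L(2) msubst_simps by (simp add: algebra_simps)
  also have "p $ 0 * \<delta> 0 + p $ 1 * \<delta> 1 + p $ 2 * \<delta> 2 = 0"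
    by (simp add: \<delta>_def minors_standard_column algebra_simps)
  finally show ?thesis by (simp add: L_def \<delta>_def)
qed

text \<open>
  At (y_0, y_1, y_2, w) = (x_1, x_0, 0, x_2) the eliminant takes the value x_0 p_1 + x_1 p_0, a minor.
\<close>

lemma eliminant_nonzero:
  fixes f :: "3 \<Rightarrow> 'k::field R" and p :: "'k R ^ 3"
  assumes "syzygy_basis f standard_column (($) p)" "f 2 \<noteq> 0"
  shows "restrict_incidence (g2 p) \<noteq> 0"
proof
  assume eq: "restrict_incidence (g2 p) = 0"
  define z :: "3 \<Rightarrow> 'k R" where "z i = (if i = 0 then mvar 1 else if i = 1 then mvar 0 else 0)" for i
  define L where "L = lift (msubst z) (mvar 2)"
  have L: "ring_map L" "L [:a:] = msubst z a" "L [:0, 1:] = mvar 2" for a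
    by (simp_all add: L_def ring_map_lift lift_const lift_X msubst_simps)
  have Lv: "L (restrict_x (mvar i)) = mvar i" for i
    by (cases i rule: cases_3) (simp_all add: restrict_x_simps incidence_point_def L msubst_simps z_def)
  have Lx: "L (restrict_x q) = q" for q
    by (rule ring_map_mpoly_unique[OF ring_map_comp[OF L(1) restrict_x_simps(1)] ring_map_id])
      (simp_all only: Lv restrict_x_simps(2) L(2) msubst_simps(1))
  have "L (restrict_incidence (g2 p)) = minors standard_column (($) p) 2"
    unfolding restrict_incidence_g2 ring_map_simps[OF L(1)] Lx L(2) msubst_simps
    by (simp add: z_def minors_standard_column algebra_simps)
  then show False
    using eq minors_nonzero[OF assms] by (simp add: ring_map_zero[OF L(1)])
qed

section \<open>Sylvester forms\<close>

abbreviation "x_weight \<equiv> case_sum (\<lambda>_. 1) (\<lambda>_. 0) :: 3 + 3 \<Rightarrow> nat"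
abbreviation "y_weight \<equiv> case_sum (\<lambda>_. 0) (\<lambda>_. 1) :: 3 + 3 \<Rightarrow> nat"

lemma bihomogeneous_xA: "bihomogeneous 1 0 (xA i)"
  using weighted_mvar[of x_weight "Inl i"] weighted_mvar[of y_weight "Inl i"]
  by (simp add: bihomogeneous_eq_weighted)

lemma bihomogeneous_yA: "bihomogeneous 0 1 (yA i)"
  using weighted_mvar[of x_weight "Inr i"] weighted_mvar[of y_weight "Inr i"]
  by (simp add: bihomogeneous_eq_weighted)

lemma bihomogeneous_add: "bihomogeneous a b p \<Longrightarrow> bihomogeneous a b q \<Longrightarrow> bihomogeneous a b (p + q)"
  by (simp add: bihomogeneous_eq_weighted weighted_add)

lemma bihomogeneous_mult: "bihomogeneous a b p \<Longrightarrow> bihomogeneous a' b' q \<Longrightarrow> bihomogeneous (a + a') (b + b') (p * q)"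
  by (simp add: bihomogeneous_eq_weighted weighted_mult)

lemma bihomogeneous_zero: "bihomogeneous a b 0"
  by (simp add: bihomogeneous_eq_weighted weighted_zero)

lemma bihomogeneous_diff: "bihomogeneous a b p \<Longrightarrow> bihomogeneous a b q \<Longrightarrow> bihomogeneous a b (p - q)"
  by (simp add: bihomogeneous_eq_weighted weighted_diff)

lemma bihomogeneous_sum: "(\<And>i. i \<in> S \<Longrightarrow> bihomogeneous a b (f i)) \<Longrightarrow> bihomogeneous a b (sum f S)"
  by (simp add: bihomogeneous_eq_weighted weighted_sum)

lemma bihomogeneous_unique: "bihomogeneous a b p \<Longrightarrow> bihomogeneous a' b' p \<Longrightarrow> p \<noteq> 0 \<Longrightarrow> a = a' \<and> b = b'"
  by (auto simp: bihomogeneous_eq_weighted dest: weighted_unique)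

lemma bihomogeneous_g2:
  assumes "\<And>i. homogeneous n (p $ i)"
  shows "bihomogeneous n 1 (g2 p)"
proof -
  have "bihomogeneous n 0 (embed_R (p $ i))" for i
    unfolding bihomogeneous_eq_weighted embed_R_def
  proof
    have "weighted x_weight 1 (xA v :: 'a A)" "weighted y_weight 0 (xA v :: 'a A)" for v
      using weighted_mvar[of x_weight "Inl v"] weighted_mvar[of y_weight "Inl v"] by simp_all
    then show "weighted x_weight n (msubst xA (p $ i))" "weighted y_weight 0 (msubst xA (p $ i))"
      using assms[of i] weighted_msubst[of "\<lambda>_. 1" n "p $ i" x_weight xA]
        weighted_msubst[of "\<lambda>_. 0" 0 "p $ i" y_weight xA]
      by (simp_all add: homogeneous_eq_weighted weighted_def[of "\<lambda>_. 0"])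
  qed
  then have "bihomogeneous (n + 0) (0 + 1) (embed_R (p $ i) * yA i)" for i
    by (intro bihomogeneous_mult bihomogeneous_yA)
  then show ?thesis unfolding g2_def by (intro bihomogeneous_sum) simp
qed

lemma sylvester_step_iff:
  "sylvester_step F F' \<longleftrightarrow> (\<exists>a b. (\<exists>k l. bihomogeneous k l a) \<and> (\<exists>k l. bihomogeneous k l b) \<and>
     F = a * xA 0 + b * xA 1 \<and> F' = yA 0 * b + yA 1 * a)"
proof -
  have "det (vector [vector [yA 0, - yA 1], vector [a, b]] :: 'a A ^ 2 ^ 2) = yA 0 * b + yA 1 * a" for a b
    by (simp add: det_2 vector_2)
  then show ?thesis unfolding sylvester_step_def by simp
qed

text \<open>
  On the incidence variety x_0 = y_1 and x_1 = y_0, so the new form y_0 b + y_1 a equals the old form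
  a x_0 + b x_1.
\<close>

lemma restrict_incidence_step:
  assumes "sylvester_step F F'"
  shows "restrict_incidence F' = restrict_incidence F"
proof -
  obtain a b where "F = a * xA 0 + b * xA 1" "F' = yA 0 * b + yA 1 * a"
    using assms by (auto simp: sylvester_step_iff)
  then show ?thesis
    by (simp add: ring_map_simps[OF restrict_incidence_simps(1)] restrict_incidence_simps(3,4) incidence_point_def)
qed

lemma mvar_mult_eq_0:
  fixes b :: "('v::finite, 'k::field) mpoly"
  assumes "b * mvar v = 0"
  shows "b = 0"
proof (rule poly_mapping_eqI)
  fix m
  have "b * mvar v = (\<Sum>n\<in>Poly_Mapping.keys b. Poly_Mapping.single (n + Poly_Mapping.single v 1) (Poly_Mapping.lookup b n))"
    by (subst (1) sum_of_monomials[of b]) (simp add: sum_distrib_right mvar_def mult_single)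
  then have "Poly_Mapping.lookup (b * mvar v) (m + Poly_Mapping.single v 1) = Poly_Mapping.lookup b m"
    by (auto simp: lookup_sum lookup_single when_def in_keys_iff)
  then show "Poly_Mapping.lookup b m = Poly_Mapping.lookup 0 m" using assms by simp
qed

text \<open>
  The bidegrees of a and b are not prescribed. A term a x_0 or b x_1 whose bidegree is not that of F
  must vanish, so a and b may be taken to have the expected bidegree.
\<close>

lemma bihomogeneous_step:
  assumes "bihomogeneous k l F" "F \<noteq> 0" "sylvester_step F F'"
  shows "\<exists>k'. k = Suc k' \<and> bihomogeneous k' (Suc l) F'"
proof -
  obtain a b ka la kb lb where ab: "bihomogeneous ka la a" "bihomogeneous kb lb b"
    "F = a * xA 0 + b * xA 1" "F' = yA 0 * b + yA 1 * a"
    using assms(3) by (auto simp: sylvester_step_iff)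
  have ax: "bihomogeneous (Suc ka) la (a * xA 0)" and bx: "bihomogeneous (Suc kb) lb (b * xA 1)"
    using bihomogeneous_mult[OF ab(1) bihomogeneous_xA] bihomogeneous_mult[OF ab(2) bihomogeneous_xA] by simp_all
  have *: "b = 0 \<or> Suc kb = k \<and> lb = l" if "Suc ka = k" "la = l"
  proof -
    have "bihomogeneous k l (b * xA 1)"
      using bihomogeneous_diff[OF assms(1), of "a * xA 0"] ax that ab(3) by simp
    then show ?thesis
      using bihomogeneous_unique[OF bx] mvar_mult_eq_0[of b] by blast
  qed
  have **: "a = 0 \<or> Suc ka = k \<and> la = l" if "Suc kb = k" "lb = l"
  proof -
    have "bihomogeneous k l (a * xA 0)"
      using bihomogeneous_diff[OF assms(1), of "b * xA 1"] bx that ab(3) by simp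
    then show ?thesis
      using bihomogeneous_unique[OF ax] mvar_mult_eq_0[of a] by blast
  qed
  have "(Suc ka = k \<and> la = l) \<or> (Suc kb = k \<and> lb = l)"
  proof -
    obtain m where m: "m \<in> Poly_Mapping.keys F" using assms(2) by fastforce
    then have "m \<in> Poly_Mapping.keys (a * xA 0) \<or> m \<in> Poly_Mapping.keys (b * xA 1)"
      using Poly_Mapping.keys_add[of "a * xA 0" "b * xA 1"] ab(3) by blast
    then show ?thesis using m assms(1) ax bx unfolding bihomogeneous_def by metis
  qed
  then obtain k' where k: "k = Suc k'" "bihomogeneous k' l a" "bihomogeneous k' l b"
    using * ** ab(1,2) bihomogeneous_zero by (metis nat.inject)
  have "bihomogeneous (0 + k') (1 + l) F'"
    unfolding ab(4) by (intro bihomogeneous_add bihomogeneous_mult bihomogeneous_yA k)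
  then show ?thesis using k(1) by simp
qed

text \<open>
  The value at x = (0, 0, 1), the common zero of x_0 and x_1.
\<close>

definition at_node :: "'k::field A \<Rightarrow> 'k R" where
  "at_node = msubst (case_sum (\<lambda>i. if i = 2 then 1 else 0) mvar)"

lemma
  assumes "bihomogeneous k l F"
  shows degree_restrict_incidence: "degree (restrict_incidence F) \<le> k"
    and coeff_restrict_incidence: "coeff (restrict_incidence F) k = at_node F"
proof -
  have w: "weighted x_weight k F" using assms by (simp add: bihomogeneous_eq_weighted)
  have d: "degree (case_sum incidence_point (\<lambda>j. [:mvar j:]) v :: 'a R poly) \<le> x_weight v" for v
    by (cases v) (simp_all add: incidence_point_def)
  show "degree (restrict_incidence F) \<le> k"
    unfolding restrict_incidence_def by (rule degree_meval_le[OF w d])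
  have "coeff (restrict_incidence F) k =
      meval mconst (\<lambda>v. coeff (case_sum incidence_point (\<lambda>j. [:mvar j:]) v) (x_weight v)) F"
    unfolding restrict_incidence_def by (rule coeff_meval_top[OF w d])
  also have "\<dots> = at_node F"
    unfolding at_node_def msubst_eq_meval
  proof (rule meval_cong)
    fix v :: "3 + 3"
    show "coeff (case_sum incidence_point (\<lambda>j. [:mvar j:]) v) (x_weight v) =
        (case_sum (\<lambda>i. if i = 2 then 1 else 0) mvar v :: 'a R)"
    proof (cases v)
      case (Inl i)
      then show ?thesis by (cases i rule: cases_3) (simp_all add: incidence_point_def)
    qed simp
  qed
  finally show "coeff (restrict_incidence F) k = at_node F" .
qed

lemma homogeneous_at_node: "bihomogeneous k l F \<Longrightarrow> homogeneous l (at_node F)"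
proof -
  assume "bihomogeneous k l F"
  then have w: "weighted y_weight l F" by (simp add: bihomogeneous_eq_weighted)
  show ?thesis
    unfolding at_node_def homogeneous_eq_weighted
  proof (rule weighted_msubst[OF w])
    fix v :: "3 + 3"
    show "weighted (\<lambda>_. 1) (y_weight v) (case_sum (\<lambda>i. if i = 2 then 1 else 0) mvar v)"
      using weighted_mvar[of "\<lambda>_. 1"] by (cases v) (simp_all add: weighted_one weighted_zero)
  qed
qed

lemma module_mult: "module ((*) :: 'a::comm_ring_1 \<Rightarrow> 'a \<Rightarrow> 'a)"
  by unfold_locales (simp_all add: algebra_simps)

lemma in_ideal_gen_1: "F \<in> ideal_gen {a :: 'a::comm_ring_1} \<longleftrightarrow> (\<exists>u. F = u * a)"
proof -
  interpret module "(*) :: 'a \<Rightarrow> 'a \<Rightarrow> 'a" by (rule module_mult)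
  show ?thesis by (auto simp: span_singleton)
qed

lemma in_ideal_gen_2: "F \<in> ideal_gen {a, b :: 'a::comm_ring_1} \<longleftrightarrow> (\<exists>u v. F = u * a + v * b)"
proof -
  interpret module "(*) :: 'a \<Rightarrow> 'a \<Rightarrow> 'a" by (rule module_mult)
  have "F \<in> span {a, b} \<longleftrightarrow> (\<exists>u. F - u * a \<in> span {b})" by (rule span_breakdown_eq)
  also have "\<dots> \<longleftrightarrow> (\<exists>u v. F - u * a = v * b)" by (simp only: in_ideal_gen_1)
  finally show ?thesis by (simp add: diff_eq_eq add.commute)
qed

lemma monomial_split:
  fixes s :: "3 + 3 \<Rightarrow> 'a::comm_ring_1"
  assumes "Poly_Mapping.lookup m (Inl 0) = 0" "Poly_Mapping.lookup m (Inl 1) = 0" "Poly_Mapping.lookup m (Inl 2) = n"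
  shows "(\<Prod>v\<in>UNIV. s v ^ Poly_Mapping.lookup m v) =
    s (Inl 2) ^ n * (\<Prod>i\<in>UNIV. s (Inr i) ^ Poly_Mapping.lookup m (Inr i))"
proof -
  have "(\<Prod>v\<in>UNIV. f v) = (\<Prod>i\<in>UNIV. f (Inl i)) * (\<Prod>i\<in>UNIV. f (Inr i))" for f :: "3 + 3 \<Rightarrow> 'a"
    unfolding UNIV_Plus_UNIV[symmetric] by (subst prod.Plus) simp_all
  moreover have "(\<Prod>i\<in>UNIV. f i) = f 1 * f 2 * f 0" for f :: "3 \<Rightarrow> 'a"
    unfolding UNIV_3 three_eq_zero by (simp add: mult.assoc)
  ultimately show ?thesis using assms by simp
qed

text \<open>
  Among the monomials of bidegree (k + 1, l) those without x_0 and x_1 are x_2^(k + 1) times a monomial in y,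
  and their sum is x_2^(k + 1) times the value at the node.
\<close>

lemma at_node_decomposition:
  fixes F :: "'k::field A"
  assumes "bihomogeneous (Suc k) l F"
  shows "\<exists>a b. bihomogeneous k l a \<and> bihomogeneous k l b \<and>
    F = xA 2 ^ Suc k * msubst yA (at_node F) + a * xA 0 + b * xA 1"
proof -
  define G where "G F = xA 2 ^ Suc k * msubst yA (at_node F)" for F :: "'k A"
  note Y = msubst_simps(3)[of "yA :: 3 \<Rightarrow> 'k A"]
  have N: "ring_map (at_node :: 'k A \<Rightarrow> _)" unfolding at_node_def by (rule msubst_simps)
  define P where "P F \<longleftrightarrow> (\<exists>a b. bihomogeneous k l a \<and> bihomogeneous k l b \<and> F = G F + a * xA 0 + b * xA 1)" for F :: "'k A"
  have P_sum: "P (sum f S)" if "\<And>m. m \<in> S \<Longrightarrow> P (f m)" for f :: "_ \<Rightarrow> 'k A" and S :: "(3 + 3 \<Rightarrow>\<^sub>0 nat) set"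
    using that
  proof (induction S rule: infinite_finite_induct)
    case (insert m S)
    have "P (f m)" using insert.prems by blast
    then obtain a b where ab: "bihomogeneous k l a" "bihomogeneous k l b" "f m = G (f m) + a * xA 0 + b * xA 1"
      unfolding P_def by blast
    have "P (sum f S)" by (rule insert.IH) (use insert.prems in blast)
    then obtain a' b' where ab': "bihomogeneous k l a'" "bihomogeneous k l b'" "sum f S = G (sum f S) + a' * xA 0 + b' * xA 1"
      unfolding P_def by blast
    have "f m + sum f S = G (f m) + a * xA 0 + b * xA 1 + (G (sum f S) + a' * xA 0 + b' * xA 1)"
      using ab(3) ab'(3) by (rule arg_cong2)
    also have "\<dots> = G (f m + sum f S) + (a + a') * xA 0 + (b + b') * xA 1"
      by (simp add: G_def ring_map_add[OF N] ring_map_add[OF Y] algebra_simps)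
    finally have "P (f m + sum f S)"
      unfolding P_def using bihomogeneous_add[OF ab(1) ab'(1)] bihomogeneous_add[OF ab(2) ab'(2)] by blast
    then show ?case using insert.hyps by simp
  qed (auto simp: P_def G_def ring_map_zero[OF N] ring_map_zero[OF Y] intro!: exI[of _ 0] bihomogeneous_zero)
  have P_I: "P F" if "bihomogeneous k l a" "bihomogeneous k l b" "at_node F = 0" "F = a * xA 0 + b * xA 1" for F a b
    using that unfolding P_def G_def by (auto simp: ring_map_zero[OF Y])
  have P_mon: "P (Poly_Mapping.single m c)" if m: "bihomogeneous (Suc k) l (Poly_Mapping.single m c)" "c \<noteq> 0" for m c
  proof -
    have sing: "Poly_Mapping.single m c = Poly_Mapping.single (m - Poly_Mapping.single v 1) c * mvar v \<and>
        at_node (Poly_Mapping.single m c) = at_node (mvar v) * at_node (Poly_Mapping.single (m - Poly_Mapping.single v 1) c)"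
      if "Poly_Mapping.lookup m v \<noteq> 0" for v
    proof -
      have "m = (m - Poly_Mapping.single v 1) + Poly_Mapping.single v 1"
        by (rule poly_mapping_eqI) (use that in \<open>auto simp: lookup_add lookup_minus lookup_single when_def\<close>)
      then have e: "Poly_Mapping.single m c = Poly_Mapping.single (m - Poly_Mapping.single v 1) c * mvar v"
        by (simp only: mvar_def mult_single mult_1_right)
      have "at_node (Poly_Mapping.single m c) = at_node (mvar v) * at_node (Poly_Mapping.single (m - Poly_Mapping.single v 1) c)"
        using arg_cong[OF e, of at_node] by (simp only: ring_map_mult[OF N] mult.commute)
      with e show ?thesis by (rule conjI)
    qed
    have bih: "bihomogeneous k l (Poly_Mapping.single (m - Poly_Mapping.single (Inl i) 1) c)"
      if "Poly_Mapping.lookup m (Inl i) \<noteq> 0" for i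
    proof -
      have "(\<Sum>i'\<in>UNIV. Poly_Mapping.lookup m (Inl i')) = Suc k" "(\<Sum>j\<in>UNIV. Poly_Mapping.lookup m (Inr j)) = l"
        using m by (simp_all add: bihomogeneous_def)
      moreover have "(\<Sum>i'\<in>UNIV. Poly_Mapping.lookup (m - Poly_Mapping.single (Inl i) 1) (Inl i')) + 1 = (\<Sum>i'\<in>UNIV. Poly_Mapping.lookup m (Inl i'))"
        using that by (cases i rule: cases_3) (simp_all add: sum_UNIV_3 lookup_minus lookup_single)
      ultimately show ?thesis by (simp add: bihomogeneous_def lookup_minus lookup_single)
    qed
    consider "Poly_Mapping.lookup m (Inl 0) \<noteq> 0" | "Poly_Mapping.lookup m (Inl 1) \<noteq> 0"
      | "Poly_Mapping.lookup m (Inl 0) = 0" "Poly_Mapping.lookup m (Inl 1) = 0" by blast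
    then show ?thesis
    proof cases
      case 1
      have "at_node (xA 0) = (0 :: 'k R)" by (simp add: at_node_def msubst_simps)
      then have "at_node (Poly_Mapping.single m c) = 0" by (simp only: sing[OF 1, THEN conjunct2] mult_zero_left)
      then show ?thesis
        by (rule P_I[OF bih[OF 1] bihomogeneous_zero]) (simp only: mult_zero_left add_0_left add_0_right sing[OF 1, THEN conjunct1, symmetric])
    next
      case 2
      have "at_node (xA 1) = (0 :: 'k R)" by (simp add: at_node_def msubst_simps)
      then have "at_node (Poly_Mapping.single m c) = 0" by (simp only: sing[OF 2, THEN conjunct2] mult_zero_left)
      then show ?thesis
        by (rule P_I[OF bihomogeneous_zero bih[OF 2]]) (simp only: mult_zero_left add_0_left add_0_right sing[OF 2, THEN conjunct1, symmetric])
    next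
      case 3
      have "Poly_Mapping.lookup m (Inl 2) = Suc k"
        using m 3 by (simp add: bihomogeneous_def sum_UNIV_3)
      note split = monomial_split[OF 3 this]
      have "at_node (Poly_Mapping.single m c) = mconst c * (\<Prod>i\<in>UNIV. mvar i ^ Poly_Mapping.lookup m (Inr i))"
        unfolding at_node_def msubst_eq_meval meval_single[OF ring_map_mconst] split by simp
      then have "msubst yA (at_node (Poly_Mapping.single m c)) = mconst c * (\<Prod>i\<in>UNIV. yA i ^ Poly_Mapping.lookup m (Inr i))"
        by (simp add: ring_map_mult[OF Y] ring_map_prod[OF Y] ring_map_power[OF Y] msubst_simps)
      then have "Poly_Mapping.single m c = G (Poly_Mapping.single m c)"
        unfolding G_def by (subst single_eq_prod, subst split) (simp only: ac_simps)
      then show ?thesis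
        unfolding P_def by (intro exI[of _ 0]) (simp add: bihomogeneous_zero)
    qed
  qed
  have "P (\<Sum>m\<in>Poly_Mapping.keys F. Poly_Mapping.single m (Poly_Mapping.lookup F m))"
  proof (rule P_sum, rule P_mon)
    fix m assume "m \<in> Poly_Mapping.keys F"
    then show "bihomogeneous (Suc k) l (Poly_Mapping.single m (Poly_Mapping.lookup F m))" "Poly_Mapping.lookup F m \<noteq> 0"
      using assms by (auto simp: bihomogeneous_def in_keys_iff)
  qed
  then have "P F" by (simp only: sum_of_monomials[symmetric])
  then show ?thesis by (simp only: P_def G_def)
qed

lemma at_node_eq_0:
  assumes "F \<in> x01_ideal"
  shows "at_node F = 0"
proof -
  have N: "ring_map (at_node :: 'a A \<Rightarrow> _)" unfolding at_node_def by (rule msubst_simps)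
  obtain a b where "F = a * xA 0 + b * xA 1"
    using assms by (auto simp: x01_ideal_def in_ideal_gen_2)
  moreover have "at_node (xA 0) = (0 :: 'a R)" "at_node (xA 1) = (0 :: 'a R)"
    by (simp_all add: at_node_def msubst_simps)
  ultimately show ?thesis by (simp add: ring_map_simps[OF N])
qed

lemma sylvester_step_exists:
  assumes "bihomogeneous (Suc k) l F" "at_node F = 0"
  shows "F \<in> x01_ideal \<and> (\<exists>F'. sylvester_step F F')"
proof -
  obtain a b where ab: "bihomogeneous k l a" "bihomogeneous k l b" "F = a * xA 0 + b * xA 1"
    using at_node_decomposition[OF assms(1)] assms(2)
    by (auto simp: ring_map_zero[OF msubst_simps(3)])
  then show ?thesis
    unfolding x01_ideal_def in_ideal_gen_2 sylvester_step_iff by blast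
qed

lemma sylvester_run_bihomogeneous:
  assumes "\<And>i. homogeneous n (p $ i)" "restrict_incidence (g2 p) \<noteq> 0" "sylvester_run p m F" "i \<le> m"
  shows "i \<le> n \<and> bihomogeneous (n - i) (i + 1) (F i) \<and> restrict_incidence (F i) = restrict_incidence (g2 p)"
  using assms(4)
proof (induction i)
  case 0
  then show ?case using assms(3) bihomogeneous_g2[OF assms(1)] by (simp add: sylvester_run_def)
next
  case (Suc i)
  then have IH: "i \<le> n" "bihomogeneous (n - i) (i + 1) (F i)" "restrict_incidence (F i) = restrict_incidence (g2 p)" by auto
  have step: "sylvester_step (F i) (F (Suc i))" using Suc.prems assms(3) by (simp add: sylvester_run_def)
  have "F i \<noteq> 0" using IH(3) assms(2) by (auto simp: ring_map_zero[OF restrict_incidence_simps(1)])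
  then obtain k' where k': "n - i = Suc k'" "bihomogeneous k' (Suc (i + 1)) (F (Suc i))"
    using bihomogeneous_step[OF IH(2) _ step] by blast
  moreover from k'(1) have "Suc i \<le> n" "n - Suc i = k'" by auto
  ultimately show ?case using restrict_incidence_step[OF step] IH(3) by simp
qed

text \<open>
  All forms of a run have the same restriction C. The last one has degree n - m in x and is not in
  (x_0, x_1), so the coefficient of w^(n - m) in C is its nonzero value at the node.
\<close>

lemma sylvester_run_length:
  assumes "\<And>i. homogeneous n (p $ i)" "restrict_incidence (g2 p) \<noteq> 0" "sylvester_run p m F"
  shows "m \<le> n \<and> degree (restrict_incidence (g2 p)) = n - m"
proof -
  note run = sylvester_run_bihomogeneous[OF assms order.refl]
  have le: "degree (restrict_incidence (g2 p)) \<le> n - m"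
    using degree_restrict_incidence[of "n - m" "m + 1" "F m"] run by simp
  have "coeff (restrict_incidence (g2 p)) (n - m) \<noteq> 0"
  proof
    assume "coeff (restrict_incidence (g2 p)) (n - m) = 0"
    then have z: "at_node (F m) = 0"
      using coeff_restrict_incidence[of "n - m" "m + 1" "F m"] run by simp
    show False
    proof (cases "n - m")
      case 0
      then have "degree (restrict_incidence (g2 p)) = 0" using le by simp
      then show False
        using \<open>coeff (restrict_incidence (g2 p)) (n - m) = 0\<close> 0 assms(2) by (metis leading_coeff_0_iff)
    next
      case (Suc k)
      then have "F m \<in> x01_ideal" using sylvester_step_exists[of k "m + 1" "F m"] run z by simp
      then show False using assms(3) by (simp add: sylvester_run_def)
    qed
  qed
  then show ?thesis using le run le_degree le_antisym by metis
qed

text \<open>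
  As long as the x-degree exceeds deg C, the value at the node vanishes and a further step exists.
\<close>

lemma sylvester_run_from:
  assumes "bihomogeneous k l F0" "restrict_incidence F0 = C" "C \<noteq> 0" "k = degree C + n"
  shows "\<exists>F. F 0 = F0 \<and> (\<forall>i<n. F i \<in> x01_ideal \<and> sylvester_step (F i) (F (Suc i))) \<and> F n \<notin> x01_ideal"
  using assms
proof (induction n arbitrary: k l F0)
  case 0
  then have "at_node F0 \<noteq> 0"
    using coeff_restrict_incidence[OF 0(1)] by (auto simp: leading_coeff_0_iff)
  then have "F0 \<notin> x01_ideal" using at_node_eq_0 by blast
  then show ?case by (intro exI[of _ "\<lambda>_. F0"]) simp
next
  case (Suc n)
  then have k: "k = Suc (degree C + n)" by simp
  have "at_node F0 = 0"
    using coeff_restrict_incidence[OF Suc(2)] Suc(3) k by (metis coeff_eq_0 less_Suc_eq_le le_add1)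
  then obtain F1 where F1: "F0 \<in> x01_ideal" "sylvester_step F0 F1"
    using sylvester_step_exists Suc(2) k by blast
  have "F0 \<noteq> 0" using Suc(3,4) by (auto simp: ring_map_zero[OF restrict_incidence_simps(1)])
  then have "bihomogeneous (degree C + n) (Suc l) F1"
    using bihomogeneous_step[OF Suc(2) _ F1(2)] k by auto
  from Suc.IH[OF this] obtain F where F: "F 0 = F1" "\<forall>i<n. F i \<in> x01_ideal \<and> sylvester_step (F i) (F (Suc i))" "F n \<notin> x01_ideal"
    using restrict_incidence_step[OF F1(2)] Suc(3,4) by auto
  show ?case
    by (rule exI[of _ "case_nat F0 F"]) (use F F1 in \<open>auto simp: less_Suc_eq_0_disj split: nat.split\<close>)
qed

lemma sylvester_run_exists:
  assumes "\<And>i. homogeneous n (p $ i)" "restrict_incidence (g2 p) \<noteq> 0"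
  shows "\<exists>F. sylvester_run p (n - degree (restrict_incidence (g2 p))) F"
proof -
  have "degree (restrict_incidence (g2 p)) \<le> n"
    by (rule degree_restrict_incidence[OF bihomogeneous_g2[OF assms(1)]])
  then show ?thesis
    using sylvester_run_from[OF bihomogeneous_g2[OF assms(1)] refl assms(2), of "n - degree (restrict_incidence (g2 p))"]
    by (simp add: sylvester_run_def)
qed

section \<open>Left inverses and the degree of the eliminant\<close>

text \<open>
  This coefficient is \<open>g2 p\<close> at x = (y_1, y_0, 0), and \<open>g2 p\<close> has total degree n + 1.
\<close>

lemma homogeneous_eliminant_0:
  assumes "\<And>i. homogeneous n (p $ i)"
  shows "homogeneous (n + 1) (coeff (restrict_incidence (g2 p)) 0)"
proof -
  define z :: "3 + 3 \<Rightarrow> 'a R" where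
    "z = case_sum (\<lambda>i. if i = 0 then mvar 1 else if i = 1 then mvar 0 else 0) mvar"
  have "poly (restrict_incidence F) 0 = msubst z F" for F
  proof (rule ring_map_mpoly_unique[OF ring_map_comp[OF ring_map_poly restrict_incidence_simps(1)] msubst_simps(3)])
    show "poly (restrict_incidence (mconst c)) 0 = msubst z (mconst c)" for c
      by (simp add: restrict_incidence_simps msubst_simps)
    show "poly (restrict_incidence (mvar v)) 0 = msubst z (mvar v)" for v
      by (cases v) (simp_all add: restrict_incidence_simps msubst_simps z_def incidence_point_def)
  qed
  then have "coeff (restrict_incidence (g2 p)) 0 = msubst z (g2 p)"
    by (simp add: poly_0_coeff_0[symmetric])
  moreover have "weighted (\<lambda>_. 1) (n + 1) (msubst z (g2 p))"
  proof (rule weighted_msubst)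
    show "weighted (\<lambda>_. 1) (n + 1) (g2 p)"
      using bihomogeneous_g2[OF assms] by (simp add: bihomogeneous_def weighted_def sum_UNIV_sum)
    show "weighted (\<lambda>_. 1) 1 (z v)" for v
      by (cases v) (simp_all add: z_def weighted_zero homogeneous_mvar[unfolded homogeneous_eq_weighted, simplified])
  qed
  ultimately show ?thesis by (simp add: homogeneous_eq_weighted)
qed

text \<open>
  If C = h w + k, then (y_1 h, y_0 h, -k) is a left inverse, because w = - p_2 x_2 is a root of C at
  y = \<delta>. For the converse, C cannot be constant: its only coefficient would be a nonzero form
  vanishing at \<delta>.
\<close>

lemma has_inverse_iff_degree_eliminant:
  fixes f :: "3 \<Rightarrow> 'k::field R" and p :: "'k R ^ 3"
  assumes syz: "syzygy_basis f standard_column (($) p)" and ind: "forms_independent f"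
    and hom: "\<And>i. homogeneous n (p $ i)" and n: "n \<ge> 1"
  shows "has_inverse f \<longleftrightarrow> degree (restrict_incidence (g2 p)) = 1"
proof -
  define C where "C = restrict_incidence (g2 p)"
  define \<delta> where "\<delta> = minors standard_column (($) p)"
  note f = forms_independent_nonzero[OF ind]
  have C0: "C \<noteq> 0" using eliminant_nonzero[OF syz f] by (simp add: C_def)
  have \<delta>2: "\<delta> 2 \<noteq> 0" "\<delta> 0 \<noteq> 0" using minors_nonzero[OF syz f] by (simp_all add: \<delta>_def)
  have par: "parallel f \<delta>" using parallel_minors[OF syz] by (simp add: \<delta>_def)
  have ind\<delta>: "h = 0" if "homogeneous e h" "msubst \<delta> h = 0" for e h
    using parallel_form_eq_0_iff[OF par that(1) f \<delta>2(1)] that ind by (auto simp: forms_independent_def)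
  note van = eliminant_vanishes_on_minors[OF hom, folded \<delta>_def C_def]
  note ml = msubst_simps(3)[of \<delta>]
  show ?thesis
  proof
    assume "has_inverse f"
    then have "degree C \<le> 1" using degree_eliminant_le_1[OF syz f f] by (simp add: C_def)
    moreover have "degree C \<noteq> 0"
    proof
      assume "degree C = 0"
      then obtain a where a: "C = [:a:]" by (rule degree_eq_zeroE)
      then have c: "C = [:coeff C 0:]" by simp
      have "msubst \<delta> (coeff C 0) = 0" using van a by (simp add: lift_const[OF ml])
      then have "coeff C 0 = 0" using ind\<delta> homogeneous_eliminant_0[OF hom] by (simp add: C_def)
      then show False using c C0 by simp
    qed
    ultimately show "degree (restrict_incidence (g2 p)) = 1" by (simp add: C_def)
  next
    assume deg: "degree (restrict_incidence (g2 p)) = 1"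
    define k h where "k = coeff C 0" and "h = coeff C 1"
    have kh: "C = [:k, h:]" "h \<noteq> 0"
    proof -
      show "C = [:k, h:]"
        using deg by (intro poly_eqI) (auto simp: C_def[symmetric] k_def h_def coeff_pCons coeff_eq_0 split: nat.splits)
      show "h \<noteq> 0" using deg C0 unfolding h_def C_def by (metis leading_coeff_0_iff)
    qed
    obtain F where run: "sylvester_run p (n - 1) F"
      using sylvester_run_exists[OF hom] C0 deg by (auto simp: C_def)
    have F: "bihomogeneous 1 n (F (n - 1))" "restrict_incidence (F (n - 1)) = C"
      using sylvester_run_bihomogeneous[OF hom _ run order.refl] C0 n by (simp_all add: C_def)
    have hh: "homogeneous n h"
      using homogeneous_at_node[OF F(1)] coeff_restrict_incidence[OF F(1)] F(2) by (simp add: h_def)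
    have hk: "homogeneous (n + 1) k"
      using homogeneous_eliminant_0[OF hom] by (simp add: k_def C_def)
    have van': "msubst \<delta> k = p $ 2 * mvar 2 * msubst \<delta> h"
    proof -
      have "[:k, h:] = [:k:] + [:0, 1:] * [:h:]" by simp
      then have "lift (msubst \<delta>) (- (p $ 2 * mvar 2)) C = msubst \<delta> k - p $ 2 * mvar 2 * msubst \<delta> h"
        by (simp only: kh(1) ring_map_simps[OF ring_map_lift[OF ml]] lift_const[OF ml] lift_X[OF ml]) simp
      then show ?thesis using van by simp
    qed
    define g :: "3 \<Rightarrow> 'k R" where "g i = (if i = 0 then mvar 1 * h else if i = 1 then mvar 0 * h else - k)" for i
    have hg: "homogeneous (n + 1) (g i)" for i
    proof -
      have "homogeneous (1 + n) (mvar i * h)" for i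
        using hh homogeneous_mvar unfolding homogeneous_eq_weighted by (intro weighted_mult)
      moreover have "homogeneous (n + 1) (- k)" using hk unfolding homogeneous_eq_weighted by (rule weighted_uminus)
      ultimately show ?thesis by (simp add: g_def)
    qed
    have g\<delta>: "msubst \<delta> (g i) = - (p $ 2 * msubst \<delta> h) * mvar i" for i
      by (cases i rule: cases_3)
        (simp_all add: g_def ring_map_simps[OF ml] msubst_simps van' minors_standard_column[of "($) p", folded \<delta>_def] ac_simps)
    have "p $ 2 \<noteq> 0" using \<delta>2 by (auto simp: \<delta>_def minors_standard_column)
    moreover have "msubst \<delta> h \<noteq> 0" using ind\<delta>[OF hh] kh(2) by blast
    ultimately have "msubst \<delta> (g 0) \<noteq> 0" by (simp add: g\<delta>)
    moreover have "parallel (\<lambda>i. msubst \<delta> (g i)) mvar"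
      unfolding parallel_def g\<delta> by (simp only: ac_simps) simp
    ultimately have "has_inverse \<delta>" using hg unfolding has_inverse_def by blast
    then show "has_inverse f"
      using has_inverse_parallel parallel_sym[OF par] \<delta>2(1) f by blast
  qed
qed

section \<open>Linear changes of coordinates\<close>

definition combine :: "'k::field ^ 3 ^ 3 \<Rightarrow> (3 \<Rightarrow> ('v::finite, 'k) mpoly) \<Rightarrow> 3 \<Rightarrow> ('v, 'k) mpoly" where
  "combine c a i = (\<Sum>j\<in>UNIV. mconst (c $ i $ j) * a j)"

lemma linear_change_eq: "linear_change M = msubst (combine M mvar)"
  by (simp add: linear_change_def combine_def[abs_def])

lemma combine_combine: "combine c (combine c' a) = combine (c ** c') a"
proof
  fix i
  have "combine c (combine c' a) i = (\<Sum>j\<in>UNIV. \<Sum>k\<in>UNIV. mconst (c $ i $ j * c' $ j $ k) * a k)"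
    by (simp add: combine_def sum_distrib_left ring_map_mult[OF ring_map_mconst] mult.assoc)
  also have "\<dots> = (\<Sum>k\<in>UNIV. (\<Sum>j\<in>UNIV. mconst (c $ i $ j * c' $ j $ k)) * a k)"
    by (subst sum.swap) (simp add: sum_distrib_right)
  finally show "combine c (combine c' a) i = combine (c ** c') a i"
    by (simp add: combine_def matrix_matrix_mult_def ring_map_sum[OF ring_map_mconst])
qed

lemma combine_mat_1: "combine (mat 1) a = a"
proof
  fix i
  have "combine (mat 1) a i = (\<Sum>j\<in>UNIV. if j = i then a j else 0)"
    unfolding combine_def
    by (rule sum.cong) (auto simp: mat_def ring_map_zero[OF ring_map_mconst] ring_map_one[OF ring_map_mconst])
  then show "combine (mat 1) a i = a i" by simp
qed

lemma ring_map_combine: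
  "ring_map h \<Longrightarrow> h (combine c a i) = (\<Sum>j\<in>UNIV. h (mconst (c $ i $ j)) * h (a j))"
  unfolding combine_def by (subst ring_map_sum, assumption) (simp add: ring_map_mult)

lemma msubst_combine: "msubst s (combine c a i) = combine c (\<lambda>j. msubst s (a j)) i"
  unfolding ring_map_combine[OF msubst_simps(3)] by (simp add: msubst_simps combine_def)

lemma msubst_msubst: "msubst s (msubst t p) = msubst (\<lambda>v. msubst s (t v)) p"
  unfolding msubst_eq_meval by (rule meval_swap_subst[OF ring_map_mconst, unfolded msubst_eq_meval])

lemma msubst_linear_change: "msubst s (linear_change c q) = msubst (combine c s) q"
proof -
  have "(\<lambda>v. msubst s (combine c mvar v)) = combine c s"
    by (rule ext) (simp add: msubst_combine msubst_simps)
  then show ?thesis by (simp add: linear_change_eq msubst_msubst)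
qed

lemma linear_change_inverse:
  assumes "c' ** c = mat 1"
  shows "linear_change c (linear_change c' q) = q"
  using assms by (simp add: linear_change_eq[of c] msubst_linear_change combine_combine combine_mat_1)
    (simp add: msubst_eq_meval meval_id)

lemma homogeneous_combine: "(\<And>j. homogeneous e (a j)) \<Longrightarrow> homogeneous e (combine c a i)"
  unfolding combine_def homogeneous_eq_weighted
  by (intro weighted_sum weighted_mult[of _ 0, simplified] weighted_mconst)

lemma homogeneous_linear_change: "homogeneous e q \<Longrightarrow> homogeneous e (linear_change c q)"
  unfolding linear_change_eq homogeneous_eq_weighted
  by (rule weighted_msubst, assumption, rule homogeneous_combine[unfolded homogeneous_eq_weighted])
    (rule homogeneous_mvar[unfolded homogeneous_eq_weighted])

lemma parallel_combine:
  assumes "parallel a b"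
  shows "parallel (combine c a) (combine c b)"
  unfolding parallel_def combine_def
proof (intro allI)
  fix i j
  have "(\<Sum>k\<in>UNIV. mconst (c $ i $ k) * a k) * (\<Sum>k\<in>UNIV. mconst (c $ j $ k) * b k) =
      (\<Sum>k\<in>UNIV. \<Sum>l\<in>UNIV. mconst (c $ i $ k) * mconst (c $ j $ l) * (a k * b l))"
    by (simp add: sum_product ac_simps)
  also have "\<dots> = (\<Sum>k\<in>UNIV. \<Sum>l\<in>UNIV. mconst (c $ i $ k) * mconst (c $ j $ l) * (a l * b k))"
    using assms by (simp add: parallel_def)
  also have "\<dots> = (\<Sum>k\<in>UNIV. mconst (c $ j $ k) * a k) * (\<Sum>k\<in>UNIV. mconst (c $ i $ k) * b k)"
    by (subst sum.swap) (simp add: sum_product ac_simps)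
  finally show "(\<Sum>k\<in>UNIV. mconst (c $ i $ k) * a k) * (\<Sum>k\<in>UNIV. mconst (c $ j $ k) * b k) =
      (\<Sum>k\<in>UNIV. mconst (c $ j $ k) * a k) * (\<Sum>k\<in>UNIV. mconst (c $ i $ k) * b k)" .
qed

text \<open>
  M changes the variables and B the coordinates of the vector; with B = N this is the action on the columns
  of the matrix, and the generators are changed by the inverse transpose of N.
\<close>

definition change :: "'k::field ^ 3 ^ 3 \<Rightarrow> 'k ^ 3 ^ 3 \<Rightarrow> (3 \<Rightarrow> 'k R) \<Rightarrow> 3 \<Rightarrow> 'k R" where
  "change B M f = combine B (\<lambda>j. linear_change M (f j))"

text \<open>
  Changing f is, on the forms in y, a change of the target coordinates followed by one of the source.
\<close>

lemma msubst_change: "msubst (change B M f) q = linear_change M (msubst f (linear_change B q))"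
  unfolding change_def msubst_linear_change
  by (simp add: linear_change_eq msubst_msubst msubst_combine)

lemma ring_map_linear_change: "ring_map (linear_change M)"
  by (simp add: linear_change_eq msubst_simps)

lemma linear_change_eq_0_iff:
  assumes "M ** M' = mat 1"
  shows "linear_change M q = 0 \<longleftrightarrow> q = 0"
  using linear_change_inverse[OF assms, of q] ring_map_zero[OF ring_map_linear_change] by metis

lemma forms_independent_change:
  fixes f :: "3 \<Rightarrow> 'k::field R"
  assumes "forms_independent f" "invertible B" "invertible M"
  shows "forms_independent (change B M f)"
proof -
  obtain B' M' where BM: "B ** B' = mat 1" "M ** M' = mat 1"
    using assms(2,3) by (auto simp: invertible_def)
  show ?thesis
    unfolding forms_independent_def
  proof (intro allI impI)
    fix n and h :: "'k R"
    assume h: "homogeneous n h" "msubst (change B M f) h = 0"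
    then have "msubst f (linear_change B h) = 0"
      by (simp add: msubst_change linear_change_eq_0_iff[OF BM(2)])
    then have "linear_change B h = 0"
      using assms(1) homogeneous_linear_change[OF h(1), of B] unfolding forms_independent_def by blast
    then show "h = 0" by (simp add: linear_change_eq_0_iff[OF BM(1)])
  qed
qed

lemma has_inverse_change:
  fixes f :: "3 \<Rightarrow> 'k::field R"
  assumes "has_inverse f" "invertible B" "invertible M"
  shows "has_inverse (change B M f)"
proof -
  obtain B' M' where B: "B ** B' = mat 1" "B' ** B = mat 1" and M: "M ** M' = mat 1" "M' ** M = mat 1"
    using assms(2,3) by (auto simp: invertible_def)
  obtain e g where g: "\<And>i. homogeneous e (g i)" "parallel (\<lambda>i. msubst f (g i)) mvar" "\<exists>i. msubst f (g i) \<noteq> 0"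
    using assms(1) by (auto simp: has_inverse_def)
  define G where "G = combine M' (\<lambda>i. linear_change B' (g i))"
  have G: "msubst (change B M f) (G i) = combine M' (\<lambda>i. linear_change M (msubst f (g i))) i" for i
    unfolding G_def msubst_combine msubst_change linear_change_inverse[OF B(2)] ..
  have "parallel (\<lambda>i. linear_change M (msubst f (g i))) (\<lambda>i. linear_change M (mvar i))"
    using g(2) by (auto simp: parallel_def ring_map_mult[OF ring_map_linear_change, symmetric])
  moreover have "(\<lambda>i. linear_change M (mvar i)) = combine M mvar"
    by (rule ext) (simp add: linear_change_eq msubst_simps)
  ultimately have "parallel (\<lambda>i. msubst (change B M f) (G i)) mvar"
    using parallel_combine[of _ "combine M mvar" M'] by (simp add: G[abs_def] combine_combine M combine_mat_1)
  moreover have "\<exists>i. msubst (change B M f) (G i) \<noteq> 0"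
  proof (rule ccontr)
    assume "\<not> ?thesis"
    then have "combine M' (\<lambda>i. linear_change M (msubst f (g i))) = (\<lambda>_. 0)" using G by auto
    then have "combine M (combine M' (\<lambda>i. linear_change M (msubst f (g i)))) = combine M (\<lambda>_. 0)" by simp
    then have "(\<lambda>i. linear_change M (msubst f (g i))) = (\<lambda>_. 0)"
      by (simp add: combine_combine M combine_mat_1) (simp add: combine_def[abs_def])
    then have "linear_change M (msubst f (g i)) = 0" for i by (rule fun_cong)
    then show False using g(3) by (simp add: linear_change_eq_0_iff[OF M(1)])
  qed
  moreover have "homogeneous e (G i)" for i
    unfolding G_def by (intro homogeneous_combine homogeneous_linear_change g(1))
  ultimately show ?thesis unfolding has_inverse_def by blast
qed

lemma sum_combine_transpose:
  "(\<Sum>i\<in>UNIV. combine (transpose c) a i * b i) = (\<Sum>i\<in>UNIV. a i * combine c b i)"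
  unfolding combine_def sum_distrib_left sum_distrib_right
  by (subst sum.swap) (simp add: transpose_def ac_simps)

text \<open>
  The pairing of f with a syzygy is preserved, since the two sides change by contragredient matrices.
\<close>

lemma syzygy_basis_change:
  fixes f l p :: "3 \<Rightarrow> 'k::field R"
  assumes "syzygy_basis f l p" "invertible M" "N ** N' = mat 1" "N' ** N = mat 1"
  shows "syzygy_basis (change (transpose N') M f) (change N M l) (change N M p)"
  unfolding syzygy_basis_def
proof (intro allI)
  fix w :: "3 \<Rightarrow> 'k R"
  obtain M' where M: "M ** M' = mat 1" "M' ** M = mat 1" using assms(2) by (auto simp: invertible_def)
  let ?\<tau> = "linear_change M" and ?\<tau>' = "linear_change M'"
  note \<tau> = ring_map_linear_change[of M]
  have inv: "?\<tau> (?\<tau>' q) = q" "?\<tau>' (?\<tau> q) = q" for q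
    using M by (simp_all add: linear_change_inverse)
  define w0 where "w0 i = ?\<tau>' (combine N' w i)" for i
  have "(\<Sum>i\<in>UNIV. change (transpose N') M f i * w i) = (\<Sum>i\<in>UNIV. ?\<tau> (f i) * combine N' w i)"
    unfolding change_def by (rule sum_combine_transpose)
  also have "\<dots> = ?\<tau> (\<Sum>i\<in>UNIV. f i * w0 i)"
    by (simp add: ring_map_sum[OF \<tau>] ring_map_mult[OF \<tau>] w0_def inv)
  finally have "(\<Sum>i\<in>UNIV. change (transpose N') M f i * w i) = 0 \<longleftrightarrow> (\<Sum>i\<in>UNIV. f i * w0 i) = 0"
    by (simp add: linear_change_eq_0_iff[OF M(1)])
  also have "\<dots> \<longleftrightarrow> (\<exists>u v. \<forall>i. w0 i = u * l i + v * p i)"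
    using assms(1) by (simp add: syzygy_basis_def)
  also have "\<dots> \<longleftrightarrow> (\<exists>u v. \<forall>i. w i = u * change N M l i + v * change N M p i)"
  proof
    assume "\<exists>u v. \<forall>i. w0 i = u * l i + v * p i"
    then obtain u v where uv: "\<And>i. w0 i = u * l i + v * p i" by blast
    have "w i = combine N (\<lambda>i. ?\<tau> (w0 i)) i" for i
      by (simp add: w0_def inv combine_combine assms(3) combine_mat_1)
    also have "combine N (\<lambda>i. ?\<tau> (w0 i)) i = ?\<tau> u * change N M l i + ?\<tau> v * change N M p i" for i
      unfolding change_def combine_def uv ring_map_simps[OF \<tau>] by (simp add: sum_distrib_left sum.distrib algebra_simps)
    finally show "\<exists>u v. \<forall>i. w i = u * change N M l i + v * change N M p i" by blast
  next
    assume "\<exists>u v. \<forall>i. w i = u * change N M l i + v * change N M p i"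
    then obtain u v where uv: "\<And>i. w i = u * change N M l i + v * change N M p i" by blast
    have "combine N' w i = u * combine N' (change N M l) i + v * combine N' (change N M p) i" for i
      unfolding combine_def[of N'] uv by (simp add: sum_distrib_left sum.distrib algebra_simps)
    moreover have "combine N' (change N M q) = (\<lambda>i. ?\<tau> (q i))" for q
      by (simp add: change_def combine_combine assms(4) combine_mat_1)
    ultimately have "w0 i = ?\<tau>' u * l i + ?\<tau>' v * p i" for i
      by (simp add: w0_def ring_map_simps[OF ring_map_linear_change] inv)
    then show "\<exists>u v. \<forall>i. w0 i = u * l i + v * p i" by blast
  qed
  finally show "(\<Sum>i\<in>UNIV. change (transpose N') M f i * w i) = 0 \<longleftrightarrow>
    (\<exists>u v. \<forall>i. w i = u * change N M l i + v * change N M p i)" .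
qed

lemma has_inverse_change_iff:
  fixes f :: "3 \<Rightarrow> 'k::field R"
  assumes "invertible B" "invertible M"
  shows "has_inverse (change B M f) \<longleftrightarrow> has_inverse f"
proof
  obtain B' M' where B: "B ** B' = mat 1" "B' ** B = mat 1" and M: "M ** M' = mat 1" "M' ** M = mat 1"
    using assms by (auto simp: invertible_def)
  assume "has_inverse (change B M f)"
  then have "has_inverse (change B' M' (change B M f))"
    by (rule has_inverse_change) (use B M in \<open>auto simp: invertible_def\<close>)
  moreover have "change B' M' (change B M f) = f"
  proof -
    have "(\<lambda>j. linear_change M' (change B M f j)) = combine B f"
      unfolding change_def linear_change_eq[of M'] msubst_combine
      by (rule ext) (simp add: linear_change_eq[of M', symmetric] linear_change_inverse[OF M(1)])
    then show ?thesis by (simp add: change_def[of B'] combine_combine B combine_mat_1)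
  qed
  ultimately show "has_inverse f" by simp
qed (rule has_inverse_change[OF _ assms])

section \<open>Normal forms of the linear column\<close>

lemma linear_form:
  fixes q :: "('v::finite, 'k::field) mpoly"
  assumes "homogeneous 1 q"
  shows "q = (\<Sum>v\<in>UNIV. mconst (Poly_Mapping.lookup q (Poly_Mapping.single v 1)) * mvar v)"
proof (rule poly_mapping_eqI)
  fix m
  have rhs: "Poly_Mapping.lookup (\<Sum>v\<in>UNIV. mconst (Poly_Mapping.lookup q (Poly_Mapping.single v 1)) * mvar v) m =
    (\<Sum>v\<in>UNIV. Poly_Mapping.lookup q (Poly_Mapping.single v 1) when Poly_Mapping.single v 1 = m)"
    by (simp add: lookup_sum mconst_def mvar_def mult_single lookup_single)
  show "Poly_Mapping.lookup q m = Poly_Mapping.lookup (\<Sum>v\<in>UNIV. mconst (Poly_Mapping.lookup q (Poly_Mapping.single v 1)) * mvar v) m"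
  proof (cases "m \<in> Poly_Mapping.keys q")
    case True
    then have s: "(\<Sum>v\<in>UNIV. Poly_Mapping.lookup m v) = 1" using assms by (simp add: homogeneous_def)
    then obtain v where v: "Poly_Mapping.lookup m v \<noteq> 0" by (metis sum.neutral zero_neq_one)
    have sv: "Poly_Mapping.lookup m v + (\<Sum>u\<in>UNIV - {v}. Poly_Mapping.lookup m u) = 1"
      using s by (simp add: sum.remove[of UNIV v])
    then have m1: "Poly_Mapping.lookup m v = 1" and "(\<Sum>u\<in>UNIV - {v}. Poly_Mapping.lookup m u) = 0"
      using v by linarith+
    then have "\<forall>u\<in>UNIV - {v}. Poly_Mapping.lookup m u = 0" by simp
    with m1 have m: "m = Poly_Mapping.single v 1"
      by (intro poly_mapping_eqI) (auto simp: lookup_single when_def)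
    have "Poly_Mapping.single u (1::nat) = m \<longleftrightarrow> u = v" for u
      unfolding m by (metis lookup_single_eq lookup_single_not_eq zero_neq_one)
    then show ?thesis unfolding rhs by (simp add: m when_def)
  next
    case False
    then have z: "Poly_Mapping.lookup q m = 0" by (simp add: in_keys_iff)
    have "(\<Sum>v\<in>UNIV. Poly_Mapping.lookup q (Poly_Mapping.single v 1) when Poly_Mapping.single v 1 = m) = 0"
      by (rule sum.neutral) (use z in \<open>auto simp: when_def\<close>)
    then show ?thesis unfolding rhs z by (rule sym)
  qed
qed

lemma linear_column:
  fixes l :: "3 \<Rightarrow> 'k::field R"
  assumes "\<And>i. homogeneous 1 (l i)"
  shows "\<exists>L. l = combine L mvar"
proof
  show "l = combine (\<chi> i j. Poly_Mapping.lookup (l i) (Poly_Mapping.single j 1)) mvar"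
    using linear_form[OF assms] by (auto simp: combine_def)
qed

lemma det_3_from_0:
  fixes A :: "'a::comm_ring_1 ^ 3 ^ 3"
  shows "det A = A $ 0 $ 0 * (A $ 1 $ 1 * A $ 2 $ 2 - A $ 1 $ 2 * A $ 2 $ 1)
    - A $ 0 $ 1 * (A $ 1 $ 0 * A $ 2 $ 2 - A $ 1 $ 2 * A $ 2 $ 0)
    + A $ 0 $ 2 * (A $ 1 $ 0 * A $ 2 $ 1 - A $ 1 $ 1 * A $ 2 $ 0)"
  unfolding det_3 three_eq_zero by (simp add: algebra_simps)

lemma invertible_with_last_column:
  fixes w :: "'k::field ^ 3"
  assumes "w \<noteq> 0"
  shows "\<exists>M :: 'k ^ 3 ^ 3. invertible M \<and> (\<forall>i. M $ i $ 2 = w $ i)"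
proof -
  obtain k where k: "w $ k \<noteq> 0" using assms by (auto simp: vec_eq_iff)
  define M :: "'k ^ 3 ^ 3" where
    "M = (\<chi> i j. if j = 2 then w $ i else if i = (if j = 0 then k + 1 else k + 2) then 1 else 0)"
  have "det M \<noteq> 0"
    using k by (cases k rule: cases_3) (simp_all add: det_3_from_0 M_def plus_3)
  then show ?thesis by (intro exI[of _ M]) (simp add: invertible_det_nz M_def)
qed

lemma invertible_to_basis:
  fixes a b :: "3 \<Rightarrow> 'k::field"
  assumes "minors a b k \<noteq> 0"
  shows "\<exists>N N' :: 'k ^ 3 ^ 3. N ** N' = mat 1 \<and> N' ** N = mat 1 \<and>
    (\<forall>i. (\<Sum>j\<in>UNIV. N $ i $ j * a j) = (if i = 0 then 1 else 0)) \<and>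
    (\<forall>i. (\<Sum>j\<in>UNIV. N $ i $ j * b j) = (if i = 1 then -1 else 0))"
proof -
  define P :: "'k ^ 3 ^ 3" where
    "P = (\<chi> i j. if j = 0 then a i else if j = 1 then - b i else if i = k then 1 else 0)"
  have "det P \<noteq> 0"
    using assms by (cases k rule: cases_3) (simp_all add: det_3_from_0 P_def minors_simps algebra_simps)
  then obtain N where N: "P ** N = mat 1" "N ** P = mat 1"
    by (auto simp: invertible_det_nz[symmetric] invertible_def)
  have e: "(\<Sum>j\<in>UNIV. N $ i $ j * P $ j $ m) = (if i = m then 1 else 0)" for i m
    using N(2) by (simp add: vec_eq_iff matrix_matrix_mult_def mat_def)
  show ?thesis
  proof (rule exI[of _ N], rule exI[of _ P], intro conjI allI N)
    show "(\<Sum>j\<in>UNIV. N $ i $ j * a j) = (if i = 0 then 1 else 0)" for i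
      using e[of i 0] by (simp add: P_def)
    have "(\<Sum>j\<in>UNIV. N $ i $ j * b j) = - (\<Sum>j\<in>UNIV. N $ i $ j * P $ j $ 1)" for i
      by (simp add: P_def sum_negf)
    then show "(\<Sum>j\<in>UNIV. N $ i $ j * b j) = (if i = 1 then -1 else 0)" for i
      by (simp add: e)
  qed
qed

lemma mconst_eq_0_iff: "(mconst c :: ('v, 'k::field) mpoly) = 0 \<longleftrightarrow> c = 0"
proof
  assume "(mconst c :: ('v, 'k) mpoly) = 0"
  then have "Poly_Mapping.lookup (mconst c :: ('v, 'k) mpoly) 0 = 0" by simp
  then show "c = 0" by (simp add: mconst_def)
qed (simp add: mconst_def)

text \<open>
  Such a relation is a linear form in y that vanishes at f.
\<close>

lemma no_constant_syzygy:
  fixes f :: "3 \<Rightarrow> 'k::field R"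
  assumes "forms_independent f" "(\<Sum>i\<in>UNIV. mconst (c i) * f i) = 0"
  shows "c i = 0"
proof -
  define h where "h = (\<Sum>i\<in>UNIV. mconst (c i) * mvar i :: 'k R)"
  have "homogeneous 1 h"
    using homogeneous_combine[where a = mvar and c = "\<chi> i j. c j" and i = 0, OF homogeneous_mvar] by (simp add: combine_def h_def)
  moreover have "msubst f h = 0"
    using assms(2) by (simp add: h_def ring_map_sum[OF msubst_simps(3)] ring_map_mult[OF msubst_simps(3)] msubst_simps)
  ultimately have "h = 0" using assms(1) by (simp add: forms_independent_def)
  then have "Poly_Mapping.lookup h (Poly_Mapping.single i 1) = 0" by simp
  moreover have "Poly_Mapping.lookup h (Poly_Mapping.single i 1) = c i"
  proof -
    have "Poly_Mapping.single u (1::nat) = Poly_Mapping.single i 1 \<longleftrightarrow> u = i" for u :: 3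
      by (metis lookup_single_eq lookup_single_not_eq zero_neq_one)
    then show ?thesis
      by (simp add: h_def lookup_sum mconst_def mvar_def mult_single lookup_single when_def)
  qed
  ultimately show ?thesis by simp
qed

text \<open>
  Let the last new coordinate be in the direction of the kernel of L, so that l becomes x_0 a + x_1 b with
  constant vectors a and b. If a and b are independent, a change of basis of the generators sends
  them to (1, 0, 0) and (0, -1, 0). Otherwise l is a linear form times a constant vector. If it is zero,
  so are the minors; if not, the constant vector is a syzygy of f.
\<close>

lemma standard_form_of_singular_column:
  fixes f l p :: "3 \<Rightarrow> 'k::field R"
  assumes syz: "syzygy_basis f l p" and ind: "forms_independent f"
    and l: "l = combine L mvar" and det: "det L = 0"
  shows "\<exists>M N N'. invertible M \<and> N ** N' = mat 1 \<and> N' ** N = mat 1 \<and> change N M l = standard_column"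
proof -
  have "\<not> (\<exists>B. B ** L = mat 1)"
    using det by (metis invertible_det_nz invertible_left_inverse)
  then obtain w where w: "L *v w = 0" "w \<noteq> 0"
    by (metis matrix_left_invertible_ker)
  obtain M :: "'k ^ 3 ^ 3" where M: "invertible M" "\<And>i. M $ i $ 2 = w $ i"
    using invertible_with_last_column[OF w(2)] by blast
  define a b where "a i = (L ** M) $ i $ 0" and "b i = (L ** M) $ i $ 1" for i
  have LM2: "(L ** M) $ i $ 2 = 0" for i
  proof -
    have "(L ** M) $ i $ 2 = (L *v w) $ i"
      unfolding matrix_matrix_mult_def matrix_vector_mult_def by (simp only: vec_lambda_beta M(2))
    then show ?thesis by (simp only: w(1) zero_index)
  qed
  have l': "linear_change M (l i) = mconst (a i) * mvar 0 + mconst (b i) * mvar 1" for i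
    unfolding l linear_change_eq msubst_combine
    by (simp add: msubst_simps combine_combine)
      (simp add: combine_def sum_UNIV_3 a_def b_def LM2 ring_map_zero[OF ring_map_mconst])
  have "\<exists>k. minors a b k \<noteq> 0"
  proof (rule ccontr)
    assume "\<not> ?thesis"
    then have "minors a b k = 0" for k by blast
    then have par: "a i * b j = a j * b i" for i j
      using minors_simps[of a b] by (cases i rule: cases_3; cases j rule: cases_3) (simp_all add: algebra_simps)
    define f' where "f' = change (mat 1) M f"
    have ind': "forms_independent f'"
      unfolding f'_def by (rule forms_independent_change[OF ind _ M(1)]) (simp add: invertible_det_nz)
    have f': "f' i = linear_change M (f i)" for i by (simp add: f'_def change_def combine_mat_1)
    have "linear_change M (\<Sum>i\<in>UNIV. f i * l i) = 0"
      using syzygy_basisD(1)[OF syz] by (simp add: ring_map_zero[OF ring_map_linear_change])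
    then have rel: "(\<Sum>i\<in>UNIV. f' i * (mconst (a i) * mvar 0 + mconst (b i) * mvar 1)) = 0"
      by (simp add: ring_map_sum[OF ring_map_linear_change] ring_map_mult[OF ring_map_linear_change] l' f')
    have "a i = 0 \<and> b i = 0" for i
    proof (rule ccontr)
      assume i: "\<not> ?thesis"
      define c where "c j = (if a i \<noteq> 0 then a j else b j)" for j
      have ci: "c i \<noteq> 0" using i by (auto simp: c_def)
      have ab: "c i * a j = a i * c j" "c i * b j = b i * c j" for j
        using par[of i j] by (auto simp: c_def mult.commute)
      have scaled: "mconst (c i) * (mconst (a j) * mvar 0 + mconst (b j) * mvar 1) =
          (mconst (a i) * mvar 0 + mconst (b i) * mvar 1) * mconst (c j)" for j :: 3
      proof -
        have m: "mconst (c i) * mconst (a j) = mconst (a i) * mconst (c j)" "mconst (c i) * mconst (b j) = mconst (b i) * mconst (c j)"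
          unfolding ring_map_mult[OF ring_map_mconst, symmetric] ab by simp_all
        have "mconst (c i) * (mconst (a j) * mvar 0 + mconst (b j) * mvar 1) =
          mconst (c i) * mconst (a j) * mvar 0 + mconst (c i) * mconst (b j) * mvar 1"
          by (simp only: distrib_left mult.assoc)
        also have "\<dots> = (mconst (a i) * mvar 0 + mconst (b i) * mvar 1) * mconst (c j)"
          unfolding m by (simp only: distrib_right) (simp only: ac_simps)
        finally show ?thesis .
      qed
      have "mconst (c i) * (\<Sum>j\<in>UNIV. f' j * (mconst (a j) * mvar 0 + mconst (b j) * mvar 1)) =
          (\<Sum>j\<in>UNIV. f' j * (mconst (c i) * (mconst (a j) * mvar 0 + mconst (b j) * mvar 1)))"
        unfolding sum_distrib_left by (simp only: ac_simps)
      also have "\<dots> = (mconst (a i) * mvar 0 + mconst (b i) * mvar 1) * (\<Sum>j\<in>UNIV. mconst (c j) * f' j)"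
        unfolding scaled sum_distrib_left by (simp only: ac_simps)
      finally have "mconst (c i) * (\<Sum>j\<in>UNIV. f' j * (mconst (a j) * mvar 0 + mconst (b j) * mvar 1)) =
          (mconst (a i) * mvar 0 + mconst (b i) * mvar 1) * (\<Sum>j\<in>UNIV. mconst (c j) * f' j)" .
      then have "(mconst (a i) * mvar 0 + mconst (b i) * mvar 1) * (\<Sum>j\<in>UNIV. mconst (c j) * f' j) = 0"
        using rel by simp
      moreover have "mconst (a i) * mvar 0 + mconst (b i) * mvar 1 \<noteq> (0 :: 'k R)"
      proof
        assume z: "mconst (a i) * mvar 0 + mconst (b i) * mvar 1 = (0 :: 'k R)"
        have "msubst (\<lambda>v::3. if v = 0 then 1 else 0) (mconst (a i) * mvar 0 + mconst (b i) * mvar 1) = (mconst (a i) :: 'k R)"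
          "msubst (\<lambda>v::3. if v = 1 then 1 else 0) (mconst (a i) * mvar 0 + mconst (b i) * mvar 1) = (mconst (b i) :: 'k R)"
          by (simp_all add: ring_map_simps[OF msubst_simps(3)] msubst_simps)
        then have "mconst (a i) = (0 :: 'k R)" "mconst (b i) = (0 :: 'k R)"
          unfolding z ring_map_zero[OF msubst_simps(3)] by simp_all
        then show False using i by (simp add: mconst_eq_0_iff)
      qed
      ultimately have "(\<Sum>j\<in>UNIV. mconst (c j) * f' j) = 0" by simp
      then show False using no_constant_syzygy[OF ind'] ci by blast
    qed
    then have "linear_change M (l i) = 0" for i by (simp add: l' ring_map_zero[OF ring_map_mconst])
    then have "l i = 0" for i
      using M(1) linear_change_eq_0_iff by (metis invertible_def)
    then have "minors l p 0 = 0" by (simp add: minors_simps)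
    then show False using minors_nonzero[OF syz forms_independent_nonzero[OF ind]] by blast
  qed
  then obtain k where k: "minors a b k \<noteq> 0" by blast
  obtain N N' :: "'k ^ 3 ^ 3" where N: "N ** N' = mat 1" "N' ** N = mat 1"
    "\<And>i. (\<Sum>j\<in>UNIV. N $ i $ j * a j) = (if i = 0 then 1 else 0)"
    "\<And>i. (\<Sum>j\<in>UNIV. N $ i $ j * b j) = (if i = 1 then -1 else 0)"
    using invertible_to_basis[OF k] by blast
  have "change N M l i = standard_column i" for i
  proof -
    have "change N M l i = mconst (\<Sum>j\<in>UNIV. N $ i $ j * a j) * mvar 0 + mconst (\<Sum>j\<in>UNIV. N $ i $ j * b j) * mvar 1"
      unfolding change_def combine_def l' sum_UNIV_3
      by (simp add: ring_map_add[OF ring_map_mconst] ring_map_mult[OF ring_map_mconst] algebra_simps)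
    also have "\<dots> = standard_column i"
      unfolding N(3,4) by (simp add: standard_column_def ring_map_zero[OF ring_map_mconst] ring_map_one[OF ring_map_mconst] ring_map_uminus[OF ring_map_mconst])
    finally show ?thesis .
  qed
  then show ?thesis using M(1) N(1,2) by blast
qed

lemma homogeneous_change: "(\<And>i. homogeneous e (f i)) \<Longrightarrow> homogeneous e (change B M f i)"
  unfolding change_def by (intro homogeneous_combine homogeneous_linear_change)

text \<open>
  If L is invertible, then l can be brought to x, which contradicts the existence of an inverse.
\<close>

lemma standard_form_of_inverse:
  fixes f l p :: "3 \<Rightarrow> 'k::field R"
  assumes syz: "syzygy_basis f l p" and ind: "forms_independent f"
    and hom: "\<And>i. homogeneous 1 (l i)" "\<And>i. homogeneous n (p i)" "n \<ge> 2"
    and inv: "has_inverse f"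
  shows "\<exists>M N N'. invertible M \<and> N ** N' = mat 1 \<and> N' ** N = mat 1 \<and> change N M l = standard_column"
proof -
  obtain L where L: "l = combine L mvar" using linear_column[of l] hom(1) by blast
  have "det L = 0"
  proof (rule ccontr)
    assume "det L \<noteq> 0"
    then obtain N where N: "L ** N = mat 1" "N ** L = mat 1"
      by (auto simp: invertible_det_nz[symmetric] invertible_def)
    have i1: "invertible (mat 1 :: 'k ^ 3 ^ 3)" by (simp add: invertible_det_nz)
    have iT: "invertible (transpose L)" using \<open>det L \<noteq> 0\<close> by (simp add: invertible_det_nz)
    have lc1: "linear_change (mat 1) q = q" for q :: "'k R"
      by (simp add: linear_change_eq combine_mat_1) (simp add: msubst_eq_meval meval_id)
    have "change N (mat 1) l = mvar"
      by (simp add: change_def lc1 L combine_combine N combine_mat_1)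
    then have syz': "syzygy_basis (change (transpose L) (mat 1) f) mvar (change N (mat 1) p)"
      using syzygy_basis_change[OF syz i1 N(2,1)] by simp
    have "has_inverse (change (transpose L) (mat 1) f)"
      by (rule has_inverse_change[OF inv iT i1])
    moreover have "change (transpose L) (mat 1) f 2 \<noteq> 0"
      by (rule forms_independent_nonzero[OF forms_independent_change[OF ind iT i1]])
    moreover have "homogeneous n (change N (mat 1) p i)" for i
      by (rule homogeneous_change) (rule hom(2))
    ultimately show False
      using no_inverse_if_linear_forms_independent[OF syz' _ _ hom(3)] by blast
  qed
  then show ?thesis using standard_form_of_singular_column[OF syz ind L] by blast
qed

section \<open>Dominance and birationality\<close>

lemma is_ideal_iff: "is_ideal (P :: 'a::comm_ring_1 set) \<longleftrightarrow>
    0 \<in> P \<and> (\<forall>a\<in>P. \<forall>b\<in>P. a + b \<in> P) \<and> (\<forall>c. \<forall>a\<in>P. c * a \<in> P)"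
  by (simp add: module.subspace_def[OF module_mult])

lemma is_prime_ideal_kernel:
  fixes h :: "'a::comm_ring_1 \<Rightarrow> 'b::idom"
  assumes "ring_map h"
  shows "is_prime_ideal {a. h a = 0}"
proof -
  have "1 \<notin> {a. h a = 0}" using ring_map_one[OF assms] by simp
  then have "{a. h a = 0} \<noteq> UNIV" by blast
  then show ?thesis
    unfolding is_prime_ideal_def is_ideal_iff by (simp add: ring_map_simps[OF assms])
qed

lemma is_prime_ideal_zero: "is_prime_ideal {0 :: 'a::idom}"
  using is_prime_ideal_kernel[where h = "\<lambda>x :: 'a. x", OF ring_map_id] by simp

lemma ideal_gen_least: "S \<subseteq> P \<Longrightarrow> is_ideal P \<Longrightarrow> ideal_gen (S :: 'a::comm_ring_1 set) \<subseteq> P"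
  by (rule module.span_minimal[OF module_mult])

lemma ideal_gen_base: "a \<in> S \<Longrightarrow> a \<in> ideal_gen (S :: 'a::comm_ring_1 set)"
  by (rule module.span_base[OF module_mult])

lemma is_ideal_gen: "is_ideal (ideal_gen (S :: 'a::comm_ring_1 set))"
  by (rule module.subspace_span[OF module_mult])

lemma zero_ideal_proj_point: "{0} \<in> (proj_points :: 'k::field R set set)"
proof -
  have "is_prime_ideal {0 :: 'k R}" by (rule is_prime_ideal_zero)
  moreover have "homogeneous_ideal {0 :: 'k R}"
  proof -
    have "{h \<in> {0 :: 'k R}. \<exists>n. homogeneous n h} = {0}" by (auto simp: homogeneous_def)
    moreover have "ideal_gen {0 :: 'k R} = {0}" by (auto simp: in_ideal_gen_1)
    ultimately show ?thesis by (simp add: homogeneous_ideal_def)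
  qed
  moreover have "mvar 0 \<in> (irrelevant_ideal :: 'k R set)"
    unfolding irrelevant_ideal_def by (rule ideal_gen_base) simp
  ultimately show ?thesis by (auto simp: proj_points_def)
qed

text \<open>
  A form that vanishes at f vanishes on the image of every point, whereas it does not vanish at the generic
  point of the plane.
\<close>

lemma forms_independent_of_dominant:
  fixes f :: "'k::field R ^ 3"
  assumes "dominant f"
  shows "forms_independent (($) f)"
  unfolding forms_independent_def
proof (intro allI impI, rule ccontr)
  fix n and h :: "'k R"
  assume h: "homogeneous n h" "msubst (($) f) h = 0" "h \<noteq> 0"
  define U where "U = {P \<in> proj_points. h \<notin> P}"
  have "{0} \<in> zariski_topology closure_of (rational_point f ` rational_domain f)"
    using assms zero_ideal_proj_point by (simp add: dominant_def)
  moreover have "openin zariski_topology U"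
    unfolding zariski_topology_def U_def by (rule topology_generated_by_Basis) (use h(1) in blast)
  moreover have "{0} \<in> U" using zero_ideal_proj_point h(3) by (simp add: U_def)
  ultimately obtain P where P: "P \<in> rational_domain f" "rational_point f P \<in> U"
    by (auto simp: in_closure_of)
  have "0 \<in> P" using P(1) by (simp add: rational_domain_def proj_points_def is_prime_ideal_def is_ideal_iff)
  then have "h \<in> rational_point f P"
    unfolding rational_point_def by (intro ideal_gen_base) (use h in auto)
  then show False using P(2) by (simp add: U_def)
qed

text \<open>
  If g(f) is proportional to x, then f(g(f)) is proportional to f by homogeneity. So the forms
  f_i(g(y)) y_j - f_j(g(y)) y_i vanish at y = f, hence identically.
\<close>

lemma birational_iff_has_inverse:
  fixes f :: "'k::field R ^ 3"
  assumes map: "rational_map d f" and dom: "dominant f"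
  shows "birational f \<longleftrightarrow> has_inverse (($) f)"
proof
  assume "birational f"
  then obtain e g where g: "rational_map e g" "same_rational_map (rational_comp g f) rational_id"
    by (auto simp: birational_def)
  show "has_inverse (($) f)"
    unfolding has_inverse_def
  proof (intro exI[of _ e] exI[of _ "($) g"] conjI allI)
    show "homogeneous e (g $ i)" for i using g(1) by (simp add: rational_map_def)
    show "parallel (\<lambda>i. msubst (($) f) (g $ i)) mvar"
      using g(2) by (simp add: same_rational_map_def rational_comp_def rational_id_def parallel_def)
    show "\<exists>i. msubst (($) f) (g $ i) \<noteq> 0"
      using g(2) by (auto simp: same_rational_map_def rational_comp_def vec_eq_iff)
  qed
next
  note ind = forms_independent_of_dominant[OF dom]
  note f0 = forms_independent_nonzero[OF ind]
  assume "has_inverse (($) f)"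
  then obtain e g where g: "\<And>i. homogeneous e (g i)" "parallel (\<lambda>i. msubst (($) f) (g i)) mvar"
    "\<exists>i. msubst (($) f) (g i) \<noteq> 0"
    by (auto simp: has_inverse_def)
  define G where "G = (\<chi> i. g i)"
  obtain k where k: "msubst (($) f) (g k) \<noteq> 0" using g(3) by blast
  have homf: "homogeneous d (f $ i)" for i using map by (simp add: rational_map_def)
  have "g k \<noteq> 0" using k ring_map_zero[OF msubst_simps(3), of "($) f"] by metis
  then have G0: "G \<noteq> 0" by (auto simp: G_def vec_eq_iff)
  define c where "c i = msubst g (f $ i)" for i
  have cf: "mvar k ^ d * msubst (($) f) (c i) = msubst (($) f) (g k) ^ d * f $ i" for i
    using parallel_form[OF ring_map_mconst g(2) homf[of i], of k]
    by (simp add: c_def msubst_msubst msubst_eq_meval[of mvar, symmetric]) (simp add: msubst_eq_meval meval_id)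
  have homc: "homogeneous (e * d) (c i)" for i
  proof -
    have "weighted (\<lambda>_. e) (e * d) (f $ i)"
      using homf[of i] by (simp add: homogeneous_def weighted_def sum_distrib_right[symmetric])
    then show ?thesis
      unfolding c_def homogeneous_eq_weighted
      by (rule weighted_msubst) (use g(1) in \<open>simp add: homogeneous_eq_weighted\<close>)
  qed
  have c0: "c i \<noteq> 0" for i
  proof
    assume "c i = 0"
    then have "msubst (($) f) (g k) ^ d * f $ i = 0"
      using cf[of i] by (simp add: ring_map_zero[OF msubst_simps(3)])
    then show False using k f0[of i] by simp
  qed
  have "c i * mvar j = c j * mvar i" for i j
  proof -
    have eq: "msubst (($) f) (c i * mvar j - c j * mvar i) = msubst (($) f) (c i) * f $ j - msubst (($) f) (c j) * f $ i"
      by (simp add: ring_map_simps[OF msubst_simps(3)] msubst_simps)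
    have "mvar k ^ d * msubst (($) f) (c i * mvar j - c j * mvar i) =
        (mvar k ^ d * msubst (($) f) (c i)) * f $ j - (mvar k ^ d * msubst (($) f) (c j)) * f $ i"
      unfolding eq by (simp only: right_diff_distrib mult.assoc)
    also have "\<dots> = 0" unfolding cf by (simp add: mult.commute mult.left_commute)
    finally have "msubst (($) f) (c i * mvar j - c j * mvar i) = 0" by simp
    moreover have "homogeneous (e * d + 1) (c i * mvar j - c j * mvar i)"
      using homc homogeneous_mvar unfolding homogeneous_eq_weighted by (intro weighted_diff weighted_mult)
    ultimately have "c i * mvar j - c j * mvar i = 0"
      using ind unfolding forms_independent_def by blast
    then show ?thesis by simp
  qed
  then have "same_rational_map (rational_comp f G) rational_id"
    using c0 by (auto simp: same_rational_map_def rational_comp_def rational_id_def vec_eq_iff c_def G_def)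
  moreover have "same_rational_map (rational_comp G f) rational_id"
    using g(2,3) by (auto simp: same_rational_map_def rational_comp_def rational_id_def vec_eq_iff G_def parallel_def)
  moreover have "rational_map e G" using g(1) G0 by (simp add: rational_map_def G_def)
  ultimately show "birational f" using dom by (auto simp: birational_def)
qed

lemma sum_UNIV_2: "(\<Sum>i\<in>(UNIV :: 2 set). f i) = f 0 + f 1"
proof -
  have "(2::2) = 0" by simp
  then show ?thesis unfolding sum_2 by (simp only: add.commute)
qed

lemma syzygy_basis_of_hilbert_burch:
  fixes f :: "'k::field R ^ 3"
  assumes "hilbert_burch_presentation a b f \<phi>"
  shows "syzygy_basis (($) f) (\<lambda>i. \<phi> $ i $ 0) (\<lambda>i. \<phi> $ i $ 1)"
  unfolding syzygy_basis_def
proof (intro allI)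
  fix w :: "3 \<Rightarrow> 'k R"
  have r: "range (\<lambda>v. \<phi> *v v) = {w. (\<Sum>i\<in>UNIV. f $ i * w $ i) = 0}"
    using assms by (simp add: hilbert_burch_presentation_def)
  have "(\<Sum>i\<in>UNIV. f $ i * w i) = 0 \<longleftrightarrow> (\<chi> i. w i) \<in> range (\<lambda>v. \<phi> *v v)"
    unfolding r by simp
  also have "\<dots> \<longleftrightarrow> (\<exists>v :: 'k R ^ 2. \<forall>i. w i = \<phi> $ i $ 0 * v $ 0 + \<phi> $ i $ 1 * v $ 1)"
    by (simp add: image_iff vec_eq_iff matrix_vector_mult_def sum_UNIV_2)
  also have "\<dots> \<longleftrightarrow> (\<exists>u v. \<forall>i. w i = u * \<phi> $ i $ 0 + v * \<phi> $ i $ 1)"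
  proof
    assume "\<exists>u v. \<forall>i. w i = u * \<phi> $ i $ 0 + v * \<phi> $ i $ 1"
    then obtain u v where "\<forall>i. w i = u * \<phi> $ i $ 0 + v * \<phi> $ i $ 1" by blast
    then show "\<exists>v :: 'k R ^ 2. \<forall>i. w i = \<phi> $ i $ 0 * v $ 0 + \<phi> $ i $ 1 * v $ 1"
      by (intro exI[of _ "\<chi> j. if j = 0 then u else v"]) (simp add: mult.commute)
  qed (auto simp: mult.commute)
  finally show "(\<Sum>i\<in>UNIV. f $ i * w i) = 0 \<longleftrightarrow> (\<exists>u v. \<forall>i. w i = u * \<phi> $ i $ 0 + v * \<phi> $ i $ 1)" .
qed

lemma coordinate_change_iff:
  "coordinate_change M N \<phi> p \<longleftrightarrow> invertible M \<and> invertible N \<and>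
     change N M (\<lambda>i. \<phi> $ i $ 0) = standard_column \<and> change N M (\<lambda>i. \<phi> $ i $ 1) = ($) p"
proof -
  have a2: "(\<forall>j::2. P j) \<longleftrightarrow> P 0 \<and> P 1" for P
  proof -
    have "(2::2) = 0" by simp
    then show ?thesis unfolding forall_2 by (simp only: conj_commute)
  qed
  have "map_matrix mconst N ** map_matrix (linear_change M) \<phi> = displayed_form p \<longleftrightarrow>
    (\<forall>i. change N M (\<lambda>i. \<phi> $ i $ 0) i = standard_column i \<and> change N M (\<lambda>i. \<phi> $ i $ 1) i = p $ i)"
    by (simp add: vec_eq_iff a2 matrix_matrix_mult_def map_matrix_def change_def combine_def displayed_form_def standard_column_def)
  then show ?thesis unfolding coordinate_change_def by (auto simp: fun_eq_iff)
qed

section \<open>The height of the ideal of two independent linear forms\<close>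

lemma is_prime_ideal_vimage:
  fixes h :: "'a::comm_ring_1 \<Rightarrow> 'b::comm_ring_1"
  assumes "ring_map h" "is_prime_ideal P"
  shows "is_prime_ideal {a. h a \<in> P}"
proof -
  have "1 \<notin> P"
  proof
    assume "1 \<in> P"
    then have "c * 1 \<in> P" for c using assms(2) unfolding is_prime_ideal_def is_ideal_iff by blast
    then show False using assms(2) by (auto simp: is_prime_ideal_def)
  qed
  then have "1 \<notin> {a. h a \<in> P}" using ring_map_one[OF assms(1)] by simp
  then have "{a. h a \<in> P} \<noteq> UNIV" by blast
  then show ?thesis
    using assms(2) unfolding is_prime_ideal_def is_ideal_iff by (auto simp: ring_map_simps[OF assms(1)])
qed

text \<open>
  Suppose that Q meets the elements free of t only in 0. An element r of least degree in Q then has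
  positive degree and divides every element of Q up to a factor free of t, which lies outside P. If r is in P,
  it follows that Q = P. Otherwise the quotient of an element of P of least degree by r is an element of P
  of smaller degree.
\<close>

lemma (in free_variable) prime_contains_free:
  assumes "is_prime_ideal P" "is_prime_ideal Q" "P \<subset> Q" "P \<noteq> {0}"
  shows "\<exists>a\<in>Q. a \<noteq> 0 \<and> free a"
proof (rule ccontr)
  assume no: "\<not> ?thesis"
  have P: "0 \<in> P" "\<And>a b. a \<in> P \<Longrightarrow> b * a \<in> P" "\<And>a b. a * b \<in> P \<Longrightarrow> a \<in> P \<or> b \<in> P"
    using assms(1) unfolding is_prime_ideal_def is_ideal_iff by blast+
  have Q: "\<And>a b. a \<in> Q \<Longrightarrow> b \<in> Q \<Longrightarrow> a + b \<in> Q" "\<And>a b. a \<in> Q \<Longrightarrow> b * a \<in> Q"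
    using assms(2) unfolding is_prime_ideal_def is_ideal_iff by blast+
  \<comment> \<open>f and r are elements of least degree of P and of Q.\<close>
  obtain f0 where "f0 \<in> P \<and> f0 \<noteq> 0" using assms(4) P(1) by blast
  then obtain f where f: "f \<in> P" "f \<noteq> 0" "\<And>f'. f' \<in> P \<and> f' \<noteq> 0 \<Longrightarrow> deg f \<le> deg f'"
    using ex_has_least_nat[of "\<lambda>f. f \<in> P \<and> f \<noteq> 0" f0 deg] by blast
  have "f \<in> Q \<and> f \<noteq> 0" using f assms(3) by blast
  then obtain r where r: "r \<in> Q" "r \<noteq> 0" "\<And>r'. r' \<in> Q \<and> r' \<noteq> 0 \<Longrightarrow> deg r \<le> deg r'"
    using ex_has_least_nat[of "\<lambda>f. f \<in> Q \<and> f \<noteq> 0" f deg] by blast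
  have r_deg: "deg r \<noteq> 0" using no r(1,2) deg_0_free by blast
  have div: "\<exists>D q. free D \<and> D \<noteq> 0 \<and> D * a = q * r" if "a \<in> Q" for a
  proof -
    obtain D q s where D: "free D" "D \<noteq> 0" "D * a = q * r + s" "s = 0 \<or> deg s < deg r"
      using pseudo_division[OF r(2), of a] by blast
    have "s = D * a + (- q) * r" using D(3) by simp
    then have "s \<in> Q" using Q that r(1) by blast
    then have "s = 0" using D(4) r(3)[of s] by fastforce
    then show ?thesis using D by auto
  qed
  have noP: "D \<notin> P" if "free D" "D \<noteq> 0" for D using no assms(3) that by blast
  obtain D q where D: "free D" "D \<noteq> 0" "D * f = q * r" using div[of f] f(1) assms(3) by blast
  then have "q * r \<in> P" using P(2)[OF f(1), of D] by simp
  then consider "q \<in> P" | "r \<in> P" using P(3) by blast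
  then show False
  proof cases
    case 1
    have q0: "q \<noteq> 0" using D(2,3) f(2) by auto
    have "deg q + deg r = deg f"
      using arg_cong[OF D(3), of deg] free_deg[OF D(1)] D(2) f(2) q0 r(2) by (simp add: deg_mult)
    then show False using f(3)[of q] 1 q0 r_deg by simp
  next
    case 2
    have "Q \<subseteq> P"
    proof
      fix a assume "a \<in> Q"
      then obtain D q where "free D" "D \<noteq> 0" "D * a = q * r" using div by blast
      then show "a \<in> P" using P(2)[OF 2, of q] P(3)[of D a] noP by simp
    qed
    then show False using assms(3) by blast
  qed
qed

definition at_zero :: "3 set \<Rightarrow> 'k::field R \<Rightarrow> 'k R" where
  "at_zero V = msubst (\<lambda>v. if v \<in> V then 0 else mvar v)"

lemma at_zero_simps:
  "ring_map (at_zero V)" "at_zero V (mconst c) = mconst c"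
  "at_zero V (mvar v) = (if v \<in> V then 0 else mvar v)"
  by (simp_all add: at_zero_def msubst_simps)

lemma at_zero_at_zero: "at_zero V (at_zero W q) = at_zero (V \<union> W) q"
  by (rule ring_map_mpoly_unique[OF ring_map_comp[OF at_zero_simps(1) at_zero_simps(1)] at_zero_simps(1)])
    (auto simp: at_zero_simps(2,3) ring_map_zero[OF at_zero_simps(1)])

lemma free_split_iff: "free_variable.free (split_variable v) a \<longleftrightarrow> at_zero {v} a = (a :: 'k::field R)"
proof -
  interpret free_variable "split_variable v" "mvar v :: 'k R" by (rule free_variable_split)
  have p: "poly (split_variable v a) 0 = at_zero {v} a" for a :: "'k R"
    by (rule ring_map_mpoly_unique[OF ring_map_comp[OF ring_map_poly j] at_zero_simps(1)])
      (simp_all add: split_variable_simps(2,3) at_zero_simps(2,3))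
  have q: "split_variable v (at_zero {v} a) = [:at_zero {v} a:]" for a :: "'k R"
    by (rule ring_map_mpoly_unique[OF ring_map_comp[OF j at_zero_simps(1)] ring_map_comp[OF ring_map_const_poly at_zero_simps(1)]])
      (auto simp: split_variable_simps(2,3) at_zero_simps(2,3) ring_map_zero[OF j])
  show ?thesis
    using p[of a] q[of a] by (auto simp: free_def)
qed

lemma mvar_dvd_of_at_zero: "at_zero {v} q = 0 \<Longrightarrow> mvar v dvd q"
  using mvar_dvd[of v q] by (simp add: at_zero_def)

lemma at_zero_01:
  assumes "at_zero {0, 1} q = 0"
  shows "\<exists>u v. q = u * mvar 0 + v * mvar 1"
proof -
  have "at_zero {0} (at_zero {1} q) = 0" using assms by (simp add: at_zero_at_zero insert_commute)
  then obtain u where u: "at_zero {1} q = mvar 0 * u" using mvar_dvd_of_at_zero by (blast elim: dvdE)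
  have "at_zero {1} (q - at_zero {1} q) = 0"
    by (simp add: ring_map_diff[OF at_zero_simps(1)] at_zero_at_zero)
  then obtain v where v: "q - at_zero {1} q = mvar 1 * v" using mvar_dvd_of_at_zero by (blast elim: dvdE)
  have "q = u * mvar 0 + v * mvar 1"
    using u v by (simp add: algebra_simps)
  then show ?thesis by blast
qed

text \<open>
  Of the nonzero elements of Q that do not involve w choose one of least degree in v. It vanishes at v = w = 0 and
  does not involve w, so v divides it; the quotient has smaller degree and is not in Q.
\<close>

lemma prime_contains_variable:
  fixes P Q :: "'k::field R set"
  assumes "is_prime_ideal P" "is_prime_ideal Q" "P \<subset> Q" "P \<noteq> {0}"
    and Q: "Q \<subseteq> {q. at_zero {v, w} q = 0}" and vw: "v \<noteq> w"
  shows "mvar v \<in> Q"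
proof -
  interpret w: free_variable "split_variable w" "mvar w :: 'k R" by (rule free_variable_split)
  interpret v: free_variable "split_variable v" "mvar v :: 'k R" by (rule free_variable_split)
  let ?S = "\<lambda>a. a \<in> Q \<and> a \<noteq> 0 \<and> at_zero {w} a = a"
  have "\<exists>a. ?S a"
    using w.prime_contains_free[OF assms(1-4)] by (auto simp: free_split_iff)
  then obtain a where a: "?S a" "\<And>b. ?S b \<Longrightarrow> v.deg a \<le> v.deg b"
    using ex_has_least_nat[of ?S _ v.deg] by blast
  have "at_zero ({v} \<union> {w}) a = 0"
    using a(1) Q by (simp add: subset_iff insert_commute)
  then have "at_zero {v} (at_zero {w} a) = 0"
    by (simp only: at_zero_at_zero)
  then have "at_zero {v} a = 0" using a(1) by simp
  then obtain b where b: "a = mvar v * b" using mvar_dvd_of_at_zero by (blast elim: dvdE)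
  then have b0: "b \<noteq> 0" using a(1) by auto
  have "mvar v * at_zero {w} b = mvar v * b"
    using a(1) vw unfolding b by (simp add: ring_map_mult[OF at_zero_simps(1)] at_zero_simps(3))
  then have "at_zero {w} b = b" by simp
  moreover have "v.deg a = 1 + v.deg b"
    unfolding b using b0 by (simp add: v.deg_mult split_variable_simps(3))
  ultimately have "b \<notin> Q" using a(2)[of b] b0 by auto
  then show ?thesis using a(1) b assms(2) unfolding is_prime_ideal_def by blast
qed

text \<open>
  In a chain of length at least 3 the last prime but one would contain x_0 and x_1, and so would be equal to
  the last.
\<close>

lemma prime_chain_01_bound:
  fixes c :: "nat \<Rightarrow> 'k::field R set"
  assumes "prime_chain c n" "c n = {q. at_zero {0, 1} q = 0}"
  shows "n \<le> 2"
proof (rule ccontr)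
  assume n: "\<not> n \<le> 2"
  define m where "m = n - 3"
  have m: "n = Suc (Suc (Suc m))" using n by (simp add: m_def)
  have prime: "is_prime_ideal (c i)" if "i \<le> n" for i using assms(1) that by (simp add: prime_chain_def)
  have sub: "c i \<subset> c (Suc i)" if "i < n" for i using assms(1) that by (simp add: prime_chain_def)
  have 0: "c m \<subset> c (Suc m)" "c (Suc m) \<subset> c (Suc (Suc m))" "c (Suc (Suc m)) \<subset> c n"
    unfolding m by (rule sub, simp add: m)+
  have "0 \<in> c m" using prime[of m] by (simp add: m is_prime_ideal_def is_ideal_iff)
  have ne: "c (Suc m) \<noteq> {0}"
  proof
    assume "c (Suc m) = {0}"
    then have "c m \<subset> {0}" using 0(1) by simp
    then show False using \<open>0 \<in> c m\<close> by (auto simp: psubset_eq subset_singleton_iff)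
  qed
  have p: "is_prime_ideal (c (Suc m))" "is_prime_ideal (c (Suc (Suc m)))" by (simp_all add: prime m)
  have le: "c (Suc (Suc m)) \<subseteq> {q. at_zero {0, 1} q = 0}" "c (Suc (Suc m)) \<subseteq> {q. at_zero {1, 0} q = 0}"
    using 0(3) assms(2) by (auto simp: insert_commute)
  have "mvar 0 \<in> c (Suc (Suc m))" "mvar 1 \<in> c (Suc (Suc m))"
    using prime_contains_variable[OF p 0(2) ne le(1)] prime_contains_variable[OF p 0(2) ne le(2)] by simp_all
  then have "u * mvar 0 + v * mvar 1 \<in> c (Suc (Suc m))" for u v
    using p(2) unfolding is_prime_ideal_def is_ideal_iff by blast
  then have "c n \<subseteq> c (Suc (Suc m))" unfolding assms(2) using at_zero_01 by blast
  then show False using 0(3) by blast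
qed

text \<open>
  The primes containing two independent linear forms lie above the chain formed by 0 and the ideal of the
  first form, which gives the lower bound for all of them at once.
\<close>

lemma height_of_linear_pair:
  fixes \<tau> \<tau>' :: "'k::field R \<Rightarrow> 'k R"
  assumes \<tau>: "ring_map \<tau>" "ring_map \<tau>'" "\<And>q. \<tau> (\<tau>' q) = q" "\<And>q. \<tau>' (\<tau> q) = q"
  shows "height {q. at_zero {0, 1} (\<tau> q) = 0} = 2"
proof -
  define K where "K = {q. at_zero {0, 1} (\<tau> q) = 0}"
  define K0 where "K0 = {q. at_zero {0} (\<tau> q) = 0}"
  have prime: "is_prime_ideal K" "is_prime_ideal K0"
    unfolding K_def K0_def by (rule is_prime_ideal_kernel[OF ring_map_comp[OF at_zero_simps(1) \<tau>(1)]])+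
  have upper: "prime_height K \<le> 2"
    unfolding prime_height_def
  proof (rule SUP_least)
    fix n assume "n \<in> {n. \<exists>c. prime_chain c n \<and> c n = K}"
    then obtain c where c: "prime_chain c n" "c n = K" by blast
    have "prime_chain (\<lambda>i. {q. \<tau>' q \<in> c i}) n"
      unfolding prime_chain_def
    proof (intro conjI allI impI)
      show "is_prime_ideal {q. \<tau>' q \<in> c i}" if "i \<le> n" for i
        using is_prime_ideal_vimage[OF \<tau>(2)] c(1) that by (simp add: prime_chain_def)
      show "{q. \<tau>' q \<in> c i} \<subset> {q. \<tau>' q \<in> c (Suc i)}" if "i < n" for i
      proof -
        have "c i \<subset> c (Suc i)" using c(1) that by (simp add: prime_chain_def)
        then obtain a where a: "a \<in> c (Suc i)" "a \<notin> c i" and sub: "c i \<subseteq> c (Suc i)" by blast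
        have "\<tau> a \<in> {q. \<tau>' q \<in> c (Suc i)}" "\<tau> a \<notin> {q. \<tau>' q \<in> c i}"
          using a by (simp_all add: \<tau>(4))
        then show ?thesis using sub by blast
      qed
    qed
    moreover have "{q. \<tau>' q \<in> c n} = {q. at_zero {0, 1} q = 0}" by (simp add: c(2) K_def \<tau>(3))
    ultimately have "n \<le> 2" by (rule prime_chain_01_bound)
    then show "enat n \<le> 2" by (simp add: numeral_eq_enat)
  qed
  have x: "\<tau>' (mvar 0) \<in> K0" "\<tau>' (mvar 1) \<in> K" "\<tau>' (mvar 1) \<notin> K0" "\<tau>' (mvar 0) \<noteq> 0"
  proof -
    show "\<tau>' (mvar 0) \<in> K0" "\<tau>' (mvar 1) \<in> K" "\<tau>' (mvar 1) \<notin> K0"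
      by (simp_all add: K_def K0_def \<tau>(3) at_zero_simps(3))
    show "\<tau>' (mvar 0) \<noteq> 0" using \<tau>(3)[of "mvar 0"] ring_map_zero[OF \<tau>(1)] by auto
  qed
  have sub: "K0 \<subseteq> K"
  proof
    fix q assume "q \<in> K0"
    then have "at_zero {1} (at_zero {0} (\<tau> q)) = 0" by (simp add: K0_def ring_map_zero[OF at_zero_simps(1)])
    then show "q \<in> K" by (simp add: K_def at_zero_at_zero insert_commute)
  qed
  have lower: "2 \<le> prime_height P" if P: "is_prime_ideal P" "K \<subseteq> P" for P
  proof -
    define c where "c i = (if i = 0 then {0} else if i = 1 then K0 else P)" for i :: nat
    have "prime_chain c 2"
      unfolding prime_chain_def
    proof (intro conjI allI impI)
      show "is_prime_ideal (c i)" if "i \<le> 2" for i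
        by (simp add: c_def P(1) prime(2) is_prime_ideal_zero)
      have "0 \<in> K0" using prime(2) by (simp add: is_prime_ideal_def is_ideal_iff)
      then have "{0} \<subset> K0" "K0 \<subset> P" using x sub P(2) by blast+
      then show "c i \<subset> c (Suc i)" if "i < 2" for i
        using that by (cases i) (simp_all add: c_def)
    qed
    moreover have "c 2 = P" by (simp add: c_def)
    ultimately have "enat 2 \<le> prime_height P"
      unfolding prime_height_def by (intro SUP_upper) blast
    then show ?thesis by (simp add: numeral_eq_enat)
  qed
  have "height K \<le> prime_height K"
    unfolding height_def by (rule INF_lower) (simp add: prime(1))
  moreover have "2 \<le> height K"
    unfolding height_def by (rule INF_greatest) (use lower in blast)
  ultimately show ?thesis using upper unfolding K_def by simp
qed

section \<open>Birationality and the number of Sylvester forms\<close>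

text \<open>
  The coefficient of w^n in the eliminant is the linear form with coefficients p_i(0, 0, 1).
\<close>

lemma vanishing_at_node:
  fixes p :: "'k::field R ^ 3"
  assumes hom: "\<And>i. homogeneous n (p $ i)" and "degree (restrict_incidence (g2 p)) < n"
  shows "at_zero {0, 1} (p $ i) = 0"
proof -
  define e where "e i = meval (\<lambda>c. c) (\<lambda>i. if i = 2 then 1 else 0) (p $ i)" for i
  define z :: "3 \<Rightarrow> 'k R" where "z i = (if i = 2 then 1 else 0)" for i
  have z: "msubst z (p $ i) = mconst (e i)" for i
  proof -
    have "mconst (e i) = meval mconst (\<lambda>v. mconst (if v = 2 then 1 else 0)) (p $ i)"
      unfolding e_def by (rule ring_map_meval_comp[OF ring_map_id ring_map_mconst])
    also have "\<dots> = msubst z (p $ i)"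
      unfolding msubst_eq_meval
      by (rule meval_cong) (simp add: z_def ring_map_zero[OF ring_map_mconst] ring_map_one[OF ring_map_mconst])
    finally show ?thesis by simp
  qed
  have N: "ring_map (at_node :: 'k A \<Rightarrow> _)" unfolding at_node_def by (rule msubst_simps)
  have "at_node (embed_R (p $ i)) = msubst z (p $ i)" for i
    unfolding at_node_def embed_R_def msubst_msubst
    by (simp add: msubst_simps z_def[abs_def])
  then have "at_node (g2 p) = (\<Sum>i\<in>UNIV. mconst (e i) * mvar i)"
    by (simp add: g2_def ring_map_sum[OF N] ring_map_mult[OF N] z) (simp add: at_node_def msubst_simps)
  moreover have "at_node (g2 p) = 0"
    using coeff_restrict_incidence[OF bihomogeneous_g2[OF hom]] coeff_eq_0[OF assms(2)] by simp
  ultimately have "(\<Sum>i\<in>UNIV. mconst (e i) * mvar i) = (0 :: 'k R)" by simp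
  moreover have "forms_independent (mvar :: 3 \<Rightarrow> 'k R)"
    by (simp add: forms_independent_def msubst_eq_meval meval_id)
  ultimately have e0: "e i = 0" for i using no_constant_syzygy by blast
  have "at_zero {0, 1} (p $ i) = meval mconst (\<lambda>v. mvar 2 * z v) (p $ i)"
    unfolding at_zero_def msubst_eq_meval
  proof (rule meval_cong)
    fix v :: 3 show "(if v \<in> {0, 1} then 0 else mvar v) = mvar 2 * z v"
      by (cases v rule: cases_3) (simp_all add: z_def)
  qed
  also have "\<dots> = mvar 2 ^ n * msubst z (p $ i)"
    unfolding msubst_eq_meval by (rule meval_scale_homogeneous[OF ring_map_mconst hom])
  finally show ?thesis by (simp add: z e0 ring_map_zero[OF ring_map_mconst])
qed

text \<open>
  In the new coordinates the ideal of entries is (x_0, x_1), since p vanishes at x_0 = x_1 = 0.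
\<close>

lemma height_entry_ideal:
  fixes \<phi> :: "'k::field R ^ 2 ^ 3"
  assumes cc: "coordinate_change M N \<phi> p" and p: "\<And>i. at_zero {0, 1} (p $ i) = 0"
  shows "height (entry_ideal \<phi>) = 2"
proof -
  let ?\<tau> = "linear_change M"
  obtain M' N' where M: "M ** M' = mat 1" "M' ** M = mat 1" and N: "N' ** N = mat 1"
    using cc by (auto simp: coordinate_change_iff invertible_def)
  let ?\<tau>' = "linear_change M'"
  have inv: "?\<tau> (?\<tau>' q) = q" "?\<tau>' (?\<tau> q) = q" for q
    using M by (simp_all add: linear_change_inverse)
  have col: "change N M (\<lambda>i. \<phi> $ i $ 0) = standard_column" "change N M (\<lambda>i. \<phi> $ i $ 1) = ($) p"
    using cc by (simp_all add: coordinate_change_iff)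
  let ?K = "{q. at_zero {0, 1} (?\<tau> q) = 0}"
  note rK = ring_map_comp[OF at_zero_simps(1)[of "{0, 1}"] ring_map_linear_change[of M]]
  have K_ideal: "is_ideal ?K" using is_prime_ideal_kernel[OF rK] by (simp add: is_prime_ideal_def)
  have col': "?\<tau> (a i) = combine N' (change N M a) i" for a i
    by (simp add: change_def combine_combine N combine_mat_1)
  have "entry_ideal \<phi> \<subseteq> ?K"
    unfolding entry_ideal_def
  proof (rule ideal_gen_least[OF _ K_ideal], clarify)
    fix i :: 3 and j :: 2
    have st: "at_zero {0, 1} (standard_column k) = (0 :: 'k R)" for k
      by (simp add: standard_column_def at_zero_simps ring_map_simps[OF at_zero_simps(1)])
    have c: "at_zero {0, 1} (combine N' a i) = 0" if "\<And>k. at_zero {0, 1} (a k) = 0" for a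
      by (simp add: ring_map_combine[OF at_zero_simps(1)] that)
    consider "j = 0" | "j = 1" using exhaust_2[of j] by force
    then show "at_zero {0, 1} (?\<tau> (\<phi> $ i $ j)) = 0"
    proof cases
      case 1
      then show ?thesis using col'[of "\<lambda>i. \<phi> $ i $ 0" i] c[OF st] by (simp add: col)
    next
      case 2
      then show ?thesis using col'[of "\<lambda>i. \<phi> $ i $ 1" i] c[OF p] by (simp add: col)
    qed
  qed
  moreover have "?K \<subseteq> entry_ideal \<phi>"
  proof
    fix q assume "q \<in> ?K"
    then obtain u v where uv: "?\<tau> q = u * mvar 0 + v * mvar 1" using at_zero_01 by blast
    have I: "is_ideal (entry_ideal \<phi>)" unfolding entry_ideal_def by (rule is_ideal_gen)
    have "?\<tau>' (change N M (\<lambda>i. \<phi> $ i $ 0) k) = (\<Sum>i\<in>UNIV. mconst (N $ k $ i) * \<phi> $ i $ 0)" for k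
      unfolding change_def ring_map_combine[OF ring_map_linear_change] inv
      by (simp add: linear_change_eq msubst_simps)
    moreover have "(\<Sum>i\<in>UNIV. mconst (N $ k $ i) * \<phi> $ i $ 0) \<in> entry_ideal \<phi>" for k
    proof -
      have "mconst (N $ k $ i) * \<phi> $ i $ 0 \<in> entry_ideal \<phi>" for i
        using I ideal_gen_base[of "\<phi> $ i $ 0" "{\<phi> $ i $ j |i j. True}"]
        unfolding entry_ideal_def is_ideal_iff by blast
      then show ?thesis using I unfolding is_ideal_iff sum_UNIV_3 by blast
    qed
    ultimately have "?\<tau>' (standard_column k) \<in> entry_ideal \<phi>" for k by (simp add: col)
    from this[of 0] this[of 1] have "?\<tau>' (mvar 0) \<in> entry_ideal \<phi>" "- ?\<tau>' (mvar 1) \<in> entry_ideal \<phi>"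
      by (simp_all add: standard_column_def ring_map_uminus[OF ring_map_linear_change])
    then have "?\<tau>' u * ?\<tau>' (mvar 0) + (- ?\<tau>' v) * (- ?\<tau>' (mvar 1)) \<in> entry_ideal \<phi>"
      using I unfolding is_ideal_iff by blast
    moreover have "q = ?\<tau>' u * ?\<tau>' (mvar 0) + (- ?\<tau>' v) * (- ?\<tau>' (mvar 1))"
      using arg_cong[OF uv, of ?\<tau>'] by (simp add: ring_map_simps[OF ring_map_linear_change] inv)
    ultimately show "q \<in> entry_ideal \<phi>" by simp
  qed
  ultimately have "entry_ideal \<phi> = ?K" by (rule equalityI)
  then show ?thesis
    using height_of_linear_pair[OF ring_map_linear_change ring_map_linear_change inv] by simp
qed

theorem theorem5p14:
  fixes f :: "'k::field R ^ 3"
    and \<phi> :: "'k R ^ 2 ^ 3"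
    and d \<mu>1 \<mu>2 :: nat
  assumes "rational_map d f"
    and "dominant f"
    and "saturated (base_ideal f)"
    and "dim_quotient (base_ideal f) = 1"
    and "hilbert_burch_presentation \<mu>1 \<mu>2 f \<phi>"
    and "\<mu>1 + \<mu>2 = d"
    and "\<mu>1 \<le> \<mu>2"
    and "\<mu>1 = 1"
    and "d \<ge> 3"
  shows "(birational f \<longleftrightarrow>
            height (entry_ideal \<phi>) = 2 \<and> some_sylvester_number \<phi> (d - 2)) \<and>
         (birational f \<longleftrightarrow>
            height (entry_ideal \<phi>) = 2 \<and> every_sylvester_number \<phi> (d - 2))"
proof -
  define n where "n = \<mu>2"
  have n: "n \<ge> 2" "d - 2 = n - 1" using assms(6,8,9) by (simp_all add: n_def)
  have syz: "syzygy_basis (($) f) (\<lambda>i. \<phi> $ i $ 0) (\<lambda>i. \<phi> $ i $ 1)"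
    by (rule syzygy_basis_of_hilbert_burch[OF assms(5)])
  have hom: "homogeneous 1 (\<phi> $ i $ 0)" "homogeneous n (\<phi> $ i $ 1)" for i
    using assms(5,8) by (simp_all add: hilbert_burch_presentation_def n_def)
  have ind: "forms_independent (($) f)" by (rule forms_independent_of_dominant[OF assms(2)])
  have bir: "birational f \<longleftrightarrow> has_inverse (($) f)"
    by (rule birational_iff_has_inverse[OF assms(1,2)])
  have cc: "(\<forall>i. homogeneous n (p $ i)) \<and> restrict_incidence (g2 p) \<noteq> 0 \<and>
      (birational f \<longleftrightarrow> degree (restrict_incidence (g2 p)) = 1)"
    if c: "coordinate_change M N \<phi> p" for M N p
  proof -
    obtain N' where N: "N ** N' = mat 1" "N' ** N = mat 1" and M: "invertible M"
      and col: "change N M (\<lambda>i. \<phi> $ i $ 0) = standard_column" "change N M (\<lambda>i. \<phi> $ i $ 1) = ($) p"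
      using c by (auto simp: coordinate_change_iff invertible_def)
    define f' where "f' = change (transpose N') M (($) f)"
    have T: "invertible (transpose N')"
    proof -
      have "invertible N'" using N by (auto simp: invertible_def)
      then show ?thesis by (simp add: invertible_det_nz)
    qed
    have syz': "syzygy_basis f' standard_column (($) p)"
      using syzygy_basis_change[OF syz M N] by (simp add: f'_def col)
    have ind': "forms_independent f'" unfolding f'_def by (rule forms_independent_change[OF ind T M])
    have "homogeneous n (change N M (\<lambda>i. \<phi> $ i $ 1) i)" for i by (rule homogeneous_change) (rule hom(2))
    then have hom': "homogeneous n (p $ i)" for i by (simp add: col)
    have "birational f \<longleftrightarrow> has_inverse f'"
      unfolding bir f'_def has_inverse_change_iff[OF T M] ..
    also have "\<dots> \<longleftrightarrow> degree (restrict_incidence (g2 p)) = 1"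
      using has_inverse_iff_degree_eliminant[OF syz' ind' hom'] n(1) by simp
    finally show ?thesis
      using hom' eliminant_nonzero[OF syz' forms_independent_nonzero[OF ind']] by blast
  qed
  have some: "birational f" if "some_sylvester_number \<phi> (d - 2)"
  proof -
    obtain M N p F where c: "coordinate_change M N \<phi> p" "sylvester_run p (n - 1) F"
      using \<open>some_sylvester_number \<phi> (d - 2)\<close> by (auto simp: some_sylvester_number_def n(2))
    then have "degree (restrict_incidence (g2 p)) = n - (n - 1)"
      using sylvester_run_length cc[OF c(1)] by blast
    then show ?thesis using cc[OF c(1)] n(1) by simp
  qed
  have every: "height (entry_ideal \<phi>) = 2 \<and> every_sylvester_number \<phi> (d - 2)" if b: "birational f"
  proof -
    have "\<exists>M N N'. invertible M \<and> N ** N' = mat 1 \<and> N' ** N = mat 1 \<and>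
        change N M (\<lambda>i. \<phi> $ i $ 0) = standard_column"
      using standard_form_of_inverse[OF syz ind hom n(1)] b bir by blast
    then obtain M N where MN: "invertible M" "invertible N" "change N M (\<lambda>i. \<phi> $ i $ 0) = standard_column"
      by (auto simp: invertible_def)
    then have c: "coordinate_change M N \<phi> (\<chi> i. change N M (\<lambda>i. \<phi> $ i $ 1) i)"
      by (simp add: coordinate_change_iff fun_eq_iff)
    have "degree (restrict_incidence (g2 (\<chi> i. change N M (\<lambda>i. \<phi> $ i $ 1) i))) < n"
      using cc[OF c] b n(1) by simp
    then have "height (entry_ideal \<phi>) = 2"
      using height_entry_ideal[OF c] vanishing_at_node[of n] cc[OF c] by blast
    moreover have "(\<exists>F. sylvester_run p (d - 2) F) \<and> (\<forall>m F. sylvester_run p m F \<longrightarrow> m = d - 2)"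
      if c': "coordinate_change M N \<phi> p" for M N p
    proof (intro conjI allI impI)
      have deg: "degree (restrict_incidence (g2 p)) = 1" using cc[OF c'] b by blast
      show "\<exists>F. sylvester_run p (d - 2) F"
        using sylvester_run_exists[of n p] cc[OF c'] deg by (simp add: n(2))
      show "m = d - 2" if "sylvester_run p m F" for m F
        using sylvester_run_length[of n p m F] cc[OF c'] that deg n by simp
    qed
    ultimately show ?thesis using c unfolding every_sylvester_number_def by blast
  qed
  have "some_sylvester_number \<phi> (d - 2)" if "every_sylvester_number \<phi> (d - 2)"
    using that unfolding every_sylvester_number_def some_sylvester_number_def by blast
  then show ?thesis using some every by blast
qed

end
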